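(* Let $x,y,z$ be non-negative integers and $\mathbf{a}=(a_1,\dots,a_n)$ a sequence of positive integers with $y+2\operatorname{O}(\mathbf{a})\ge a_1+1$. Write $s=\mathbf{s}_n(\mathbf{a})$, $E=\operatorname{E}(\mathbf{a})$, $O=\operatorname{O}(\mathbf{a})$, and set $a_k:=0$ for $k>n$. If $y$ is odd, then \[ \operatorname{M}(\mathcal{R}'_{x,y,z}(\mathbf{a}))=\prod_{i=1}^{\frac{y-1}{2}}(2x+2i-1)_{2s+2y+2z-4i+1}\cdot\frac{1}{2^{y-1}}\frac{\operatorname{H}(s+y+z-1)\operatorname{H}_2(y)\operatorname{H}_2(2E+2z+1)\operatorname{H}_2(2O+1)\operatorname{H}_2(2s+y+2z)}{\operatorname{H}(s+z)\operatorname{H}_2(2E+y+2z)\operatorname{H}_2(2O+y)\operatorname{H}_2(2s+2y+2z-1)} \] \[ \times\operatorname{Q}'\Big(x+\tfrac{y-1}{2}+a_{2\lfloor\frac{n+1}{2}\rfloor},a_{2\lfloor\frac{n+1}{2}\rfloor-1},\dots,a_1\Big)\operatorname{Q}'\Big(x+\tfrac{y-1}{2}+a_{2\lfloor\frac{n}{2}\rfloor+1},a_{2\lfloor\frac{n}{2}\rfloor},\dots,a_1,z\Big), \] and if $y$ is even, then \[ \operatorname{M}(\mathcal{R}'_{x,y,z}(\mathbf{a}))=\prod_{i=1}^{\frac{y}{2}}(2x+2i-1)_{2s+2y+2z-4i+1}\cdot\frac{\operatorname{H}(s+y+z)\operatorname{H}_2(y)\operatorname{H}_2(2E+2z)\operatorname{H}_2(2O)\operatorname{H}_2(2s+y+2z)}{\operatorname{H}(s+z)\operatorname{H}_2(2E+y+2z)\operatorname{H}_2(2O+y)\operatorname{H}_2(2s+2y+2z)}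 \] \[ \times\operatorname{K}'\Big(x+\tfrac{y}{2}+a_{2\lfloor\frac{n+1}{2}\rfloor},a_{2\lfloor\frac{n+1}{2}\rfloor-1},\dots,a_1\Big)\operatorname{K}'\Big(x+\tfrac{y}{2}+a_{2\lfloor\frac{n}{2}\rfloor+1},a_{2\lfloor\frac{n}{2}\rfloor},\dots,a_1,z\Big). \] Empty products are $1$.
   Context: Work on the triangular lattice drawn with horizontal lattice lines; unit triangles are up- or down-pointing. A lozenge is the union of two unit triangles sharing an edge; a tiling of a region is a covering by lozenges without gaps or overlaps; for weighted lozenges, $\operatorname{M}(R)$ is the sum over all tilings of $R$ of the product of the weights of their lozenges (the number of tilings if unweighted). A vertical lozenge is the union of an up- and a down-pointing unit triangle sharing a horizontal edge. A "vertical zigzag western side with $N$ unit segments": from the north-west corner, the western boundary consists of $N$ unit segments alternately in the south-west and south-east directions, the first going south-west. "Weighting the western vertical lozenges by $\frac12$": for each $i$, the vertical lozenge formed by the leftmost unit triangle of row $2i-1$ and that of row $2i$ (rows counted from the top) gets weight $\frac12$, all other lozenges weight $1$. For a sequence $\mathbf{b}=(b_1,\dots,b_m)$: $\operatorname{E}(\mathbf{b})=\sum_{i\text{ even}}b_i$, $\operatorname{O}(\mathbf{b})=\sum_{i\text{ odd}}b_i$, $\mathbf{s}_k(\mathbf{b})=\sum_{i\le k}b_i$. $\operatorname{H}(n)=0!\,1!\cdots(n-1)!$; $\operatorname{H}_2(n)=0!\,2!\cdots(n-2)!$ for even $n$ and $1!\,3!\cdots(n-2)!$ for odd $n$ (empty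 products $=1$). Pochhammer symbol: $(u)_m=u(u+1)\cdots(u+m-1)$ for $m>0$, $(u)_0=1$, $(u)_m=1/((u-1)(u-2)\cdots(u+m))$ for $m<0$. $\mathcal{Q}(\mathbf{t})$, for $\mathbf{t}=(t_1,\dots,t_{2l})$ non-negative: region with northern side $\operatorname{O}(\mathbf{t})$, straight northeastern side $2\operatorname{E}(\mathbf{t})$, southern side $\operatorname{E}(\mathbf{t})+\operatorname{O}(\mathbf{t})$, vertical zigzag western side with $2\operatorname{E}(\mathbf{t})$ unit segments; along the southern side from left to right, leave a segment $t_1$, remove the up-pointing triangle of side $t_2$ resting on the southern side, leave $t_3$, remove an up-pointing triangle of side $t_4$, etc. $\mathcal{K}(\mathbf{t})$: same but with northeastern side $2\operatorname{E}(\mathbf{t})-1$ and zigzag western side with $2\operatorname{E}(\mathbf{t})-1$ unit segments. $\mathcal{Q}'(\mathbf{t})$, $\mathcal{K}'(\mathbf{t})$: these regions with the western vertical lozenges weighted $\frac12$; $\operatorname{Q}'(\mathbf{t})=\operatorname{M}(\mathcal{Q}'(\mathbf{t}))$, $\operatorname{K}'(\mathbf{t})=\operatorname{M}(\mathcal{K}'(\mathbf{t}))$. $\mathcal{R}_{x,y,z}(\mathbf{a})$: start from the region with northern side $x+\operatorname{E}(\mathbf{a})$, northeastern side $y+z+2\operatorname{O}(\mathbf{a})-1$, southeastern side $y+z+2\operatorname{E}(\mathbf{a})-1$, southern side $x+\operatorname{O}(\mathbf{a})$, and vertical zigzag western side with $2(y+z+\mathbf{s}_n(\mathbf{a})-1)$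 unit segments. Let $V$ be its eastern vertex, $\ell$ the horizontal lattice line $z$ units above $V$, and $P$ the point where $\ell$ meets the northeastern side. Going left from $P$ along $\ell$, mark consecutive segments of lengths $a_1,\dots,a_n$; remove the up-pointing triangle with the $i$-th segment as base for odd $i$ and the down-pointing triangle with the $i$-th segment as top side for even $i$. $\mathcal{R}'_{x,y,z}(\mathbf{a})$ is $\mathcal{R}_{x,y,z}(\mathbf{a})$ with the western vertical lozenges weighted $\frac12$. *)

theory Defs
  imports Complex_Main "HOL-Library.Disjoint_Sets"
begin

section \<open>The triangular lattice, lozenges, and weighted tilings\<close>

text \<open>
  A unit triangle is encoded by a pair \<open>(r, p)\<close>. Here \<open>r\<close> is its row, counted from the top, and \<open>p\<close>
  is the horizontal position of its centre, measured in half-units. The triangle spans the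
  horizontal range from \<open>p - 1\<close> to \<open>p + 1\<close>. Line \<open>j\<close> is the horizontal lattice line below row \<open>j\<close>,
  and line \<open>0\<close> is the top of row \<open>1\<close>. The lattice points on line \<open>j\<close> are those whose half-unit
  position has the parity of \<open>j\<close>, so row \<open>r\<close> consists of alternating up- and down-pointing triangles,
  and \<open>(r, p)\<close> points up iff its apex, at position \<open>p\<close>, is a lattice point of line \<open>r - 1\<close>.
  All regions below have their north-west corner at position \<open>0\<close> of line \<open>0\<close>.
\<close>

type_synonym triangle = "int \<times> int"

definition up_pointing :: "triangle \<Rightarrow> bool" where
  "up_pointing t \<longleftrightarrow> odd (fst t + snd t)"

text \<open>Horizontal neighbours share a slanted edge; an up-pointing triangle \<open>(r, p)\<close> shares its
  horizontal edge with the down-pointing triangle \<open>(r + 1, p)\<close>.\<close>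

definition vertical_lozenge :: "triangle set \<Rightarrow> bool" where
  "vertical_lozenge L \<longleftrightarrow> (\<exists>r p. up_pointing (r, p) \<and> L = {(r, p), (r + 1, p)})"

definition lozenge :: "triangle set \<Rightarrow> bool" where
  "lozenge L \<longleftrightarrow> vertical_lozenge L \<or> (\<exists>r p. L = {(r, p), (r, p + 1)})"

definition tilings :: "triangle set \<Rightarrow> triangle set set set" where
  "tilings R = {T. partition_on R T \<and> (\<forall>L\<in>T. lozenge L)}"

definition tiling_sum :: "(triangle set \<Rightarrow> real) \<Rightarrow> triangle set \<Rightarrow> real" where
  "tiling_sum w R = (\<Sum>T\<in>tilings R. \<Prod>L\<in>T. w L)"

text \<open>In every region below, the leftmost unit triangle of each row \<open>r\<close> (before dents are removed) is
  \<open>(r, 0)\<close>; it points up in odd rows and down in even rows.\<close>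

definition west_weight :: "triangle set \<Rightarrow> real" where
  "west_weight L = (if \<exists>i\<ge>1. L = {(2 * i - 1, 0), (2 * i, 0)} then 1 / 2 else 1)"


section \<open>Sequences and products of factorials\<close>

text \<open>Sequences are lists, indexed from \<open>1\<close> and extended by \<open>0\<close>.\<close>

definition term_of :: "nat list \<Rightarrow> nat \<Rightarrow> nat" where
  "term_of b k = (if 1 \<le> k \<and> k \<le> length b then b ! (k - 1) else 0)"

definition E_sum :: "nat list \<Rightarrow> nat" where
  "E_sum b = (\<Sum>i\<in>{i. 1 \<le> i \<and> i \<le> length b \<and> even i}. term_of b i)"

definition O_sum :: "nat list \<Rightarrow> nat" where
  "O_sum b = (\<Sum>i\<in>{i. 1 \<le> i \<and> i \<le> length b \<and> odd i}. term_of b i)"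

definition s_sum :: "nat \<Rightarrow> nat list \<Rightarrow> nat" where
  "s_sum k b = (\<Sum>i=1..k. term_of b i)"

definition H :: "nat \<Rightarrow> real" where
  "H n = (\<Prod>k<n. fact k)"

text \<open>The factors are \<open>(n-2)!, (n-4)!, \<dots>\<close>, down to \<open>0!\<close> for even \<open>n\<close> and to \<open>1!\<close> for odd \<open>n\<close>.\<close>

definition H2 :: "nat \<Rightarrow> real" where
  "H2 n = (\<Prod>i=1..n div 2. fact (n - 2 * i))"


section \<open>Regions\<close>

text \<open>
  The region with vertical zigzag western side, northern side \<open>N\<close>, north-eastern side \<open>ne\<close> and
  south-eastern side \<open>se\<close>. On line \<open>j\<close> the western boundary is at half-unit position \<open>0\<close> (even \<open>j\<close>) or
  \<open>-1\<close> (odd \<open>j\<close>). The eastern boundary is at \<open>2 N + j\<close> for \<open>j \<le> ne\<close> and at \<open>2 N + 2 ne - j\<close> for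
  \<open>j \<ge> ne\<close>. The last triangle of row \<open>r\<close> therefore points up, with right corner at \<open>2 N + r\<close>, if
  \<open>r \<le> ne\<close>, and points down, with right corner at \<open>2 N + 2 ne - (r - 1)\<close>, if \<open>r > ne\<close>.
  The numbers \<open>N, ne, se\<close> determine the southern side and the \<open>ne + se\<close> unit segments of the
  zigzag side.
\<close>

definition zigzag_region :: "nat \<Rightarrow> nat \<Rightarrow> nat \<Rightarrow> triangle set" where
  "zigzag_region N ne se = {(r, p). 1 \<le> r \<and> r \<le> int ne + int se \<and> 0 \<le> p \<and>
     p \<le> (if r \<le> int ne then 2 * int N + r - 1 else 2 * int N + 2 * int ne - r)}"

text \<open>The up-pointing (down-pointing) triangle of side \<open>k\<close> whose base (top side) lies on line \<open>j\<close> and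
  extends from half-unit position \<open>c\<close> to \<open>c + 2 k\<close>. The inequalities have no solution in \<open>p\<close> more
  than \<open>k\<close> rows away from line \<open>j\<close>.\<close>

definition up_triangle :: "int \<Rightarrow> int \<Rightarrow> nat \<Rightarrow> triangle set" where
  "up_triangle j c k = {(r, p). r \<le> j \<and> c + (j - r) < p \<and> p < c + 2 * int k - (j - r)}"

definition down_triangle :: "int \<Rightarrow> int \<Rightarrow> nat \<Rightarrow> triangle set" where
  "down_triangle j c k =
     {(r, p). r > j \<and> c + (r - j - 1) < p \<and> p < c + 2 * int k - (r - j - 1)}"

text \<open>The common shape of \<open>\<Q>(t)\<close> and \<open>\<K>(t)\<close>: \<open>h\<close> rows, straight north-eastern side, and dents along
  line \<open>h\<close>, whose western end is at half-unit position \<open>- (h mod 2)\<close>.\<close>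

definition dented_region :: "nat \<Rightarrow> nat list \<Rightarrow> triangle set" where
  "dented_region h t = zigzag_region (O_sum t) h 0 -
     (\<Union>i\<in>{i. 1 \<le> i \<and> i \<le> length t \<and> even i}.
        up_triangle (int h) (- int (h mod 2) + 2 * int (s_sum (i - 1) t)) (term_of t i))"

definition Q_region :: "nat list \<Rightarrow> triangle set" where
  "Q_region t = dented_region (2 * E_sum t) t"

text \<open>For \<open>E_sum t = 0\<close> the height \<open>2 * E_sum t - 1\<close> is truncated to \<open>0\<close>, and the region is empty (one
  tiling).\<close>

definition K_region :: "nat list \<Rightarrow> triangle set" where
  "K_region t = dented_region (2 * E_sum t - 1) t"

definition Q' :: "nat list \<Rightarrow> real" where
  "Q' t = tiling_sum west_weight (Q_region t)"

definition K' :: "nat list \<Rightarrow> real" where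
  "K' t = tiling_sum west_weight (K_region t)"

text \<open>
  The eastern vertex lies on line \<open>y + z + 2 O - 1\<close>, so the fern lies on line \<open>j = y + 2 O - 1\<close>, which
  meets the north-eastern side at half-unit position \<open>2 N + j\<close>, where \<open>N\<close> is the northern side.
  Under \<open>y + 2 O \<ge> a\<^sub>1 + 1\<close> and \<open>a\<^sub>i > 0\<close>, the only subtraction below that can truncate is in the
  south-eastern side when \<open>y = z = E = 0\<close>, where the prescribed length would be \<open>-1\<close>. It is then
  read as \<open>0\<close>: the eastern vertex, the line carrying the fern and the southern side share one line,
  and the zigzag side has \<open>2 O - 1\<close> segments. The lozenges of the bottom row of that region are forced
  and have weight \<open>1\<close>, so discarding this row, to get the prescribed \<open>2 (O - 1)\<close> zigzag segments, does
  not change the weighted count.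
\<close>

definition R_region :: "nat \<Rightarrow> nat \<Rightarrow> nat \<Rightarrow> nat list \<Rightarrow> triangle set" where
  "R_region x y z a =
    (let N = x + E_sum a;
         j = int (y + 2 * O_sum a - 1);
         P = 2 * int N + j
     in zigzag_region N (y + z + 2 * O_sum a - 1) (y + z + 2 * E_sum a - 1) -
        (\<Union>i\<in>{1..length a}.
           (if odd i then up_triangle else down_triangle)
             j (P - 2 * int (s_sum i a)) (term_of a i)))"

definition R' :: "nat \<Rightarrow> nat \<Rightarrow> nat \<Rightarrow> nat list \<Rightarrow> real" where
  "R' x y z a = tiling_sum west_weight (R_region x y z a)"

text \<open>\<open>rev_prefix a k\<close> is the sequence \<open>a\<^sub>k, a\<^sub>k\<^sub>-\<^sub>1, \<dots>, a\<^sub>1\<close> (with \<open>a\<^sub>i = 0\<close> for \<open>i > length a\<close>).\<close>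

definition rev_prefix :: "nat list \<Rightarrow> nat \<Rightarrow> nat list" where
  "rev_prefix a k = map (term_of a) (rev [1..<k + 1])"

end

theory Submission
  imports Defs "Jordan_Normal_Form.Determinant"
begin

text \<open>
  Cut the region along the line carrying the fern. The vertical lozenges crossing this line occupy a
  set \<open>S\<close> of \<open>\<lfloor>y / 2\<rfloor>\<close> of the \<open>m = x + \<lfloor>y / 2\<rfloor>\<close> free positions west of the fern, and what remains of a tiling
  tiles two trapezoids (the lower one upside down) with unit dents at \<open>S \<union> D\<^sub>1\<close> and \<open>S \<union> D\<^sub>2\<close>, where \<open>D\<^sub>1\<close>
  and \<open>D\<^sub>2\<close> partition the \<open>s + z\<close> positions following the free ones.

  In a trapezoid the vertical lozenges on consecutive lines interlace. Summing a determinant of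
  central factorials over interlacing positions gives such a determinant again, so the weighted count
  is a Vandermonde product in the squares of the dent positions. The products over \<open>D\<^sub>1\<close> and \<open>D\<^sub>2\<close> alone
  are the two factors \<open>Q'\<close> (or \<open>K'\<close>), and the remaining sum over \<open>S\<close> depends on the fern only through
  \<open>s + z\<close>. It can therefore be evaluated for the empty fern: then the region is a half hexagon, that is,
  a trapezoid without a corner triangle, and its count is a single Vandermonde product.
\<close>

section \<open>Weighted tilings\<close>

text \<open>The zigzag side acts as a reflecting wall. Halve the horizontal coordinate: crossings on
  odd lines then sit at integers, on even lines at half-integers. The entries \<open>cfe j\<close>
  are even and \<open>cfo j\<close> odd in this coordinate, so summing \<open>cfe j\<close> from the
  wall gives a value of \<open>cfo j\<close> exactly when the point \<open>0\<close> has weight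
  \<open>1 / 2\<close>, while sums of \<open>cfo j\<close> need no weight. This is where the weight
  enters, and why squares of positions appear. The sum over \<open>S\<close> is never attacked
  directly. Its only link to the fern consists of the factors between \<open>S\<close> and the two
  dent sets, and these multiply to a product over the whole interval of \<open>s + z\<close>
  positions. Comparing two counts of the empty fern, with \<open>s + z\<close> in place of
  \<open>z\<close>, determines the sum by division; this needs \<open>y >= 1\<close>, and for
  \<open>y = 0\<close> only \<open>S = {}\<close> occurs. Both halves are handled by the same
  lemmas: the lower one, upside down, lacks a corner triangle of side \<open>z\<close>, which is
  prepended to the fern. This swaps the parities, so that the down-pointing triangles of
  \<open>a\<close> become odd-numbered in \<open>z # a\<close>.\<close>

lemma finite_tilings:
  assumes "finite R"
  shows "finite (tilings R)"
proof (rule finite_subset)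
  show "tilings R \<subseteq> Pow (Pow R)"
    by (auto simp: tilings_def partition_on_def)
qed (use assms in simp)

lemma tilings_empty [simp]: "tilings {} = {{}}"
  by (auto simp: tilings_def partition_on_def)

lemma tiling_sum_empty [simp]: "tiling_sum w {} = 1"
  by (simp add: tiling_sum_def)

lemma lozenge_nonempty: "lozenge L \<Longrightarrow> L \<noteq> {}"
  by (auto simp: lozenge_def vertical_lozenge_def)

lemma tilings_iff:
  "T \<in> tilings R \<longleftrightarrow> \<Union>T = R \<and> disjoint T \<and> (\<forall>L\<in>T. lozenge L)"
  by (auto simp: tilings_def partition_on_def dest: lozenge_nonempty)

lemma tiling_sum_eq_0:
  assumes "t \<in> R" "\<And>L. lozenge L \<Longrightarrow> L \<subseteq> R \<Longrightarrow> t \<notin> L"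
  shows "tiling_sum w R = 0"
proof -
  have "tilings R = {}"
    using assms by (auto simp: tilings_iff) (metis Union_upper)
  then show ?thesis by (simp add: tiling_sum_def)
qed

text \<open>Sort the lozenges of a tiling by whether they lie in \<open>A\<close>, lie in
  \<open>B\<close> or straddle both. Once the straddling set \<open>C\<close> is fixed, the two
  remainders are tiled independently.\<close>

lemma tiling_sum_Un:
  assumes "finite A" "finite B" and AB: "A \<inter> B = {}"
  shows "tiling_sum w (A \<union> B) =
    (\<Sum>C\<in>{C. (\<forall>L\<in>C. lozenge L \<and> L \<inter> A \<noteq> {} \<and> L \<inter> B \<noteq> {}) \<and> disjoint C \<and> \<Union>C \<subseteq> A \<union> B}.
       (\<Prod>L\<in>C. w L) * tiling_sum w (A - \<Union>C) * tiling_sum w (B - \<Union>C))"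
    (is "_ = (\<Sum>C\<in>?C. _)")
proof -
  let ?S = "SIGMA C:?C. tilings (A - \<Union>C) \<times> tilings (B - \<Union>C)"
  have finC: "finite ?C"
    by (rule finite_subset[of _ "Pow (Pow (A \<union> B))"]) (use assms in auto)
  have "tiling_sum w (A \<union> B) =
      (\<Sum>(C, T, U)\<in>?S. (\<Prod>L\<in>C. w L) * (\<Prod>L\<in>T. w L) * (\<Prod>L\<in>U. w L))"
    unfolding tiling_sum_def
  proof (rule sum.reindex_bij_witness[where
        j = "\<lambda>T. ({L\<in>T. L \<inter> A \<noteq> {} \<and> L \<inter> B \<noteq> {}}, {L\<in>T. L \<subseteq> A}, {L\<in>T. L \<subseteq> B})" and
        i = "\<lambda>(C, T, U). C \<union> T \<union> U"])
    fix T assume T: "T \<in> tilings (A \<union> B)"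
    then have U: "\<Union>T = A \<union> B" and d: "disjoint T" and l: "\<And>L. L \<in> T \<Longrightarrow> lozenge L"
      by (auto simp: tilings_iff)
    let ?C0 = "{L\<in>T. L \<inter> A \<noteq> {} \<and> L \<inter> B \<noteq> {}}"
    have split: "T = ?C0 \<union> {L\<in>T. L \<subseteq> A} \<union> {L\<in>T. L \<subseteq> B}"
      using U by blast
    show "(case ({L\<in>T. L \<inter> A \<noteq> {} \<and> L \<inter> B \<noteq> {}}, {L\<in>T. L \<subseteq> A}, {L\<in>T. L \<subseteq> B}) of
        (C, T, U) \<Rightarrow> C \<union> T \<union> U) = T"
      using split by simp
    have disj: "K \<inter> L = {}" if "K \<in> T" "L \<in> T" "K \<noteq> L" for K L
      using d that by (auto simp: disjoint_def)
    have sub: "disjoint T'" if "T' \<subseteq> T" for T'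
      using d that by (auto simp: disjoint_def)
    have "\<Union>{L\<in>T. L \<subseteq> A} = A - \<Union>?C0"
    proof (intro equalityI subsetI)
      fix t assume "t \<in> \<Union>{L\<in>T. L \<subseteq> A}"
      then obtain L where L: "L \<in> T" "L \<subseteq> A" "t \<in> L" by blast
      have "t \<notin> K" if "K \<in> ?C0" for K
        using disj[of K L] that L AB by blast
      then show "t \<in> A - \<Union>?C0" using L by blast
    next
      fix t assume t: "t \<in> A - \<Union>?C0"
      then have "t \<in> \<Union>T" using U by simp
      then obtain L where L: "L \<in> T" "t \<in> L" by blast
      then have "L \<inter> B = {}" using t by blast
      moreover have "L \<subseteq> A \<union> B" unfolding U[symmetric] using L by blast
      ultimately have "L \<subseteq> A" by blast
      then show "t \<in> \<Union>{L\<in>T. L \<subseteq> A}" using L by blast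
    qed
    moreover have "\<Union>{L\<in>T. L \<subseteq> B} = B - \<Union>?C0"
    proof (intro equalityI subsetI)
      fix t assume "t \<in> \<Union>{L\<in>T. L \<subseteq> B}"
      then obtain L where L: "L \<in> T" "L \<subseteq> B" "t \<in> L" by blast
      have "t \<notin> K" if "K \<in> ?C0" for K
        using disj[of K L] that L AB by blast
      then show "t \<in> B - \<Union>?C0" using L by blast
    next
      fix t assume t: "t \<in> B - \<Union>?C0"
      then have "t \<in> \<Union>T" using U by simp
      then obtain L where L: "L \<in> T" "t \<in> L" by blast
      then have "L \<inter> A = {}" using t by blast
      moreover have "L \<subseteq> A \<union> B" unfolding U[symmetric] using L by blast
      ultimately have "L \<subseteq> B" by blast
      then show "t \<in> \<Union>{L\<in>T. L \<subseteq> B}" using L by blast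
    qed
    ultimately show "({L\<in>T. L \<inter> A \<noteq> {} \<and> L \<inter> B \<noteq> {}}, {L\<in>T. L \<subseteq> A}, {L\<in>T. L \<subseteq> B}) \<in> ?S"
      using l U by (auto simp: tilings_iff intro!: sub)
    have finT: "finite T"
      using U assms by (metis finite_UnI finite_UnionD)
    have "(\<Prod>L\<in>T. w L) = (\<Prod>L\<in>?C0 \<union> {L\<in>T. L \<subseteq> A} \<union> {L\<in>T. L \<subseteq> B}. w L)"
      using split by simp
    also have "\<dots> = (\<Prod>L\<in>?C0. w L) * (\<Prod>L\<in>{L\<in>T. L \<subseteq> A}. w L) * (\<Prod>L\<in>{L\<in>T. L \<subseteq> B}. w L)"
    proof (subst prod.union_disjoint)
      show "(?C0 \<union> {L\<in>T. L \<subseteq> A}) \<inter> {L\<in>T. L \<subseteq> B} = {}"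
        using AB lozenge_nonempty[OF l] by blast
      show "(\<Prod>L\<in>?C0 \<union> {L\<in>T. L \<subseteq> A}. w L) * prod w {L\<in>T. L \<subseteq> B} =
          prod w ?C0 * prod w {L\<in>T. L \<subseteq> A} * prod w {L\<in>T. L \<subseteq> B}"
        by (subst prod.union_disjoint) (use finT AB in auto)
    qed (use finT in auto)
    finally show "(case ({L\<in>T. L \<inter> A \<noteq> {} \<and> L \<inter> B \<noteq> {}}, {L\<in>T. L \<subseteq> A}, {L\<in>T. L \<subseteq> B}) of
        (C, T, U) \<Rightarrow> (\<Prod>L\<in>C. w L) * (\<Prod>L\<in>T. w L) * (\<Prod>L\<in>U. w L)) = (\<Prod>L\<in>T. w L)"
      by simp
  next
    fix X assume X: "X \<in> ?S"
    obtain C T U where XX: "X = (C, T, U)" by (cases X) auto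
    have C: "\<And>L. L \<in> C \<Longrightarrow> lozenge L \<and> L \<inter> A \<noteq> {} \<and> L \<inter> B \<noteq> {}" "disjoint C" "\<Union>C \<subseteq> A \<union> B"
      and T: "\<Union>T = A - \<Union>C" "disjoint T" "\<And>L. L \<in> T \<Longrightarrow> lozenge L"
      and U: "\<Union>U = B - \<Union>C" "disjoint U" "\<And>L. L \<in> U \<Longrightarrow> lozenge L"
      using X XX by (auto simp: tilings_iff)
    have TA: "L \<subseteq> A" if "L \<in> T" for L using that T by blast
    have UB: "L \<subseteq> B" if "L \<in> U" for L using that U by blast
    have C': "\<not> L \<subseteq> A" "\<not> L \<subseteq> B" "L \<inter> A \<noteq> {}" "L \<inter> B \<noteq> {}" if "L \<in> C" for L
      using C(1)[OF that] AB by auto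
    have T': "\<not> L \<subseteq> B" "L \<inter> B = {}" if "L \<in> T" for L
      using TA[OF that] lozenge_nonempty[OF T(3)[OF that]] AB by auto
    have U': "\<not> L \<subseteq> A" "L \<inter> A = {}" if "L \<in> U" for L
      using UB[OF that] lozenge_nonempty[OF U(3)[OF that]] AB by auto
    have eqC: "{L \<in> C \<union> T \<union> U. L \<inter> A \<noteq> {} \<and> L \<inter> B \<noteq> {}} = C"
      using C'(3,4) T'(2) U'(2) by (intro Set.set_eqI) (simp only: mem_Collect_eq Un_iff, metis)
    have eqT: "{L \<in> C \<union> T \<union> U. L \<subseteq> A} = T"
      using C'(1) TA U'(1) by (intro Set.set_eqI) (simp only: mem_Collect_eq Un_iff, metis)
    have eqU: "{L \<in> C \<union> T \<union> U. L \<subseteq> B} = U"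
      using C'(2) T'(1) UB by (intro Set.set_eqI) (simp only: mem_Collect_eq Un_iff, metis)
    show "(\<lambda>T. ({L\<in>T. L \<inter> A \<noteq> {} \<and> L \<inter> B \<noteq> {}}, {L\<in>T. L \<subseteq> A}, {L\<in>T. L \<subseteq> B}))
        (case X of (C, T, U) \<Rightarrow> C \<union> T \<union> U) = X"
      using eqC eqT eqU XX by simp
    have "disjoint (C \<union> T \<union> U)"
    proof (intro disjoint_union C T U)
      show "\<Union>C \<inter> \<Union>T = {}" unfolding T by blast
      show "\<Union>(C \<union> T) \<inter> \<Union>U = {}" unfolding Union_Un_distrib T U using AB by blast
    qed
    then show "(case X of (C, T, U) \<Rightarrow> C \<union> T \<union> U) \<in> tilings (A \<union> B)"
      using C T U XX by (auto simp: tilings_iff)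
  qed
  also have "\<dots> = (\<Sum>C\<in>?C. \<Sum>(T, U)\<in>tilings (A - \<Union>C) \<times> tilings (B - \<Union>C).
      (\<Prod>L\<in>C. w L) * (\<Prod>L\<in>T. w L) * (\<Prod>L\<in>U. w L))"
    by (subst sum.Sigma) (use finC assms in \<open>auto intro!: finite_cartesian_product finite_tilings\<close>)
  also have "\<dots> = (\<Sum>C\<in>?C. (\<Prod>L\<in>C. w L) * tiling_sum w (A - \<Union>C) * tiling_sum w (B - \<Union>C))"
    unfolding tiling_sum_def
    by (intro sum.cong refl)
       (simp add: sum.cartesian_product[symmetric] sum_distrib_left[symmetric] sum_distrib_right[symmetric])
  finally show ?thesis .
qed

lemma tiling_sum_independent:
  assumes "finite A" "finite B" "A \<inter> B = {}"
    and no: "\<And>L. lozenge L \<Longrightarrow> L \<subseteq> A \<union> B \<Longrightarrow> L \<inter> A \<noteq> {} \<Longrightarrow> L \<inter> B = {}"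
  shows "tiling_sum w (A \<union> B) = tiling_sum w A * tiling_sum w B"
proof -
  let ?C = "{C. (\<forall>L\<in>C. lozenge L \<and> L \<inter> A \<noteq> {} \<and> L \<inter> B \<noteq> {}) \<and> disjoint C \<and> \<Union>C \<subseteq> A \<union> B}"
  have "C = {}" if "C \<in> ?C" for C
  proof (rule ccontr)
    assume "C \<noteq> {}"
    then obtain L where "L \<in> C" by blast
    then have "lozenge L" "L \<subseteq> A \<union> B" "L \<inter> A \<noteq> {}" "L \<inter> B \<noteq> {}" using that by auto
    then show False using no by blast
  qed
  moreover have "{} \<in> ?C" by simp
  ultimately have "?C = {{}}" by blast
  then show ?thesis
    using assms by (simp add: tiling_sum_Un)
qed

text \<open>Split \<open>R\<close> into \<open>{t}\<close> and the rest: a lozenge has two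
  triangles, so \<open>{t}\<close> has no tiling of its own and the straddling set has to be
  \<open>{L}\<close>.\<close>

lemma tiling_sum_forced:
  assumes "finite R" "lozenge L" "L \<subseteq> R" "t \<in> L"
    and unique: "\<And>L'. lozenge L' \<Longrightarrow> L' \<subseteq> R \<Longrightarrow> t \<in> L' \<Longrightarrow> L' = L"
  shows "tiling_sum w R = w L * tiling_sum w (R - L)"
proof -
  have two: "\<exists>u. u \<in> K \<and> u \<noteq> t" if K: "lozenge K" for K
  proof -
    consider r p where "K = {(r, p), (r + 1, p)}" | r p where "K = {(r, p), (r, p + 1)}"
      using K unfolding lozenge_def vertical_lozenge_def by blast
    then show ?thesis
    proof cases
      case (1 r p)
      then have "(r, p) \<in> K" "(r + 1, p) \<in> K" "(r + 1, p) \<noteq> (r, p)" by auto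
      then show ?thesis by metis
    next
      case (2 r p)
      then have "(r, p) \<in> K" "(r, p + 1) \<in> K" "(r, p + 1) \<noteq> (r, p)" by auto
      then show ?thesis by metis
    qed
  qed
  have Lt: "L \<inter> (R - {t}) \<noteq> {}" using two[OF assms(2)] assms(3) by blast
  have zero: "tiling_sum w {t} = 0"
  proof (rule tiling_sum_eq_0[of t])
    fix K assume "lozenge K" "K \<subseteq> {t}"
    then show "t \<notin> K" using two[of K] by blast
  qed simp
  let ?C = "{C. (\<forall>L\<in>C. lozenge L \<and> L \<inter> {t} \<noteq> {} \<and> L \<inter> (R - {t}) \<noteq> {}) \<and> disjoint C \<and>
      \<Union>C \<subseteq> {t} \<union> (R - {t})}"
  have tR: "{t} \<union> (R - {t}) = R" using assms by blast
  have "?C \<subseteq> {{}, {L}}"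
  proof
    fix C assume C: "C \<in> ?C"
    have "K = L" if "K \<in> C" for K
    proof (rule unique)
      show "lozenge K" "K \<subseteq> R" "t \<in> K" using C that unfolding tR by auto
    qed
    then show "C \<in> {{}, {L}}" by blast
  qed
  moreover have "{{}, {L}} \<subseteq> ?C" using assms(2-4) Lt unfolding tR by (auto simp: disjoint_def)
  ultimately have "?C = {{}, {L}}" by blast
  moreover have "tiling_sum w R = (\<Sum>C\<in>?C. (\<Prod>L\<in>C. w L) * tiling_sum w ({t} - \<Union>C) *
      tiling_sum w (R - {t} - \<Union>C))"
    using tiling_sum_Un[of "{t}" "R - {t}" w] assms(1) unfolding tR by simp
  moreover have "R - {t} - L = R - L" "{t} - L = {}" using assms(4) by auto
  ultimately show ?thesis by (simp add: zero)
qed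

text \<open>A lozenge meeting both sides of line \<open>j\<close> is vertical and thus determined by
  its position \<open>p\<close>, so the straddling families of \<open>tiling_sum_Un\<close> become
  sets of positions. The parity condition says that \<open>(j, p)\<close> points up.\<close>

lemma tiling_sum_line:
  assumes A: "finite A" "\<And>r p. (r, p) \<in> A \<Longrightarrow> r \<le> j" and B: "finite B" "\<And>r p. (r, p) \<in> B \<Longrightarrow> r > j"
  shows "tiling_sum w (A \<union> B) =
    (\<Sum>S\<in>Pow {p. odd (j + p) \<and> (j, p) \<in> A \<and> (j + 1, p) \<in> B}.
       (\<Prod>p\<in>S. w {(j, p), (j + 1, p)}) * tiling_sum w (A - Pair j ` S) * tiling_sum w (B - Pair (j + 1) ` S))"
proof -
  let ?P = "{p. odd (j + p) \<and> (j, p) \<in> A \<and> (j + 1, p) \<in> B}"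
  let ?C = "{C. (\<forall>L\<in>C. lozenge L \<and> L \<inter> A \<noteq> {} \<and> L \<inter> B \<noteq> {}) \<and> disjoint C \<and> \<Union>C \<subseteq> A \<union> B}"
  let ?v = "\<lambda>p. {(j, p), (j + 1, p)}"
  have notA: "(j + 1, p) \<notin> A" and notB: "(j, p) \<notin> B" for p
    using A(2)[of "j + 1" p] B(2)[of j p] by auto
  have cross: "\<exists>p\<in>?P. L = ?v p" if L: "lozenge L" "L \<inter> A \<noteq> {}" "L \<inter> B \<noteq> {}" "L \<subseteq> A \<union> B" for L
  proof -
    consider r p where "odd (r + p)" "L = {(r, p), (r + 1, p)}" | r p where "L = {(r, p), (r, p + 1)}"
      using L(1) by (auto simp: lozenge_def vertical_lozenge_def up_pointing_def)
    then show ?thesis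
    proof cases
      case 1
      have "r = j"
        using L 1 A(2)[of r p] A(2)[of "r+1" p] B(2)[of r p] B(2)[of "r + 1" p] by auto
      then show ?thesis using 1 L notA notB by auto
    next
      case 2
      then show ?thesis
        using L A(2)[of r p] A(2)[of r "p+1"] B(2)[of r p] B(2)[of r "p+1"] by auto
    qed
  qed
  have loz: "lozenge (?v p)" if "p \<in> ?P" for p
    using that by (auto simp: lozenge_def vertical_lozenge_def up_pointing_def)
  have inj: "inj_on ?v S" for S
    by (auto simp: inj_on_def doubleton_eq_iff)
  have "tiling_sum w (A \<union> B) = (\<Sum>C\<in>?C. (\<Prod>L\<in>C. w L) * tiling_sum w (A - \<Union>C) * tiling_sum w (B - \<Union>C))"
    using A B by (intro tiling_sum_Un) force+
  also have "\<dots> = (\<Sum>S\<in>Pow ?P. (\<Prod>p\<in>S. w (?v p)) * tiling_sum w (A - Pair j ` S) *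
      tiling_sum w (B - Pair (j + 1) ` S))"
  proof (rule sum.reindex_bij_witness[where i = "\<lambda>S. ?v ` S" and j = "\<lambda>C. {p. ?v p \<in> C}"])
    fix C assume C: "C \<in> ?C"
    have sub: "\<exists>p\<in>?P. L = ?v p" if "L \<in> C" for L
      using that C by (intro cross) auto
    show *: "?v ` {p. ?v p \<in> C} = C"
      using sub by auto
    show "{p. ?v p \<in> C} \<in> Pow ?P"
      using sub by (fastforce simp: doubleton_eq_iff)
    have "A - Pair j ` {p. ?v p \<in> C} = A - \<Union>C" "B - Pair (j + 1) ` {p. ?v p \<in> C} = B - \<Union>C"
      using sub notA notB by fastforce+
    moreover have "(\<Prod>p\<in>{p. ?v p \<in> C}. w (?v p)) = (\<Prod>L\<in>?v ` {p. ?v p \<in> C}. w L)"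
      by (subst prod.reindex[OF inj]) simp
    ultimately show "(\<Prod>p\<in>{p. ?v p \<in> C}. w (?v p)) * tiling_sum w (A - Pair j ` {p. ?v p \<in> C}) *
      tiling_sum w (B - Pair (j + 1) ` {p. ?v p \<in> C}) =
      (\<Prod>L\<in>C. w L) * tiling_sum w (A - \<Union>C) * tiling_sum w (B - \<Union>C)"
      using * by simp
  next
    fix S assume S: "S \<in> Pow ?P"
    show "{p. ?v p \<in> ?v ` S} = S"
      by (auto simp: doubleton_eq_iff)
    show "?v ` S \<in> ?C"
      using S loz by (auto simp: disjoint_def)
  qed
  finally show ?thesis .
qed

text \<open>Used to turn the lower half of the region upside down. Weight invariance is asked only
  inside \<open>R\<close>, because \<open>west_weight\<close> singles out the rows from
  \<open>1\<close> on and is not symmetric on the whole plane.\<close>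

lemma tiling_sum_involution:
  assumes f: "\<And>t. f (f t) = t" and loz: "\<And>L. lozenge L \<Longrightarrow> lozenge (f ` L)"
    and w: "\<And>L. lozenge L \<Longrightarrow> L \<subseteq> R \<Longrightarrow> w (f ` L) = w L"
  shows "tiling_sum w (f ` R) = tiling_sum w R"
proof -
  have inj: "inj f" using f by (metis injI)
  have ff: "f ` f ` X = X" for X by (simp add: image_image f)
  have til: "(`) f ` T \<in> tilings (f ` X)" if "T \<in> tilings X" for T X
  proof -
    have "disjoint ((`) f ` T)"
    proof (rule disjointI)
      fix K' L' assume "K' \<in> (`) f ` T" "L' \<in> (`) f ` T" "K' \<noteq> L'"
      then obtain K L where KL: "K \<in> T" "L \<in> T" "K \<noteq> L" "K' = f ` K" "L' = f ` L" by blast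
      then have "K \<inter> L = {}" using that by (auto simp: tilings_iff disjoint_def)
      then show "K' \<inter> L' = {}" using KL by (simp add: image_Int[OF inj, symmetric])
    qed
    then show ?thesis using that loz by (auto simp: tilings_iff)
  qed
  have fff: "(`) f ` (`) f ` T = T" for T by (simp add: image_image f)
  have "(\<Sum>T\<in>tilings (f ` R). \<Prod>L\<in>T. w L) = (\<Sum>T\<in>tilings R. \<Prod>L\<in>T. w L)"
  proof (rule sum.reindex_bij_witness[where i = "\<lambda>T. (`) f ` T" and j = "\<lambda>T. (`) f ` T"])
    fix T assume T: "T \<in> tilings (f ` R)"
    show T': "(`) f ` T \<in> tilings R" using til[OF T] by (simp add: ff)
    have "(\<Prod>L\<in>(`) f ` T. w L) = (\<Prod>L\<in>T. w (f ` L))"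
      by (subst prod.reindex) (auto simp: inj_on_def inj_image_eq_iff[OF inj])
    also have "\<dots> = (\<Prod>L\<in>T. w L)"
    proof (rule prod.cong[OF refl])
      fix L assume L: "L \<in> T"
      then have "f ` L \<subseteq> R" "lozenge (f ` L)" using T' by (auto simp: tilings_iff)
      then show "w (f ` L) = w L" using w[of "f ` L"] by (simp add: ff)
    qed
    finally show "(\<Prod>L\<in>(`) f ` T. w L) = (\<Prod>L\<in>T. w L)" .
  qed (use til fff in auto)
  then show ?thesis by (simp add: tiling_sum_def)
qed

section \<open>Determinants of central factorials\<close>

lemma det_mat_def:
  "det (mat d d f) = (\<Sum>p | p permutes {0..<d}. signof p * (\<Prod>i<d. f (i, p i)))"
  unfolding det_def'[OF mat_carrier]
proof (rule sum.cong[OF refl])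
  fix p assume "p \<in> {p. p permutes {0..<d}}"
  then have "p i < d" if "i < d" for i using that permutes_in_image[of p "{0..<d}" i] by auto
  then show "signof p * (\<Prod>i = 0..<d. mat d d f $$ (i, p i)) = signof p * (\<Prod>i<d. f (i, p i))"
    by (simp add: atLeast0LessThan)
qed

lemma sum_det_rows:
  fixes f :: "nat \<Rightarrow> 'b \<Rightarrow> nat \<Rightarrow> 'a::comm_ring_1"
  assumes "\<And>i. i < d \<Longrightarrow> finite (I i)"
  shows "(\<Sum>s\<in>PiE {..<d} I. det (mat d d (\<lambda>(i, j). f i (s i) j))) =
    det (mat d d (\<lambda>(i, j). \<Sum>t\<in>I i. f i t j))"
proof -
  have "(\<Sum>s\<in>PiE {..<d} I. det (mat d d (\<lambda>(i, j). f i (s i) j))) =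
      (\<Sum>p | p permutes {0..<d}. signof p * (\<Sum>s\<in>PiE {..<d} I. \<Prod>i<d. f i (s i) (p i)))"
    unfolding det_mat_def by (subst sum.swap) (simp add: sum_distrib_left)
  also have "\<dots> = (\<Sum>p | p permutes {0..<d}. signof p * (\<Prod>i<d. \<Sum>t\<in>I i. f i t (p i)))"
    by (subst prod_sum_PiE) (use assms in auto)
  finally show ?thesis unfolding det_mat_def by simp
qed

lemma det_scale:
  fixes f :: "nat \<Rightarrow> nat \<Rightarrow> 'a::comm_ring_1"
  shows "det (mat d d (\<lambda>(i, j). r i * c j * f i j)) =
    (\<Prod>i<d. r i) * (\<Prod>j<d. c j) * det (mat d d (\<lambda>(i, j). f i j))"
proof -
  have "(\<Prod>i<d. c (p i)) = (\<Prod>j<d. c j)" if "p permutes {0..<d}" for p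
    using prod.permute[OF that, of c] by (simp add: atLeast0LessThan comp_def)
  then show ?thesis
    by (simp add: det_mat_def prod.distrib sum_distrib_left mult.assoc mult.left_commute)
qed

text \<open>The differences arise by multiplying from the left with the unipotent matrix that has
  \<open>1\<close> on the diagonal and \<open>-1\<close> just below it.\<close>

lemma det_row_differences:
  fixes f :: "nat \<Rightarrow> nat \<Rightarrow> 'a::idom"
  shows "det (mat d d (\<lambda>(i, j). f i j - (if i = 0 then 0 else f (i - 1) j))) = det (mat d d (\<lambda>(i, j). f i j))"
proof -
  let ?l = "\<lambda>i k. (if k = i then 1 else 0) - (if i = Suc k then 1 else (0::'a))"
  let ?L = "mat d d (\<lambda>(i, k). ?l i k)" and ?A = "mat d d (\<lambda>(i, j). f i j)"
  have "?L * ?A = mat d d (\<lambda>(i, j). f i j - (if i = 0 then 0 else f (i - 1) j))"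
  proof (rule eq_matI, goal_cases)
    case (1 i j)
    then have ij: "i < d" "j < d" by auto
    have "(\<Sum>k<d. ?l i k * f k j) = (\<Sum>k<d. (if k = i then f k j else 0)) - (\<Sum>k<d. if i = Suc k then f k j else 0)"
      unfolding sum_subtractf[symmetric] by (intro sum.cong) auto
    also have "(\<Sum>k<d. if i = Suc k then f k j else 0) = (if i = 0 then 0 else f (i - 1) j)"
    proof (cases i)
      case (Suc m)
      have "(\<Sum>k<d. if i = Suc k then f k j else 0) = (\<Sum>k<d. if k = m then f k j else 0)"
        by (intro sum.cong) (auto simp: Suc)
      then show ?thesis using ij Suc by simp
    qed simp
    finally show ?case
      using ij by (simp add: scalar_prod_def atLeast0LessThan)
  qed auto
  moreover have "det ?L = 1"
  proof -
    have "det ?L = prod_list (diag_mat ?L)"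
      by (rule det_lower_triangular[of d]) auto
    then show ?thesis by (simp add: prod_list_diag_prod)
  qed
  moreover have "det (?L * ?A) = det ?L * det ?A"
    by (rule det_mult) auto
  ultimately show ?thesis by simp
qed

text \<open>Read from right to left, this enlarges a matrix by one, as is needed when a line has one
  more dent than the line above has crossings.\<close>

lemma det_first_column_unit:
  fixes f :: "nat \<Rightarrow> nat \<Rightarrow> 'a::comm_ring_1"
  shows "det (mat (Suc d) (Suc d) (\<lambda>(i, j). if j = 0 then (if i = 0 then 1 else 0) else f i (j - 1))) =
    det (mat d d (\<lambda>(i, j). f (Suc i) j))"
proof -
  let ?A = "mat (Suc d) (Suc d) (\<lambda>(i, j). if j = 0 then (if i = 0 then 1 else 0) else f i (j - 1))"
  have "det ?A = (\<Sum>i<Suc d. ?A $$ (i, 0) * cofactor ?A i 0)"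
    by (rule laplace_expansion_column) auto
  also have "\<dots> = (\<Sum>i<Suc d. if i = 0 then cofactor ?A 0 0 else 0)"
    by (intro sum.cong) auto
  also have "\<dots> = cofactor ?A 0 0" by simp
  also have "mat_delete ?A 0 0 = mat d d (\<lambda>(i, j). f (Suc i) j)"
    by (rule eq_matI) (auto simp: mat_delete_def)
  then have "cofactor ?A 0 0 = det (mat d d (\<lambda>(i, j). f (Suc i) j))"
    by (simp add: cofactor_def)
  finally show ?thesis .
qed

text \<open>For any nodes the columns are values of monic polynomials of degrees
  \<open>0, 1, ...\<close>, so the determinant is the Vandermonde determinant whatever the nodes
  are. With the points themselves as nodes the matrix is lower triangular.\<close>

lemma det_newton:
  fixes X a :: "nat \<Rightarrow> 'a::idom"
  shows "det (mat d d (\<lambda>(i, j). \<Prod>l<j. X i - a l)) = (\<Prod>i<d. \<Prod>l<i. X i - X l)"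
proof -
  let ?V = "mat d d (\<lambda>(i, k). X i ^ k)"
  have V: "det (mat d d (\<lambda>(i, j). \<Prod>l<j. X i - b l)) = det ?V" for b :: "nat \<Rightarrow> 'a"
  proof -
    define P where "P j = (\<Prod>l<j. [:- b l, 1:])" for j
    have deg: "degree (P j) = j" for j
      unfolding P_def by (subst degree_prod_eq_sum_degree) auto
    have lead: "coeff (P j) j = 1" for j
      using lead_coeff_prod[of "\<lambda>l. [:- b l, 1:]" "{..<j}"] deg[of j] by (simp add: P_def)
    let ?U = "mat d d (\<lambda>(k, j). coeff (P j) k)"
    have "?V * ?U = mat d d (\<lambda>(i, j). \<Prod>l<j. X i - b l)"
    proof (rule eq_matI, goal_cases)
      case (1 i j)
      then have ij: "i < d" "j < d" by auto
      have "(\<Prod>l<j. X i - b l) = poly (P j) (X i)"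
        by (simp add: P_def poly_prod)
      also have "\<dots> = (\<Sum>k\<le>j. coeff (P j) k * X i ^ k)"
        by (simp add: poly_altdef deg)
      also have "\<dots> = (\<Sum>k<d. coeff (P j) k * X i ^ k)"
        by (rule sum.mono_neutral_left) (use ij deg in \<open>auto intro: coeff_eq_0\<close>)
      finally show ?case
        using ij by (simp add: scalar_prod_def atLeast0LessThan mult.commute)
    qed auto
    moreover have "det ?U = 1"
    proof -
      have "det ?U = prod_list (diag_mat ?U)"
        by (rule det_upper_triangular[of _ d]) (auto simp: upper_triangular_def deg intro!: coeff_eq_0)
      then show ?thesis by (simp add: prod_list_diag_prod lead)
    qed
    moreover have "det (?V * ?U) = det ?V * det ?U"
      by (rule det_mult) auto
    ultimately show ?thesis by simp
  qed
  have "det (mat d d (\<lambda>(i, j). \<Prod>l<j. X i - X l)) = (\<Prod>i<d. \<Prod>l<i. X i - X l)"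
  proof -
    let ?M = "mat d d (\<lambda>(i, j). \<Prod>l<j. X i - X l)"
    have "det ?M = prod_list (diag_mat ?M)"
      by (rule det_lower_triangular[of d]) auto
    then show ?thesis by (simp add: prod_list_diag_prod atLeast0LessThan)
  qed
  then show ?thesis using V by metis
qed

text \<open>The central factorials \<open>u\<^bsup>[2j]\<^esup> / (2j)!\<close> and \<open>u\<^bsup>[2j+1]\<^esup> / (2j+1)!\<close>: the central difference operator
  lowers their index by one.\<close>

definition cfe :: "nat \<Rightarrow> real \<Rightarrow> real" where
  "cfe j u = (\<Prod>l<j. u\<^sup>2 - (real l)\<^sup>2) / fact (2 * j)"

definition cfo :: "nat \<Rightarrow> real \<Rightarrow> real" where
  "cfo j u = u * (\<Prod>l<j. u\<^sup>2 - (real l + 1 / 2)\<^sup>2) / fact (2 * j + 1)"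

lemma cfe_minus [simp]: "cfe j (- u) = cfe j u"
  by (simp add: cfe_def)

lemma cfo_minus [simp]: "cfo j (- u) = - cfo j u"
  by (simp add: cfo_def)

lemma cfe_0 [simp]: "cfe (Suc j) 0 = 0"
  by (simp add: cfe_def prod.lessThan_Suc_shift del: prod.lessThan_Suc)

text \<open>Both shifted products share the factor \<open>?R\<close> of \<open>cfo j\<close>, with
  two linear factors left over; the second product is the first one at \<open>- x\<close>. The
  leftovers combine to \<open>x * (2 * j + 2)\<close>, which lowers the factorial.\<close>

lemma cfe_difference: "cfe (Suc j) (x + 1 / 2) - cfe (Suc j) (x - 1 / 2) = cfo j x"
proof -
  have plus: "(\<Prod>l<Suc j. (y + 1 / 2)\<^sup>2 - (real l)\<^sup>2) =
      (y + 1 / 2) * (y + 1 / 2 + j) * (\<Prod>l<j. y\<^sup>2 - (real l + 1 / 2)\<^sup>2)" for y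
  proof (induction j)
    case 0
    then show ?case by (simp add: power2_eq_square)
  next
    case (Suc j)
    have *: "(y + 1 / 2 + j) * ((y + 1 / 2)\<^sup>2 - (real (Suc j))\<^sup>2) =
        (y + 1 / 2 + Suc j) * (y\<^sup>2 - (real j + 1 / 2)\<^sup>2)"
      by (simp add: power2_eq_square field_simps)
    have "(\<Prod>l<Suc (Suc j). (y + 1 / 2)\<^sup>2 - (real l)\<^sup>2) =
      (y + 1 / 2) * (y + 1 / 2 + j) * (\<Prod>l<j. y\<^sup>2 - (real l + 1 / 2)\<^sup>2) * ((y + 1 / 2)\<^sup>2 - (real (Suc j))\<^sup>2)"
      using Suc by simp
    also have "\<dots> = (y + 1 / 2) * (y + 1 / 2 + Suc j) *
        ((\<Prod>l<j. y\<^sup>2 - (real l + 1 / 2)\<^sup>2) * (y\<^sup>2 - (real j + 1 / 2)\<^sup>2))"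
      using arg_cong[OF *, of "\<lambda>u. (y + 1 / 2) * (\<Prod>l<j. y\<^sup>2 - (real l + 1 / 2)\<^sup>2) * u"]
      by (simp only: mult_ac)
    finally show ?case by simp
  qed
  let ?R = "\<Prod>l<j. x\<^sup>2 - (real l + 1 / 2)\<^sup>2"
  have "(- x + 1 / 2)\<^sup>2 = (x - 1 / 2)\<^sup>2" by (simp add: power2_eq_square algebra_simps)
  then have minus: "(\<Prod>l<Suc j. (x - 1 / 2)\<^sup>2 - (real l)\<^sup>2) = (- x + 1 / 2) * (- x + 1 / 2 + j) * ?R"
    using plus[of "- x"] by simp
  have "cfe (Suc j) (x + 1 / 2) - cfe (Suc j) (x - 1 / 2) =
      ((x + 1 / 2) * (x + 1 / 2 + j) * ?R - (- x + 1 / 2) * (- x + 1 / 2 + j) * ?R) / fact (2 * Suc j)"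
    unfolding cfe_def plus minus by (simp add: diff_divide_distrib)
  also have "(x + 1 / 2) * (x + 1 / 2 + j) * ?R - (- x + 1 / 2) * (- x + 1 / 2 + j) * ?R =
      x * ?R * (2 * j + 2)"
    by (simp add: algebra_simps)
  also have "(fact (2 * Suc j) :: real) = fact (2 * j + 1) * real (2 * j + 2)"
    by (simp add: algebra_simps)
  also have "x * ?R * real (2 * j + 2) / (fact (2 * j + 1) * real (2 * j + 2)) = x * ?R / fact (2 * j + 1)"
    by (rule nonzero_mult_divide_mult_cancel_right) simp
  finally show ?thesis unfolding cfo_def .
qed

text \<open>The same scheme; the common factor of the two shifts lacks the factor for
  \<open>l = 0\<close> of \<open>cfe j\<close>, and the linear leftovers supply this missing square
  of \<open>x\<close>.\<close>

lemma cfo_difference: "cfo j (x + 1 / 2) - cfo j (x - 1 / 2) = cfe j x"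
proof (cases j)
  case 0
  then show ?thesis by (simp add: cfo_def cfe_def)
next
  case (Suc i)
  have plus: "(\<Prod>l<Suc i. (y + 1 / 2)\<^sup>2 - (real l + 1 / 2)\<^sup>2) =
      y * (y + Suc i) * (\<Prod>l<i. y\<^sup>2 - (real (Suc l))\<^sup>2)" for y
  proof (induction i)
    case 0
    then show ?case by (simp add: power2_eq_square algebra_simps)
  next
    case (Suc i)
    have *: "(y + Suc i) * ((y + 1 / 2)\<^sup>2 - (real (Suc i) + 1 / 2)\<^sup>2) =
        (y + Suc (Suc i)) * (y\<^sup>2 - (real (Suc i))\<^sup>2)"
      by (simp add: power2_eq_square field_simps)
    have "(\<Prod>l<Suc (Suc i). (y + 1 / 2)\<^sup>2 - (real l + 1 / 2)\<^sup>2) =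
      y * (y + Suc i) * (\<Prod>l<i. y\<^sup>2 - (real (Suc l))\<^sup>2) * ((y + 1 / 2)\<^sup>2 - (real (Suc i) + 1 / 2)\<^sup>2)"
      using Suc by simp
    also have "\<dots> = y * (y + Suc (Suc i)) *
        ((\<Prod>l<i. y\<^sup>2 - (real (Suc l))\<^sup>2) * (y\<^sup>2 - (real (Suc i))\<^sup>2))"
      using arg_cong[OF *, of "\<lambda>u. y * (\<Prod>l<i. y\<^sup>2 - (real (Suc l))\<^sup>2) * u"]
      by (simp only: mult_ac)
    finally show ?case by simp
  qed
  let ?R = "\<Prod>l<i. x\<^sup>2 - (real (Suc l))\<^sup>2"
  have "(- x + 1 / 2)\<^sup>2 = (x - 1 / 2)\<^sup>2" by (simp add: power2_eq_square algebra_simps)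
  then have minus: "(\<Prod>l<Suc i. (x - 1 / 2)\<^sup>2 - (real l + 1 / 2)\<^sup>2) = (- x) * (- x + Suc i) * ?R"
    using plus[of "- x"] by simp
  have Q: "(\<Prod>l<Suc i. x\<^sup>2 - (real l)\<^sup>2) = x\<^sup>2 * ?R"
    by (simp add: prod.lessThan_Suc_shift del: prod.lessThan_Suc)
  have "cfo j (x + 1 / 2) - cfo j (x - 1 / 2) =
      ((x + 1 / 2) * (x * (x + Suc i) * ?R) - (x - 1 / 2) * ((- x) * (- x + Suc i) * ?R)) / fact (2 * j + 1)"
    unfolding cfo_def Suc plus minus by (simp only: diff_divide_distrib)
  also have "(x + 1 / 2) * (x * (x + Suc i) * ?R) - (x - 1 / 2) * ((- x) * (- x + Suc i) * ?R) =
      x\<^sup>2 * ?R * (2 * Suc i + 1)"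
    by (simp add: power2_eq_square algebra_simps)
  also have "(fact (2 * j + 1) :: real) = fact (2 * Suc i) * real (2 * Suc i + 1)"
    by (simp add: Suc algebra_simps)
  also have "x\<^sup>2 * ?R * real (2 * Suc i + 1) / (fact (2 * Suc i) * real (2 * Suc i + 1)) =
      x\<^sup>2 * ?R / fact (2 * Suc i)"
    by (rule nonzero_mult_divide_mult_cancel_right) simp
  finally show ?thesis unfolding cfe_def Suc Q .
qed

section \<open>Summing determinants of central factorials over interlacing positions\<close>

definition wall_weight :: "nat \<Rightarrow> real" where
  "wall_weight t = (if t = 0 then 1 / 2 else 1)"

text \<open>Telescoping by \<open>cfo_difference\<close>. Since \<open>cfo j\<close> is odd,
  \<open>cfe j 0\<close> is twice \<open>cfo j (1 / 2)\<close>: the weight \<open>1 / 2\<close> at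
  the wall removes the boundary term.\<close>

lemma sum_cfe: "(\<Sum>t\<le>e. wall_weight t * cfe j (real t)) = cfo j (real e + 1 / 2)"
proof (induction e)
  case 0
  have "2 * cfo j (1 / 2) = cfe j 0"
    using cfo_difference[of j 0] cfo_minus[of j "1 / 2"] by simp
  then show ?case by (simp add: wall_weight_def)
next
  case (Suc e)
  show ?case
    using Suc cfo_difference[of j "real (Suc e)"] by (simp add: wall_weight_def algebra_simps)
qed

lemma sum_cfo: "(\<Sum>t<e. cfo j (real t + 1 / 2)) = cfe (Suc j) (real e)"
proof (induction e)
  case (Suc e)
  show ?case
    using Suc cfe_difference[of j "real e + 1 / 2"] by (simp add: algebra_simps)
qed simp

text \<open>Each row is summed over its own interval, where \<open>sum_cfe\<close> telescopes, so
  row \<open>i\<close> becomes a difference of consecutive rows; row \<open>0\<close> starts at the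
  wall and has nothing to subtract.\<close>

lemma sum_det_cfe:
  assumes e: "\<And>i. Suc i < d \<Longrightarrow> e i < e (Suc i)"
  shows "(\<Sum>s\<in>PiE {..<d} (\<lambda>i. {(if i = 0 then 0 else Suc (e (i - 1)))..e i}).
      (\<Prod>i<d. wall_weight (s i)) * det (mat d d (\<lambda>(i, j). cfe j (real (s i))))) =
    det (mat d d (\<lambda>(i, j). cfo j (real (e i) + 1 / 2)))"
proof -
  let ?I = "\<lambda>i. {(if i = 0 then 0 else Suc (e (i - 1)))..e i}"
  let ?f = "\<lambda>i j. cfo j (real (e i) + 1 / 2)"
  have "(\<Sum>s\<in>PiE {..<d} ?I. (\<Prod>i<d. wall_weight (s i)) * det (mat d d (\<lambda>(i, j). cfe j (real (s i))))) =
      (\<Sum>s\<in>PiE {..<d} ?I. det (mat d d (\<lambda>(i, j). wall_weight (s i) * cfe j (real (s i)))))"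
    using det_scale[of d "\<lambda>i. wall_weight (s i)" "\<lambda>_. 1" "\<lambda>i j. cfe j (real (s i))" for s] by simp
  also have "\<dots> = det (mat d d (\<lambda>(i, j). \<Sum>t\<in>?I i. wall_weight t * cfe j (real t)))"
    by (rule sum_det_rows) simp
  also have "mat d d (\<lambda>(i, j). \<Sum>t\<in>?I i. wall_weight t * cfe j (real t)) =
      mat d d (\<lambda>(i, j). ?f i j - (if i = 0 then 0 else ?f (i - 1) j))"
  proof -
    have "(\<Sum>t\<in>?I i. wall_weight t * cfe j (real t)) = ?f i j - (if i = 0 then 0 else ?f (i - 1) j)"
      if "i < d" for i j
    proof (cases i)
      case 0
      then show ?thesis by (simp add: sum_cfe atLeast0AtMost)
    next
      case (Suc m)
      then have eq: "{..e i} = {..e m} \<union> {Suc (e m)..e i}" using e[of m] that by auto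
      have "(\<Sum>t\<le>e i. wall_weight t * cfe j (real t)) =
        (\<Sum>t\<le>e m. wall_weight t * cfe j (real t)) + (\<Sum>t = Suc (e m)..e i. wall_weight t * cfe j (real t))"
        unfolding eq by (rule sum.union_disjoint) auto
      then show ?thesis by (simp add: sum_cfe Suc)
    qed
    then show ?thesis by (intro cong_mat refl) (simp only: prod.case)
  qed
  also have "det \<dots> = det (mat d d (\<lambda>(i, j). ?f i j))"
    by (rule det_row_differences)
  finally show ?thesis .
qed

text \<open>The \<open>d\<close> intervals between \<open>d + 1\<close> dents give a matrix of row
  differences that lacks the first row and the column of index \<open>0\<close>.\<close>

lemma sum_det_cfo:
  assumes e: "\<And>i. i < d \<Longrightarrow> e i < e (Suc i)"
  shows "(\<Sum>s\<in>PiE {..<d} (\<lambda>i. {e i..<e (Suc i)}). det (mat d d (\<lambda>(i, j). cfo j (real (s i) + 1 / 2)))) =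
    det (mat (Suc d) (Suc d) (\<lambda>(i, j). cfe j (real (e i))))"
proof -
  let ?f = "\<lambda>i j. cfe j (real (e i))"
  have "(\<Sum>s\<in>PiE {..<d} (\<lambda>i. {e i..<e (Suc i)}). det (mat d d (\<lambda>(i, j). cfo j (real (s i) + 1 / 2)))) =
      det (mat d d (\<lambda>(i, j). \<Sum>t\<in>{e i..<e (Suc i)}. cfo j (real t + 1 / 2)))"
    by (rule sum_det_rows) simp
  also have "mat d d (\<lambda>(i, j). \<Sum>t\<in>{e i..<e (Suc i)}. cfo j (real t + 1 / 2)) =
      mat d d (\<lambda>(i, j). ?f (Suc i) (Suc j) - ?f i (Suc j))"
  proof -
    have "(\<Sum>t = e i..<e (Suc i). cfo j (real t + 1 / 2)) = ?f (Suc i) (Suc j) - ?f i (Suc j)"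
      if "i < d" for i j
    proof -
      have eq: "{..<e (Suc i)} = {..<e i} \<union> {e i..<e (Suc i)}" using e[of i] that by auto
      have "(\<Sum>t<e (Suc i). cfo j (real t + 1 / 2)) =
          (\<Sum>t<e i. cfo j (real t + 1 / 2)) + (\<Sum>t = e i..<e (Suc i). cfo j (real t + 1 / 2))"
        unfolding eq by (rule sum.union_disjoint) auto
      then show ?thesis by (simp add: sum_cfo)
    qed
    then show ?thesis by (intro cong_mat refl) (simp only: prod.case)
  qed
  \<comment> \<open>Since \<open>cfe 0\<close> is constantly \<open>1\<close>, its row differences
    form the first unit column. Bordering with it restores the full matrix of row differences of
    size \<open>d + 1\<close>.\<close>
  also have "det \<dots> = det (mat (Suc d) (Suc d) (\<lambda>(i, j). if j = 0 then (if i = 0 then 1 else 0)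
      else (\<lambda>i j. ?f i (Suc j) - (if i = 0 then 0 else ?f (i - 1) (Suc j))) i (j - 1)))"
    by (subst det_first_column_unit) simp
  also have "mat (Suc d) (Suc d) (\<lambda>(i, j). if j = 0 then (if i = 0 then 1 else 0)
      else (\<lambda>i j. ?f i (Suc j) - (if i = 0 then 0 else ?f (i - 1) (Suc j))) i (j - 1)) =
    mat (Suc d) (Suc d) (\<lambda>(i, j). ?f i j - (if i = 0 then 0 else ?f (i - 1) j))"
    by (rule cong_mat) (auto simp: cfe_def[of 0])
  also have "det \<dots> = det (mat (Suc d) (Suc d) (\<lambda>(i, j). ?f i j))"
    by (rule det_row_differences)
  finally show ?thesis .
qed

lemma det_cfe:
  "det (mat d d (\<lambda>(i, j). cfe j (X i))) =
    (\<Prod>i<d. \<Prod>l<i. (X i)\<^sup>2 - (X l)\<^sup>2) / (\<Prod>j<d. fact (2 * j))"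
  using det_scale[of d "\<lambda>_. 1" "\<lambda>j. 1 / fact (2 * j)" "\<lambda>i j. \<Prod>l<j. (X i)\<^sup>2 - (real l)\<^sup>2"]
  by (simp add: cfe_def det_newton[where a = "\<lambda>l. (real l)\<^sup>2" and X = "\<lambda>i. (X i)\<^sup>2"] prod_dividef)

lemma det_cfo:
  "det (mat d d (\<lambda>(i, j). cfo j (X i))) =
    (\<Prod>i<d. X i) * (\<Prod>i<d. \<Prod>l<i. (X i)\<^sup>2 - (X l)\<^sup>2) / (\<Prod>j<d. fact (2 * j + 1))"
  using det_scale[of d X "\<lambda>j. 1 / fact (2 * j + 1)" "\<lambda>i j. \<Prod>l<j. (X i)\<^sup>2 - (real l + 1 / 2)\<^sup>2"]
  by (simp add: cfo_def det_newton[where a = "\<lambda>l. (real l + 1 / 2)\<^sup>2" and X = "\<lambda>i. (X i)\<^sup>2"] prod_dividef)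

section \<open>Tilings of a single row\<close>

abbreviation strip_sum :: "int \<Rightarrow> int set \<Rightarrow> real" where
  "strip_sum r I \<equiv> tiling_sum west_weight (Pair r ` I)"

lemma lozenge_in_row:
  assumes "lozenge L" "L \<subseteq> Pair r ` I"
  obtains p where "L = {(r, p), (r, p + 1)}"
proof -
  consider r' p where "L = {(r', p), (r' + 1, p)}" | r' p where "L = {(r', p), (r', p + 1)}"
    using assms(1) unfolding lozenge_def vertical_lozenge_def by blast
  then show ?thesis
  proof cases
    case (1 r' p)
    then show ?thesis using assms(2) by auto
  next
    case (2 r' p)
    then show ?thesis using assms(2) that by auto
  qed
qed

lemma lozenge_horizontal: "lozenge {(r, p), (r, p + 1)}"
  by (auto simp: lozenge_def)

lemma west_weight_horizontal: "west_weight {(r, p), (r, p + 1)} = 1"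
  by (auto simp: west_weight_def doubleton_eq_iff)

text \<open>Within a row every lozenge joins horizontal neighbours, so a cell without eastern
  neighbour is paired with its western one. Iterating this fixes the tiling; as horizontal lozenges
  have weight \<open>1\<close>, the sum is \<open>0\<close> or \<open>1\<close>.\<close>

lemma strip_sum_last:
  assumes "finite I" "M \<in> I" "M + 1 \<notin> I"
  shows "strip_sum r I = (if M - 1 \<in> I then strip_sum r (I - {M - 1, M}) else 0)"
proof -
  have unique: "L = {(r, M - 1), (r, M)} \<and> M - 1 \<in> I" if L: "lozenge L" "L \<subseteq> Pair r ` I" "(r, M) \<in> L" for L
  proof -
    obtain p where p: "L = {(r, p), (r, p + 1)}" using lozenge_in_row[OF L(1,2)] by blast
    then have "M = p \<or> M = p + 1" "p \<in> I" "p + 1 \<in> I" using L by auto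
    then show ?thesis using p assms by auto
  qed
  show ?thesis
  proof (cases "M - 1 \<in> I")
    case True
    have "strip_sum r I = west_weight {(r, M - 1), (r, M)} *
        tiling_sum west_weight (Pair r ` I - {(r, M - 1), (r, M)})"
    proof (rule tiling_sum_forced[where t = "(r, M)"])
      show "lozenge {(r, M - 1), (r, M)}" using lozenge_horizontal[of r "M - 1"] by simp
      show "{(r, M - 1), (r, M)} \<subseteq> Pair r ` I" using True assms(2) by auto
      show "L = {(r, M - 1), (r, M)}" if "lozenge L" "L \<subseteq> Pair r ` I" "(r, M) \<in> L" for L
        using unique[OF that] by simp
    qed (use assms(1) in auto)
    moreover have "Pair r ` I - {(r, M - 1), (r, M)} = Pair r ` (I - {M - 1, M})" by auto
    ultimately show ?thesis using True west_weight_horizontal[of r "M - 1"] by simp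
  next
    case False
    then have "strip_sum r I = 0"
    proof (intro tiling_sum_eq_0[of "(r, M)"])
      show "(r, M) \<notin> L" if "lozenge L" "L \<subseteq> Pair r ` I" for L
        using unique[OF that] False by blast
    qed (use assms(2) in simp)
    then show ?thesis using False by simp
  qed
qed

lemma strip_sum_split:
  assumes "finite A" "finite B" "\<And>a b. a \<in> A \<Longrightarrow> b \<in> B \<Longrightarrow> a + 1 < b"
  shows "strip_sum r (A \<union> B) = strip_sum r A * strip_sum r B"
  unfolding image_Un
proof (rule tiling_sum_independent)
  show "Pair r ` A \<inter> Pair r ` B = {}" using assms(3) by fastforce
  fix L assume L: "lozenge L" "L \<subseteq> Pair r ` A \<union> Pair r ` B" "L \<inter> Pair r ` A \<noteq> {}"
  obtain p where p: "L = {(r, p), (r, p + 1)}"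
    using lozenge_in_row[of L r "A \<union> B"] L by (auto simp: image_Un)
  have "p \<in> A \<union> B" "p + 1 \<in> A \<union> B" "p \<in> A \<or> p + 1 \<in> A" using L p by auto
  moreover have "\<not> (p \<in> A \<and> p + 1 \<in> B)" "\<not> (p \<in> B \<and> p + 1 \<in> A)" 
    using assms(3)[of p "p + 1"] assms(3)[of "p + 1" p] by auto
  moreover have "\<not> (q \<in> A \<and> q \<in> B)" for q using assms(3)[of q q] by auto
  ultimately show "L \<inter> Pair r ` B = {}" using p by auto
qed (use assms in auto)

abbreviation evens :: "int \<Rightarrow> nat set \<Rightarrow> int set" where
  "evens a S \<equiv> (\<lambda>q. a + 2 * int q) ` S"

text \<open>From the east, cells pair off as \<open>a + 2 * q\<close> and
  \<open>a + 2 * q + 1\<close>. Those of the second kind are always present, so a missing one of the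
  first kind leaves its partner unmatched.\<close>

lemma strip_sum_even_length:
  "strip_sum r ({a + 2 * int c..<a + 2 * int c + 2 * int l} - evens a S) =
    (if S \<inter> {c..<c + l} = {} then 1 else 0)"
proof (induction l)
  case (Suc l)
  let ?I = "\<lambda>l. {a + 2 * int c..<a + 2 * int c + 2 * int l} - evens a S"
  let ?M = "a + 2 * int c + 2 * int l + 1"
  have odd: "?M \<noteq> a + 2 * int q" for q by presburger
  have "a + 2 * int c + 2 * int l = a + 2 * int q \<longleftrightarrow> q = c + l" for q by auto
  then have ev: "a + 2 * int c + 2 * int l \<in> evens a S \<longleftrightarrow> c + l \<in> S"
    by (simp only: image_iff) auto
  have "strip_sum r (?I (Suc l)) =
      (if ?M - 1 \<in> ?I (Suc l) then strip_sum r (?I (Suc l) - {?M - 1, ?M}) else 0)"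
    by (rule strip_sum_last) (use odd in auto)
  moreover have "?M - 1 \<in> ?I (Suc l) \<longleftrightarrow> c + l \<notin> S"
    using ev by auto
  moreover have "?I (Suc l) - {?M - 1, ?M} = ?I l" by auto
  moreover have "S \<inter> {c..<c + Suc l} = {} \<longleftrightarrow> c + l \<notin> S \<and> S \<inter> {c..<c + l} = {}"
    by (auto simp: less_Suc_eq)
  ultimately show ?case using Suc by simp
qed simp

text \<open>The run has one more cell of the kind \<open>a + 2 * q\<close> than of the other, and a
  lozenge uses one of each, so exactly one has to be missing; the pieces on both sides of it then
  have even length.\<close>

lemma strip_sum_odd_length:
  "strip_sum r ({a + 2 * int c..a + 2 * int c + 2 * int l} - evens a S) =
    (if card (S \<inter> {c..c + l}) = 1 then 1 else 0)"
proof (induction l)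
  case 0
  have ev: "a + 2 * int c \<in> evens a S \<longleftrightarrow> c \<in> S" by auto
  show ?case
  proof (cases "c \<in> S")
    case True
    then have "{a + 2 * int c..a + 2 * int c + 2 * int 0} - evens a S = {}" "S \<inter> {c..c + 0} = {c}" by auto
    then show ?thesis by (simp only: image_empty tiling_sum_empty) simp
  next
    case False
    then have "{a + 2 * int c..a + 2 * int c + 2 * int 0} - evens a S = {a + 2 * int c}" "S \<inter> {c..c + 0} = {}"
      using ev by auto
    then show ?thesis using strip_sum_last[of "{a + 2 * int c}" "a + 2 * int c" r] by (simp only:) simp
  qed
next
  case (Suc l)
  let ?I = "\<lambda>l. {a + 2 * int c..a + 2 * int c + 2 * int l} - evens a S"
  let ?M = "a + 2 * int c + 2 * int (Suc l)"
  have odd: "a + 2 * int c + 2 * int l + 1 \<noteq> a + 2 * int q" for q by presburger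
  have "?M = a + 2 * int q \<longleftrightarrow> q = c + Suc l" for q by auto
  then have ev: "?M \<in> evens a S \<longleftrightarrow> c + Suc l \<in> S"
    by (simp only: image_iff) auto
  have S: "S \<inter> {c..c + Suc l} = (if c + Suc l \<in> S then insert (c + Suc l) (S \<inter> {c..<c + Suc l}) else S \<inter> {c..c + l})"
    by (auto simp: le_Suc_eq)
  show ?case
  proof (cases "c + Suc l \<in> S")
    case True
    then have "?I (Suc l) = {a + 2 * int c..<a + 2 * int c + 2 * int (Suc l)} - evens a S"
      using ev by auto
    moreover have "S \<inter> {c..c + Suc l} = insert (c + Suc l) (S \<inter> {c..<c + Suc l})"
      using S True by presburger
    then have "card (S \<inter> {c..c + Suc l}) = 1 \<longleftrightarrow> S \<inter> {c..<c + Suc l} = {}"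
      by (simp only:) (simp add: card_insert_if)
    ultimately show ?thesis by (simp only: strip_sum_even_length)
  next
    case False
    have "strip_sum r (?I (Suc l)) =
        (if ?M - 1 \<in> ?I (Suc l) then strip_sum r (?I (Suc l) - {?M - 1, ?M}) else 0)"
      by (rule strip_sum_last) (use ev False in auto)
    moreover have "?M - 1 \<in> ?I (Suc l)" by auto presburger
    moreover have "?I (Suc l) - {?M - 1, ?M} = ?I l" by auto
    ultimately show ?thesis using Suc S False by simp
  qed
qed

text \<open>The cells \<open>a + 2 * q\<close> with \<open>q\<close> in \<open>gap e i\<close> are
  those between the dents \<open>a + 1 + 2 * e (i - 1)\<close> and \<open>a + 1 + 2 * e i\<close>.
  This offset puts \<open>e i\<close> in and \<open>e (i - 1)\<close> out.\<close>

definition gap :: "(nat \<Rightarrow> nat) \<Rightarrow> nat \<Rightarrow> nat set" where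
  "gap e i = {(if i = 0 then 0 else Suc (e (i - 1)))..e i}"

text \<open>The dents cut the row into runs of odd length, one for each \<open>gap\<close>. The row
  stops just before the dent \<open>e d\<close>, so that the induction step appends one run beyond
  it.\<close>

lemma strip_sum_prefix:
  assumes "\<And>i. i < d \<Longrightarrow> e i < e (Suc i)"
  shows "strip_sum r ({a..a + 2 * int (e d)} - evens a S - evens (a + 1) (e ` {..<d})) =
    (if \<forall>i\<le>d. card (S \<inter> gap e i) = 1 then 1 else 0)"
  using assms
proof (induction d)
  case 0
  then show ?case using strip_sum_odd_length[of r a 0 "e 0" S] by (simp add: gap_def)
next
  case (Suc d)
  let ?A = "{a..a + 2 * int (e d)} - evens a S - evens (a + 1) (e ` {..<d})"
  let ?c = "Suc (e d)" let ?l = "e (Suc d) - ?c"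
  let ?B = "{a + 2 * int ?c..a + 2 * int ?c + 2 * int ?l} - evens a S"
  have e: "e d < e (Suc d)" using Suc.prems[of d] by simp
  have le: "e i \<le> e d" if "i \<le> d" for i
    using that
  proof (induction rule: inc_induct)
    case (step n)
    then show ?case using Suc.prems[of n] by simp
  qed simp
  have no: "a + 1 + 2 * int q \<noteq> a + 2 * int q'" for q q' by presburger
  have l: "int ?l = int (e (Suc d)) - int ?c" using e by simp
  have "{a..a + 2 * int (e (Suc d))} - evens a S - evens (a + 1) (e ` {..<Suc d}) = ?A \<union> ?B" (is "?L = _")
  proof (rule Set.set_eqI)
    fix x
    have c1: "x \<notin> evens (a + 1) (e ` {..<Suc d})" if "x > a + 2 * int (e d) + 1"
      using that le by (fastforce simp: less_Suc_eq_le)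
    have c2: "x \<in> evens (a + 1) (e ` {..<Suc d}) \<longleftrightarrow> x \<in> evens (a + 1) (e ` {..<d})" if "x < a + 2 * int (e d) + 1"
      using that by (auto simp: less_Suc_eq)
    have c3: "x \<in> evens (a + 1) (e ` {..<Suc d})" if "x = a + 2 * int (e d) + 1"
      using that by auto
    consider "x < a + 2 * int (e d) + 1" | "x = a + 2 * int (e d) + 1" | "x > a + 2 * int (e d) + 1" by linarith
    then show "x \<in> ?L \<longleftrightarrow> x \<in> ?A \<union> ?B"
    proof cases
      case 1
      have "x \<notin> ?B" "x \<le> a + 2 * int (e d)" "x \<le> a + 2 * int (e (Suc d))" using 1 e by auto
      then show ?thesis using c2[OF 1] by simp
    next
      case 2
      have "x \<notin> ?B" "x \<notin> ?A" using 2 e by auto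
      then show ?thesis using c3[OF 2] by simp
    next
      case 3
      have "x \<notin> ?A" "x \<ge> a + 2 * int ?c" "x \<ge> a" using 3 e by auto
      then show ?thesis using c1[OF 3] l by auto
    qed
  qed
  then have "strip_sum r ?L = strip_sum r ?A * strip_sum r ?B"
    by (simp only:) (rule strip_sum_split, auto)
  also have "strip_sum r ?A = (if \<forall>i\<le>d. card (S \<inter> gap e i) = 1 then 1 else 0)"
    using Suc.prems by (intro Suc.IH) simp
  also have "strip_sum r ?B = (if card (S \<inter> {?c..?c + ?l}) = 1 then 1 else 0)"
    by (rule strip_sum_odd_length)
  also have "{?c..?c + ?l} = gap e (Suc d)" using e by (simp add: gap_def)
  finally show ?case by (auto simp: le_Suc_eq)
qed

lemma strict_chain:
  fixes e :: "nat \<Rightarrow> nat"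
  assumes "\<And>i. Suc i < d \<Longrightarrow> e i < e (Suc i)" "i < j" "j < d"
  shows "e i < e j"
  using assms(2,3)
proof (induction j)
  case (Suc j)
  then show ?case using assms(1)[of j] by (cases "i = j") (auto simp: less_Suc_eq)
qed simp

lemma gap_Union:
  assumes "\<And>i. Suc i < Suc d \<Longrightarrow> e i < e (Suc i)"
  shows "(\<Union>i\<le>d. gap e i) = {..e d}"
  using assms
proof (induction d)
  case (Suc d)
  have "e d < e (Suc d)" using Suc.prems[of d] by simp
  then have "gap e (Suc d) \<union> {..e d} = {..e (Suc d)}" by (auto simp: gap_def)
  moreover have "(\<Union>i\<le>d. gap e i) = {..e d}" using Suc by simp
  ultimately show ?case by (simp add: atMost_Suc)
qed (auto simp: gap_def)

text \<open>What lies east of the last dent has even length and allows no missing cell, so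
  \<open>S\<close> interlaces with the dents.\<close>

lemma strip_sum_even_row:
  assumes e: "\<And>i. Suc i < d \<Longrightarrow> e i < e (Suc i)" "\<And>i. i < d \<Longrightarrow> e i < n" and S: "S \<subseteq> {..<n}"
  shows "strip_sum r ({a..<a + 2 * int n} - evens a S - evens (a + 1) (e ` {..<d})) =
    (if S \<subseteq> (\<Union>i<d. gap e i) \<and> (\<forall>i<d. card (S \<inter> gap e i) = 1) then 1 else 0)"
proof (cases d)
  case 0
  have "S \<inter> {0..<0 + n} = S" using S by auto
  then show ?thesis using strip_sum_even_length[of r a 0 n S] 0 by simp
next
  case (Suc m)
  let ?A = "{a..a + 2 * int (e m)} - evens a S - evens (a + 1) (e ` {..<m})"
  let ?c = "Suc (e m)" let ?l = "n - ?c"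
  let ?B = "{a + 2 * int ?c..<a + 2 * int ?c + 2 * int ?l} - evens a S"
  have em: "e m < n" using e Suc by simp
  have le: "e i \<le> e m" if "i \<le> m" for i
    using strict_chain[of d e i m] e Suc that by (cases "i = m") auto
  have l: "int ?l = int n - int ?c" using em by simp
  have "{a..<a + 2 * int n} - evens a S - evens (a + 1) (e ` {..<d}) = ?A \<union> ?B" (is "?L = _")
  proof (rule Set.set_eqI)
    fix x
    have c1: "x \<notin> evens (a + 1) (e ` {..<Suc m})" if "x > a + 2 * int (e m) + 1"
      using that le by (fastforce simp: less_Suc_eq_le)
    have c2: "x \<in> evens (a + 1) (e ` {..<Suc m}) \<longleftrightarrow> x \<in> evens (a + 1) (e ` {..<m})" if "x < a + 2 * int (e m) + 1"
      using that by (auto simp: less_Suc_eq)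
    have c3: "x \<in> evens (a + 1) (e ` {..<Suc m})" if "x = a + 2 * int (e m) + 1"
      using that by auto
    consider "x < a + 2 * int (e m) + 1" | "x = a + 2 * int (e m) + 1" | "x > a + 2 * int (e m) + 1" by linarith
    then show "x \<in> ?L \<longleftrightarrow> x \<in> ?A \<union> ?B"
    proof cases
      case 1
      have "x \<notin> ?B" "x \<le> a + 2 * int (e m)" "x < a + 2 * int n" using 1 em by auto
      then show ?thesis using c2[OF 1] Suc by simp
    next
      case 2
      have "x \<notin> ?B" "x \<notin> ?A" using 2 by auto
      then show ?thesis using c3[OF 2] Suc by simp
    next
      case 3
      have "x \<notin> ?A" "x \<ge> a + 2 * int ?c" "x \<ge> a" using 3 by auto
      then show ?thesis using c1[OF 3] l Suc by auto
    qed
  qed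
  then have "strip_sum r ?L = strip_sum r ?A * strip_sum r ?B"
    by (simp only:) (rule strip_sum_split, auto)
  also have "strip_sum r ?A = (if \<forall>i\<le>m. card (S \<inter> gap e i) = 1 then 1 else 0)"
    using e Suc by (intro strip_sum_prefix) simp
  also have "strip_sum r ?B = (if S \<inter> {?c..<?c + ?l} = {} then 1 else 0)"
    by (rule strip_sum_even_length)
  also have "S \<inter> {?c..<?c + ?l} = {} \<longleftrightarrow> S \<subseteq> {..e m}" using S em by (auto simp: disjoint_iff subset_iff not_less_eq_eq)
  also have "{..e m} = (\<Union>i<d. gap e i)" using gap_Union[of m e] e Suc by (simp add: lessThan_Suc_atMost)
  finally show ?thesis using Suc by (auto simp: less_Suc_eq_le)
qed

text \<open>An odd row is an even row whose leftmost cell has been removed.\<close>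

lemma strip_sum_odd_row:
  assumes e: "\<And>i. Suc i < d \<Longrightarrow> e i < e (Suc i)" "\<And>i. i < d \<Longrightarrow> e i \<le> n" and S: "S \<subseteq> {..<n}"
  shows "strip_sum r ({0..2 * int n} - evens 1 S - evens 0 (e ` {..<d})) =
    (if d \<noteq> 0 \<and> S \<subseteq> (\<Union>i<d - 1. {e i..<e (Suc i)}) \<and> (\<forall>i<d - 1. card (S \<inter> {e i..<e (Suc i)}) = 1)
     then 1 else 0)"
proof -
  let ?S = "insert 0 (Suc ` S)"
  have "{0..2 * int n} - evens 1 S - evens 0 (e ` {..<d}) =
      {- 1..<- 1 + 2 * int (Suc n)} - evens (- 1) ?S - evens (- 1 + 1) (e ` {..<d})"
  proof -
    have "evens (- 1) ?S = insert (- 1) (evens 1 S)" by (auto simp: image_iff)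
    moreover have "{- 1..<- 1 + 2 * int (Suc n)} = insert (- 1) {0..2 * int n}" by auto
    ultimately show ?thesis by auto
  qed
  then have "strip_sum r ({0..2 * int n} - evens 1 S - evens 0 (e ` {..<d})) =
      (if ?S \<subseteq> (\<Union>i<d. gap e i) \<and> (\<forall>i<d. card (?S \<inter> gap e i) = 1) then 1 else 0)"
    by (simp only:) (rule strip_sum_even_row, use e S in \<open>auto simp: less_Suc_eq_le\<close>)
  also have "?S \<subseteq> (\<Union>i<d. gap e i) \<and> (\<forall>i<d. card (?S \<inter> gap e i) = 1) \<longleftrightarrow>
    d \<noteq> 0 \<and> S \<subseteq> (\<Union>i<d - 1. {e i..<e (Suc i)}) \<and> (\<forall>i<d - 1. card (S \<inter> {e i..<e (Suc i)}) = 1)"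
  proof (cases d)
    case (Suc m)
    have U: "(\<Union>i<d. gap e i) = {..e m}"
      using gap_Union[of m e] e Suc by (simp add: lessThan_Suc_atMost)
    have V: "(\<Union>i<k. {e i..<e (Suc i)}) = {e 0..<e k}" if "k \<le> m" for k
      using that
    proof (induction k)
      case (Suc k)
      have "e k < e (Suc k)" using e Suc.prems \<open>d = Suc m\<close> by simp
      moreover have "e 0 \<le> e k"
        using strict_chain[of d e 0 k] e Suc.prems \<open>d = Suc m\<close> by (cases k) (auto simp: less_imp_le)
      ultimately show ?case using Suc by (auto simp: lessThan_Suc)
    qed simp
    \<comment> \<open>The virtual cell of index \<open>0\<close> already fills the first gap, so
      \<open>S\<close> has nothing west of \<open>e 0\<close>. Hence \<open>d\<close> dents go with
      only \<open>d - 1\<close> crossings.\<close>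
    have c0: "card (?S \<inter> gap e 0) = 1 \<longleftrightarrow> S \<inter> {..<e 0} = {}"
    proof -
      have "?S \<inter> gap e 0 = insert 0 (Suc ` (S \<inter> {..<e 0}))" by (auto simp: gap_def Suc_le_eq)
      then show ?thesis by (simp add: card_insert_if card_image)
    qed
    have c: "card (?S \<inter> gap e (Suc i)) = card (S \<inter> {e i..<e (Suc i)})" for i
    proof -
      have "?S \<inter> gap e (Suc i) = Suc ` (S \<inter> {e i..<e (Suc i)})" by (auto simp: gap_def Suc_le_eq)
      then show ?thesis by (simp add: card_image)
    qed
    have sub: "?S \<subseteq> {..e m} \<longleftrightarrow> S \<subseteq> {..<e m}" by (auto simp: Suc_le_eq)
    have "(\<forall>i<d. card (?S \<inter> gap e i) = 1) \<longleftrightarrow>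
        S \<inter> {..<e 0} = {} \<and> (\<forall>i<m. card (S \<inter> {e i..<e (Suc i)}) = 1)"
      unfolding Suc All_less_Suc2 c0 c ..
    moreover have "S \<subseteq> {..<e m} \<and> S \<inter> {..<e 0} = {} \<longleftrightarrow> S \<subseteq> {e 0..<e m}"
      by (auto simp: disjoint_iff subset_iff not_less)
    moreover have "(\<Union>i<d - 1. {e i..<e (Suc i)}) = {e 0..<e m}" using V[of m] Suc by simp
    ultimately show ?thesis unfolding U sub using Suc by auto
  qed simp
  finally show ?thesis .
qed

text \<open>A set meeting each of the disjoint \<open>J i\<close> exactly once is the image of a
  unique choice function. This brings the 0/1 value of a row into the form that row multilinearity
  (\<open>sum_det_rows\<close>) requires.\<close>

lemma sum_over_selectors:
  fixes J :: "nat \<Rightarrow> 'b set" and g :: "'b set \<Rightarrow> real"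
  assumes J: "\<And>i. i < d \<Longrightarrow> finite (J i)" "\<And>i k. i < d \<Longrightarrow> k < d \<Longrightarrow> i \<noteq> k \<Longrightarrow> J i \<inter> J k = {}"
    and X: "finite X" "(\<Union>i<d. J i) \<subseteq> X"
  shows "(\<Sum>S\<in>Pow X. (if S \<subseteq> (\<Union>i<d. J i) \<and> (\<forall>i<d. card (S \<inter> J i) = 1) then 1 else 0) * g S) =
    (\<Sum>s\<in>PiE {..<d} J. g (s ` {..<d}))"
proof -
  let ?P = "\<lambda>S. S \<subseteq> (\<Union>i<d. J i) \<and> (\<forall>i<d. card (S \<inter> J i) = 1)"
  have "(\<Sum>S\<in>Pow X. (if ?P S then 1 else 0) * g S) = (\<Sum>S\<in>Pow X. if ?P S then g S else 0)"
    by (intro sum.cong) auto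
  also have "\<dots> = (\<Sum>S\<in>{S\<in>Pow X. ?P S}. g S)"
    by (rule sum.inter_filter[symmetric]) (use X in simp)
  also have "{S\<in>Pow X. ?P S} = Collect ?P" using X by auto
  also have "(\<Sum>S\<in>Collect ?P. g S) = (\<Sum>s\<in>PiE {..<d} J. g (s ` {..<d}))"
  proof (rule sum.reindex_bij_witness[where i = "\<lambda>s. s ` {..<d}" and
        j = "\<lambda>S. \<lambda>i\<in>{..<d}. the_elem (S \<inter> J i)"])
    fix S assume "S \<in> Collect ?P"
    then have S: "S \<subseteq> (\<Union>i<d. J i)" "\<And>i. i < d \<Longrightarrow> card (S \<inter> J i) = 1" by auto
    have t: "S \<inter> J i = {the_elem (S \<inter> J i)}" if "i < d" for i
      using S(2)[OF that] by (metis card_1_singletonE the_elem_eq)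
    have "(\<lambda>i\<in>{..<d}. the_elem (S \<inter> J i)) ` {..<d} = (\<Union>i<d. {the_elem (S \<inter> J i)})" by auto
    also have "\<dots> = (\<Union>i<d. S \<inter> J i)" using t by auto
    also have "\<dots> = S" using S(1) by auto
    finally show *: "(\<lambda>i\<in>{..<d}. the_elem (S \<inter> J i)) ` {..<d} = S" .
    show "(\<lambda>i\<in>{..<d}. the_elem (S \<inter> J i)) \<in> PiE {..<d} J"
      using t by auto
    show "g ((\<lambda>i\<in>{..<d}. the_elem (S \<inter> J i)) ` {..<d}) = g S" using * by simp
  next
    fix s assume s: "s \<in> PiE {..<d} J"
    have c: "s ` {..<d} \<inter> J i = {s i}" if "i < d" for i
    proof -
      have "s k \<notin> J i" if "k < d" "k \<noteq> i" for k
        using J(2)[of k i] that \<open>i < d\<close> PiE_mem[OF s, of k] by auto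
      then show ?thesis using that PiE_mem[OF s, of i] by auto
    qed
    show "(\<lambda>i\<in>{..<d}. the_elem (s ` {..<d} \<inter> J i)) = s"
    proof
      fix i
      show "(\<lambda>i\<in>{..<d}. the_elem (s ` {..<d} \<inter> J i)) i = s i"
        using c[of i] PiE_arb[OF s, of i] by (cases "i < d") simp_all
    qed
    have "s ` {..<d} \<subseteq> (\<Union>i<d. J i)" using PiE_mem[OF s] by auto
    then show "s ` {..<d} \<in> Collect ?P" using c by simp
  qed
  finally show ?thesis .
qed

section \<open>Trapezoids with unit dents\<close>

text \<open>Positions on a line are numbered from the west, starting with \<open>0\<close>.\<close>

definition base_pos :: "nat \<Rightarrow> nat \<Rightarrow> int" where
  "base_pos h q = 2 * int q + (if even h then 1 else 0)"

text \<open>Line \<open>h\<close> runs from \<open>- (h mod 2)\<close> to \<open>2 * N + h\<close>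
  in half-units, whence the rounding.\<close>

definition base_width :: "nat \<Rightarrow> nat \<Rightarrow> nat" where
  "base_width N h = N + (h + 1) div 2"

definition base_cells :: "nat \<Rightarrow> nat set \<Rightarrow> triangle set" where
  "base_cells h D = (\<lambda>q. (int h, base_pos h q)) ` D"

definition trapezoid_sum :: "nat \<Rightarrow> nat \<Rightarrow> nat set \<Rightarrow> real" where
  "trapezoid_sum N h D = tiling_sum west_weight (zigzag_region N h 0 - base_cells h D)"

lemma zigzag_region_0:
  "zigzag_region N h 0 = {(r, p). 1 \<le> r \<and> r \<le> int h \<and> 0 \<le> p \<and> p \<le> 2 * int N + r - 1}"
  by (auto simp: zigzag_region_def)

lemma finite_zigzag_region [simp]: "finite (zigzag_region N ne se)"
  by (rule finite_subset[of _ "{1..int ne + int se} \<times> {0..2 * int N + 2 * int ne}"])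
     (auto simp: zigzag_region_def split: if_splits)

lemma inj_base_pos: "inj_on (base_pos h) A"
  by (auto simp: inj_on_def base_pos_def)

lemma sum_Pow_image:
  assumes "inj_on f A"
  shows "(\<Sum>T\<in>Pow (f ` A). g T) = (\<Sum>S\<in>Pow A. g (f ` S))"
  using sum.reindex[OF inj_on_image_Pow[OF assms], of g]
  by (simp add: image_Pow_surj[OF refl] comp_def)

text \<open>The weighted lozenges join rows \<open>2 * i - 1\<close> and \<open>2 * i\<close> at
  horizontal position \<open>0\<close>. On an odd line this is position number \<open>0\<close>; on
  an even line no crossing lies there.\<close>

lemma west_weight_crossing:
  assumes "h \<ge> 1"
  shows "west_weight {(int h, base_pos h q), (int h + 1, base_pos h q)} =
    (if odd h then wall_weight q else 1)"
proof (cases "odd h \<and> q = 0")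
  case True
  then have "\<exists>i\<ge>1. int h = 2 * i - 1" by (intro exI[of _ "(int h + 1) div 2"]) (use assms in presburger)
  then show ?thesis using True by (auto simp: west_weight_def wall_weight_def base_pos_def)
next
  case False
  then have "base_pos h q \<noteq> 0" by (auto simp: base_pos_def)
  then show ?thesis using False by (auto simp: west_weight_def wall_weight_def doubleton_eq_iff)
qed

text \<open>Cutting along line \<open>h\<close> leaves a smaller trapezoid with unit dents at the
  crossings \<open>S\<close> and a single row that lacks the cells at \<open>S\<close> and at
  \<open>D\<close>.\<close>

lemma trapezoid_sum_Suc:
  assumes "h \<ge> 1"
  shows "trapezoid_sum N (Suc h) D =
    (\<Sum>S\<in>Pow {..<base_width N h}. (\<Prod>q\<in>S. if odd h then wall_weight q else 1) * trapezoid_sum N h S *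
       strip_sum (int h + 1) ({0..2 * int N + int h} - base_pos h ` S - base_pos (Suc h) ` D))"
proof -
  let ?A = "zigzag_region N h 0"
  let ?B = "Pair (int h + 1) ` ({0..2 * int N + int h} - base_pos (Suc h) ` D)"
  have AB: "zigzag_region N (Suc h) 0 - base_cells (Suc h) D = ?A \<union> ?B"
    by (auto simp: zigzag_region_0 base_cells_def image_iff)
  have P: "{p. odd (int h + p) \<and> (int h, p) \<in> ?A \<and> (int h + 1, p) \<in> ?B} = base_pos h ` {..<base_width N h}"
    (is "?P = _")
  proof (rule Set.set_eqI)
    fix p
    have "p \<in> ?P \<longleftrightarrow> odd (int h + p) \<and> 0 \<le> p \<and> p \<le> 2 * int N + int h - 1"
      using assms by (auto simp: zigzag_region_0 base_pos_def split: if_splits)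
    also have "\<dots> \<longleftrightarrow> p \<in> base_pos h ` {..<base_width N h}"
    proof
      assume p: "odd (int h + p) \<and> 0 \<le> p \<and> p \<le> 2 * int N + int h - 1"
      have "p = base_pos h (nat (p div 2))" "nat (p div 2) < base_width N h"
        using p by (auto simp: base_pos_def base_width_def)
      then show "p \<in> base_pos h ` {..<base_width N h}" by blast
    next
      assume "p \<in> base_pos h ` {..<base_width N h}"
      then obtain q where "p = base_pos h q" "q < base_width N h" by blast
      then show "odd (int h + p) \<and> 0 \<le> p \<and> p \<le> 2 * int N + int h - 1"
        using assms by (auto simp: base_pos_def base_width_def split: if_splits) presburger+
    qed
    finally show "p \<in> ?P \<longleftrightarrow> p \<in> base_pos h ` {..<base_width N h}" .
  qed
  have "trapezoid_sum N (Suc h) D = tiling_sum west_weight (?A \<union> ?B)"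
    unfolding trapezoid_sum_def AB ..
  also have "\<dots> = (\<Sum>S\<in>Pow ?P. (\<Prod>p\<in>S. west_weight {(int h, p), (int h + 1, p)}) *
      tiling_sum west_weight (?A - Pair (int h) ` S) * tiling_sum west_weight (?B - Pair (int h + 1) ` S))"
    by (rule tiling_sum_line, rule finite_zigzag_region) (auto simp: zigzag_region_0)
  also have "\<dots> = (\<Sum>S\<in>Pow {..<base_width N h}. (\<Prod>p\<in>base_pos h ` S. west_weight {(int h, p), (int h + 1, p)}) *
      tiling_sum west_weight (?A - Pair (int h) ` base_pos h ` S) *
      tiling_sum west_weight (?B - Pair (int h + 1) ` base_pos h ` S))"
    unfolding P by (rule sum_Pow_image[OF inj_base_pos])
  also have "\<dots> = (\<Sum>S\<in>Pow {..<base_width N h}. (\<Prod>q\<in>S. if odd h then wall_weight q else 1) * trapezoid_sum N h S *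
       strip_sum (int h + 1) ({0..2 * int N + int h} - base_pos h ` S - base_pos (Suc h) ` D))"
  proof (rule sum.cong[OF refl])
    fix S
    have "?B - Pair (int h + 1) ` base_pos h ` S =
      Pair (int h + 1) ` ({0..2 * int N + int h} - base_pos h ` S - base_pos (Suc h) ` D)" by auto
    moreover have "Pair (int h) ` base_pos h ` S = base_cells h S"
      by (simp add: base_cells_def image_image)
    moreover have "(\<Prod>p\<in>base_pos h ` S. west_weight {(int h, p), (int h + 1, p)}) =
        (\<Prod>q\<in>S. if odd h then wall_weight q else 1)"
      by (subst prod.reindex[OF inj_base_pos]) (simp add: west_weight_crossing[OF assms])
    ultimately show "(\<Prod>p\<in>base_pos h ` S. west_weight {(int h, p), (int h + 1, p)}) *
      tiling_sum west_weight (?A - Pair (int h) ` base_pos h ` S) *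
      tiling_sum west_weight (?B - Pair (int h + 1) ` base_pos h ` S) =
      (\<Prod>q\<in>S. if odd h then wall_weight q else 1) * trapezoid_sum N h S *
       strip_sum (int h + 1) ({0..2 * int N + int h} - base_pos h ` S - base_pos (Suc h) ` D)"
      by (simp only: trapezoid_sum_def)
  qed
  finally show ?thesis .
qed

text \<open>Induction on the number of rows. Passing an odd line keeps the number of dents and turns
  \<open>cfe\<close> into \<open>cfo\<close>; passing an even line adds a dent and turns
  \<open>cfo\<close> back into \<open>cfe\<close>. The value \<open>0\<close> for other
  \<open>d\<close> is carried along because \<open>d\<close> varies in the induction.\<close>

lemma trapezoid_sum_det:
  assumes "h \<ge> 1" "\<And>i. Suc i < d \<Longrightarrow> e i < e (Suc i)" "\<And>i. i < d \<Longrightarrow> e i < base_width N h"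
  shows "trapezoid_sum N h (e ` {..<d}) =
    (if d = (h + 1) div 2
     then if even h then det (mat d d (\<lambda>(i, j). cfo j (real (e i) + 1 / 2)))
       else det (mat d d (\<lambda>(i, j). cfe j (real (e i))))
     else 0)"
  using assms
proof (induction h arbitrary: d e rule: nat_induct_at_least)
  case base
  have "zigzag_region N 1 0 - base_cells 1 (e ` {..<d}) =
      Pair 1 ` ({0..2 * int N} - evens 1 {} - evens 0 (e ` {..<d}))"
    by (auto simp: zigzag_region_0 base_cells_def base_pos_def image_iff)
  then have "trapezoid_sum N 1 (e ` {..<d}) = strip_sum 1 ({0..2 * int N} - evens 1 {} - evens 0 (e ` {..<d}))"
    by (simp only: trapezoid_sum_def)
  also have "\<dots> = (if d \<noteq> 0 \<and> {} \<subseteq> (\<Union>i<d - 1. {e i..<e (Suc i)}) \<and>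
      (\<forall>i<d - 1. card ({} \<inter> {e i..<e (Suc i)}) = 1) then 1 else 0)"
    by (rule strip_sum_odd_row) (use base in \<open>auto simp: base_width_def less_Suc_eq_le\<close>)
  \<comment> \<open>Nothing crosses into a single row from above, so any interval between
    consecutive dents would lack its required element: only \<open>d = 1\<close> survives.\<close>
  also have "\<dots> = (if d = 1 then 1 else 0)"
    by (cases d; cases "d - 1") auto
  also have "\<dots> = (if d = 1 then det (mat d d (\<lambda>(i, j). cfe j (real (e i)))) else 0)"
    using det_cfe[of 1 "\<lambda>i. real (e i)"] by simp
  finally show ?case by simp
next
  case (Suc h)
  let ?n = "base_width N h"
  have smono: "s i < s (Suc i)" if "s \<in> PiE {..<m} J" "\<And>i x y. Suc i < m \<Longrightarrow> x \<in> J i \<Longrightarrow> y \<in> J (Suc i) \<Longrightarrow> x < y" "Suc i < m"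
    for s m i and J :: "nat \<Rightarrow> nat set"
    using that(2)[OF that(3)] PiE_mem[OF that(1), of i] PiE_mem[OF that(1), of "Suc i"] that(3) by simp
  have disjoint: "J i \<inter> J k = {}" if J: "\<And>i k x y. i < k \<Longrightarrow> k < m \<Longrightarrow> x \<in> J i \<Longrightarrow> y \<in> J k \<Longrightarrow> x < y" "i < m" "k < m" "i \<noteq> k"
    for J :: "nat \<Rightarrow> nat set" and i k m
  proof (rule ccontr)
    assume "J i \<inter> J k \<noteq> {}"
    then obtain x where "x \<in> J i" "x \<in> J k" by blast
    then show False using J(1)[of i k x x] J(1)[of k i x x] J(2-4) by (meson less_irrefl linorder_neqE_nat)
  qed
  note chain = strict_chain[of d e, OF Suc.prems(1)]
  show ?case
  proof (cases "odd h")
    \<comment> \<open>Row \<open>h + 1\<close> is even: crossings occupy the cells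
      \<open>0, 2, ...\<close> and dents the cells \<open>1, 3, ...\<close>. A crossing at the wall
      has weight \<open>1 / 2\<close>.\<close>
    case True
    then have wid: "base_width N (Suc h) = ?n" by (auto simp: base_width_def elim!: oddE)
    have row: "{0..2 * int N + int h} = {0..<0 + 2 * int ?n}"
      using True by (auto simp: base_width_def elim!: oddE)
    have gaplt: "x < y" if "i < k" "k < d" "x \<in> gap e i" "y \<in> gap e k" for i k x y
    proof -
      have "i = k - 1 \<or> i < k - 1 \<and> k - 1 < d" using that by arith
      then have "e i \<le> e (k - 1)" using chain[of i "k - 1"] by auto
      then show ?thesis using that by (auto simp: gap_def)
    qed
    have s: "Suc i < d \<Longrightarrow> s i < s (Suc i)" "i < d \<Longrightarrow> s i < ?n" if "s \<in> PiE {..<d} (gap e)" for s i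
    proof -
      show "s i < s (Suc i)" if "Suc i < d"
        by (rule smono[OF \<open>s \<in> PiE {..<d} (gap e)\<close> _ that]) (rule gaplt, auto)
      show "s i < ?n" if "i < d"
        using PiE_mem[OF \<open>s \<in> PiE {..<d} (gap e)\<close>, of i] that Suc.prems(2)[of i] wid by (auto simp: gap_def)
    qed
    have "trapezoid_sum N (Suc h) (e ` {..<d}) =
        (\<Sum>S\<in>Pow {..<?n}. strip_sum (int h + 1) ({0..<0 + 2 * int ?n} - evens 0 S - evens (0 + 1) (e ` {..<d})) *
          ((\<Prod>q\<in>S. wall_weight q) * trapezoid_sum N h S))"
      unfolding trapezoid_sum_Suc[OF Suc.hyps] row
      by (rule sum.cong[OF refl]) (use True in \<open>simp add: base_pos_def add.commute\<close>)
    also have "\<dots> = (\<Sum>S\<in>Pow {..<?n}. (if S \<subseteq> (\<Union>i<d. gap e i) \<and> (\<forall>i<d. card (S \<inter> gap e i) = 1) then 1 else 0) *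
          ((\<Prod>q\<in>S. wall_weight q) * trapezoid_sum N h S))"
      by (rule sum.cong[OF refl], subst strip_sum_even_row) (use Suc.prems wid in auto)
    also have "\<dots> = (\<Sum>s\<in>PiE {..<d} (gap e). (\<Prod>q\<in>s ` {..<d}. wall_weight q) * trapezoid_sum N h (s ` {..<d}))"
    proof (rule sum_over_selectors)
      show "gap e i \<inter> gap e k = {}" if "i < d" "k < d" "i \<noteq> k" for i k
      proof (rule disjoint[of d "gap e", OF _ that])
        show "x < y" if "i < k" "k < d" "x \<in> gap e i" "y \<in> gap e k" for i k x y
          by (rule gaplt[OF that])
      qed
      show "(\<Union>i<d. gap e i) \<subseteq> {..<?n}"
        using Suc.prems(2) wid by (fastforce simp: gap_def)
    qed (auto simp: gap_def)
    also have "\<dots> = (\<Sum>s\<in>PiE {..<d} (gap e). (\<Prod>i<d. wall_weight (s i)) *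
        (if d = (h + 1) div 2 then det (mat d d (\<lambda>(i, j). cfe j (real (s i)))) else 0))"
    proof (rule sum.cong[OF refl])
      fix t assume t: "t \<in> PiE {..<d} (gap e)"
      have "inj_on t {..<d}"
      proof (rule linorder_inj_onI)
        show "t x \<noteq> t y" if "x < y" "x \<in> {..<d}" "y \<in> {..<d}" for x y
          using strict_chain[of d t x y] s(1)[OF t] that by simp
      qed auto
      then have "(\<Prod>q\<in>t ` {..<d}. wall_weight q) = (\<Prod>i<d. wall_weight (t i))"
        by (simp add: prod.reindex)
      moreover have "trapezoid_sum N h (t ` {..<d}) =
        (if d = (h + 1) div 2 then det (mat d d (\<lambda>(i, j). cfe j (real (t i)))) else 0)"
        using Suc.IH[of d t] s[OF t] True by simp
      ultimately show "(\<Prod>q\<in>t ` {..<d}. wall_weight q) * trapezoid_sum N h (t ` {..<d}) =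
        (\<Prod>i<d. wall_weight (t i)) *
        (if d = (h + 1) div 2 then det (mat d d (\<lambda>(i, j). cfe j (real (t i)))) else 0)"
        by simp
    qed
    also have "\<dots> = (if d = (h + 1) div 2 then det (mat d d (\<lambda>(i, j). cfo j (real (e i) + 1 / 2))) else 0)"
    proof (cases "d = (h + 1) div 2")
      case d: True
      show ?thesis
        using sum_det_cfe[of d e, OF Suc.prems(1)] unfolding gap_def[abs_def] by (simp only: if_P[OF d])
    qed simp
    finally show ?thesis using True by (auto elim!: oddE)
  next
    \<comment> \<open>Row \<open>h + 1\<close> is odd: the two kinds of cells exchange their roles,
      and the first dent may sit at the wall.\<close>
    case False
    then have wid: "base_width N (Suc h) = Suc ?n" by (auto simp: base_width_def elim!: evenE)
    have row: "{0..2 * int N + int h} = {0..2 * int ?n}"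
      using False by (auto simp: base_width_def elim!: evenE)
    have "trapezoid_sum N (Suc h) (e ` {..<d}) =
        (\<Sum>S\<in>Pow {..<?n}. strip_sum (int h + 1) ({0..2 * int ?n} - evens 1 S - evens 0 (e ` {..<d})) *
          trapezoid_sum N h S)"
      unfolding trapezoid_sum_Suc[OF Suc.hyps] row
      by (rule sum.cong[OF refl]) (use False in \<open>simp add: base_pos_def add.commute\<close>)
    also have "\<dots> = (\<Sum>S\<in>Pow {..<?n}. (if d \<noteq> 0 \<and> S \<subseteq> (\<Union>i<d - 1. {e i..<e (Suc i)}) \<and>
        (\<forall>i<d - 1. card (S \<inter> {e i..<e (Suc i)}) = 1) then 1 else 0) * trapezoid_sum N h S)"
    proof (rule sum.cong[OF refl])
      fix S assume "S \<in> Pow {..<?n}"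
      then show "strip_sum (int h + 1) ({0..2 * int ?n} - evens 1 S - evens 0 (e ` {..<d})) * trapezoid_sum N h S =
        (if d \<noteq> 0 \<and> S \<subseteq> (\<Union>i<d - 1. {e i..<e (Suc i)}) \<and>
        (\<forall>i<d - 1. card (S \<inter> {e i..<e (Suc i)}) = 1) then 1 else 0) * trapezoid_sum N h S"
        using strip_sum_odd_row[of d e ?n S "int h + 1", OF Suc.prems(1)] Suc.prems(2) wid
        by (simp add: less_Suc_eq_le)
    qed
    finally have eq: "trapezoid_sum N (Suc h) (e ` {..<d}) =
      (\<Sum>S\<in>Pow {..<?n}. (if d \<noteq> 0 \<and> S \<subseteq> (\<Union>i<d - 1. {e i..<e (Suc i)}) \<and>
        (\<forall>i<d - 1. card (S \<inter> {e i..<e (Suc i)}) = 1) then 1 else 0) * trapezoid_sum N h S)" .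
    show ?thesis
    proof (cases d)
      case 0
      then show ?thesis unfolding eq by simp
    next
      case d: (Suc m)
      let ?J = "\<lambda>i. {e i..<e (Suc i)}"
      have Jlt: "x < y" if "i < k" "k < m" "x \<in> ?J i" "y \<in> ?J k" for i k x y
      proof -
        have "e (Suc i) \<le> e k" using chain[of "Suc i" k] that d by (cases "Suc i = k") auto
        then show ?thesis using that by auto
      qed
      have s: "Suc i < m \<Longrightarrow> s i < s (Suc i)" "i < m \<Longrightarrow> s i < ?n" if "s \<in> PiE {..<m} ?J" for s i
      proof -
        show "s i < s (Suc i)" if "Suc i < m"
          by (rule smono[OF \<open>s \<in> PiE {..<m} ?J\<close> _ that]) (rule Jlt, auto)
        show "s i < ?n" if "i < m"
          using PiE_mem[OF \<open>s \<in> PiE {..<m} ?J\<close>, of i] that Suc.prems(2)[of "Suc i"] wid d by auto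
      qed
      have "trapezoid_sum N (Suc h) (e ` {..<d}) =
        (\<Sum>S\<in>Pow {..<?n}. (if S \<subseteq> (\<Union>i<m. ?J i) \<and> (\<forall>i<m. card (S \<inter> ?J i) = 1) then 1 else 0) *
          trapezoid_sum N h S)"
        unfolding eq using d by simp
      also have "\<dots> = (\<Sum>s\<in>PiE {..<m} ?J. trapezoid_sum N h (s ` {..<m}))"
      proof (rule sum_over_selectors)
        show "?J i \<inter> ?J k = {}" if "i < m" "k < m" "i \<noteq> k" for i k
        proof (rule disjoint[of m ?J, OF _ that])
          show "x < y" if "i < k" "k < m" "x \<in> ?J i" "y \<in> ?J k" for i k x y
            by (rule Jlt[OF that])
        qed
        show "(\<Union>i<m. ?J i) \<subseteq> {..<?n}"
        proof
          fix x assume "x \<in> (\<Union>i<m. ?J i)"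
          then obtain i where "i < m" "x < e (Suc i)" by auto
          then show "x \<in> {..<?n}" using Suc.prems(2)[of "Suc i"] wid d by simp
        qed
      qed auto
      also have "\<dots> = (\<Sum>s\<in>PiE {..<m} ?J.
        (if m = (h + 1) div 2 then det (mat m m (\<lambda>(i, j). cfo j (real (s i) + 1 / 2))) else 0))"
        using Suc.IH[of m] s False by (intro sum.cong refl) simp
      also have "\<dots> = (if m = (h + 1) div 2 then det (mat d d (\<lambda>(i, j). cfe j (real (e i)))) else 0)"
      proof (cases "m = (h + 1) div 2")
        case m: True
        have "e i < e (Suc i)" if "i < m" for i using Suc.prems(1) d that by simp
        then show ?thesis
          unfolding d if_P[OF m] by (rule sum_det_cfo)
      qed simp
      finally show ?thesis using False d by (auto elim!: evenE)
    qed
  qed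
qed

section \<open>Product form of the trapezoid count\<close>

lemma H2_even: "H2 (2 * d) = (\<Prod>j<d. fact (2 * j))"
  unfolding H2_def
  by (rule prod.reindex_bij_witness[where i = "\<lambda>j. d - j" and j = "\<lambda>i. d - i"])
     (auto simp: diff_mult_distrib2)

lemma H2_odd: "H2 (2 * d + 1) = (\<Prod>j<d. fact (2 * j + 1))"
  unfolding H2_def
  by (rule prod.reindex_bij_witness[where i = "\<lambda>j. d - j" and j = "\<lambda>i. d - i"])
     (auto simp: diff_mult_distrib2 Suc_diff_le)

text \<open>Attached to a set of positions, with signs fixed by the order of the naturals, so that
  it can be split along unions of dent sets.\<close>

definition vandermonde :: "(nat \<Rightarrow> real) \<Rightarrow> nat set \<Rightarrow> real" where
  "vandermonde X D = (\<Prod>q\<in>D. \<Prod>q'\<in>{q'\<in>D. q' < q}. X q - X q')"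

lemma vandermonde_image:
  assumes "\<And>i. Suc i < d \<Longrightarrow> e i < e (Suc i)"
  shows "vandermonde X (e ` {..<d}) = (\<Prod>i<d. \<Prod>l<i. X (e i) - X (e l))"
proof -
  have lt: "e i < e j" if "i < j" "j < d" for i j using strict_chain[of d e] assms that by blast
  have inj: "inj_on e {..<d}"
    by (rule linorder_inj_onI) (use lt in \<open>auto dest: less_imp_neq\<close>)
  have "{q'\<in>e ` {..<d}. q' < e i} = e ` {..<i}" if "i < d" for i
  proof -
    have "e k < e i \<longleftrightarrow> k < i" if "k < d" for k
      using lt[of i k] lt[of k i] that \<open>i < d\<close> by (cases i k rule: linorder_cases) auto
    then have "{q'\<in>e ` {..<d}. q' < e i} = e ` {k\<in>{..<d}. k < i}" by auto
    also have "{k\<in>{..<d}. k < i} = {..<i}" using that by auto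
    finally show ?thesis .
  qed
  moreover have "inj_on e {..<i}" if "i < d" for i
    by (rule inj_on_subset[OF inj]) (use that in auto)
  ultimately show ?thesis
    unfolding vandermonde_def by (subst prod.reindex[OF inj]) (simp add: prod.reindex)
qed

text \<open>Numerator of the determinant of central factorials. Only the parity of \<open>y\<close>
  matters; it is that of \<open>h + 1\<close> for a trapezoid with \<open>h\<close> rows. The point
  \<open>q\<close> or \<open>q + 1 / 2\<close> is half of \<open>base_pos h q\<close>.\<close>

definition dent_product :: "nat \<Rightarrow> nat set \<Rightarrow> real" where
  "dent_product y D = (if odd y
    then (\<Prod>q\<in>D. real q + 1 / 2) * vandermonde (\<lambda>q. (real q + 1 / 2)\<^sup>2) D
    else vandermonde (\<lambda>q. (real q)\<^sup>2) D)"

lemma strict_enumeration: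
  fixes D :: "nat set"
  assumes "finite D"
  obtains e where "\<And>i. Suc i < card D \<Longrightarrow> e i < e (Suc i)" "D = e ` {..<card D}"
proof
  let ?e = "\<lambda>i. sorted_list_of_set D ! i"
  show "?e i < ?e (Suc i)" if "Suc i < card D" for i
    by (rule sorted_wrt_nth_less[OF strict_sorted_list_of_set]) (use that in auto)
  show "D = ?e ` {..<card D}"
    using assms nth_image[of "card D" "sorted_list_of_set D"] by (simp add: atLeast0LessThan)
qed

text \<open>\<open>H2 (h + 1)\<close> collects the factorial denominators of the columns:
  \<open>fact (2 * j)\<close> for odd \<open>h\<close> and \<open>fact (2 * j + 1)\<close> for even
  \<open>h\<close>.\<close>

theorem trapezoid_sum_eq:
  assumes "h \<ge> 1" "D \<subseteq> {..<base_width N h}"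
  shows "trapezoid_sum N h D =
    (if card D = (h + 1) div 2 then dent_product (h + 1) D / H2 (h + 1) else 0)"
proof -
  obtain e where e: "\<And>i. Suc i < card D \<Longrightarrow> e i < e (Suc i)" and D: "D = e ` {..<card D}"
    using strict_enumeration[of D] finite_subset[OF assms(2)] by auto
  have bound: "e i < base_width N h" if "i < card D" for i
    using D assms(2) that by blast
  have inj: "inj_on e {..<card D}"
    using D by (intro eq_card_imp_inj_on) auto
  note vd = vandermonde_image[of "card D" e, OF e, folded D]
  have pr: "(\<Prod>q\<in>D. real q + 1 / 2) = (\<Prod>i<card D. real (e i) + 1 / 2)"
    using prod.reindex[OF inj, of "\<lambda>q. real q + 1 / 2"] D by simp
  have "trapezoid_sum N h D = (if card D = (h + 1) div 2
     then if even h then det (mat (card D) (card D) (\<lambda>(i, j). cfo j (real (e i) + 1 / 2)))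
       else det (mat (card D) (card D) (\<lambda>(i, j). cfe j (real (e i))))
     else 0)"
    using trapezoid_sum_det[of h "card D" e N, OF assms(1) e bound] D by simp
  also have "\<dots> = (if card D = (h + 1) div 2 then dent_product (h + 1) D / H2 (h + 1) else 0)"
  proof (cases "even h")
    case True
    then have "H2 (h + 1) = (\<Prod>j<(h + 1) div 2. fact (2 * j + 1))"
      using H2_odd[of "h div 2"] by (auto elim!: evenE)
    then show ?thesis using True
      by (simp add: det_cfo[where X = "\<lambda>i. real (e i) + 1 / 2"] dent_product_def vd pr)
  next
    case False
    then have "H2 (h + 1) = (\<Prod>j<(h + 1) div 2. fact (2 * j))"
      using H2_even[of "(h + 1) div 2"] by (auto elim!: oddE)
    then show ?thesis using False
      by (simp add: det_cfe[where X = "\<lambda>i. real (e i)"] dent_product_def vd)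
  qed
  finally show ?thesis .
qed

section \<open>Triangular dents and ferns\<close>

definition triangle_base :: "int \<Rightarrow> int \<Rightarrow> nat \<Rightarrow> triangle set" where
  "triangle_base j c k = {(r, p). r = j \<and> c < p \<and> p < c + 2 * int k \<and> odd (j + p)}"

lemma triangle_base_subset: "triangle_base j c k \<subseteq> up_triangle j c k"
  by (auto simp: triangle_base_def up_triangle_def)

text \<open>Without the up-pointing cells of the bottom row, each down-pointing cell between them
  has only its upper neighbour left. These forced lozenges use up the base of the triangle one row
  higher and one unit smaller, and so on.\<close>

lemma tiling_sum_up_triangle:
  assumes "finite R" "up_triangle j c k \<subseteq> R" "c \<ge> - 1" "even (j + c)"
  shows "tiling_sum west_weight (R - triangle_base j c k) = tiling_sum west_weight (R - up_triangle j c k)"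
  using assms
proof (induction k arbitrary: R j c)
  case 0
  have "triangle_base j c 0 = {}" "up_triangle j c 0 = {}"
    by (auto simp: triangle_base_def up_triangle_def)
  then show ?case by simp
next
  case (Suc k)
  let ?B = "triangle_base j c (Suc k)"
  let ?D = "{p. c + 1 < p \<and> p < c + 1 + 2 * int k \<and> even (j + p)}"
  let ?L = "\<lambda>p. {(j - 1, p), (j, p)}"
  have finD: "finite ?D" by (rule finite_subset[of _ "{c..c + 1 + 2 * int k}"]) auto
  have step: "tiling_sum west_weight (R - ?B) = tiling_sum west_weight (R - ?B - (\<Union>p\<in>P. ?L p))"
    if P: "P \<subseteq> ?D" for P
    using finite_subset[OF P finD] P
  proof (induction P rule: finite_induct)
    case (insert p P)
    let ?R = "R - ?B - (\<Union>p\<in>P. ?L p)"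
    have p: "c + 1 < p" "p < c + 1 + 2 * int k" "even (j + p)" using insert.prems by auto
    have "tiling_sum west_weight ?R = west_weight (?L p) * tiling_sum west_weight (?R - ?L p)"
    proof (rule tiling_sum_forced[where t = "(j, p)"])
      show "finite ?R" using Suc.prems(1) by simp
      have "up_pointing (j - 1, p)" using p by (simp add: up_pointing_def)
      then show "lozenge (?L p)" unfolding lozenge_def vertical_lozenge_def
        by (intro disjI1 exI[of _ "j - 1"] exI[of _ p]) simp
      have "(j, p) \<in> up_triangle j c (Suc k)" "(j - 1, p) \<in> up_triangle j c (Suc k)"
        using p by (auto simp: up_triangle_def)
      then have "(j, p) \<in> R" "(j - 1, p) \<in> R" using Suc.prems(2) by auto
      then show "?L p \<subseteq> ?R" using p(3) insert.hyps(2) by (auto simp: triangle_base_def)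
      fix L' assume L': "lozenge L'" "L' \<subseteq> ?R" "(j, p) \<in> L'"
      have no: "(j, p + 1) \<in> ?B" "(j, p - 1) \<in> ?B"
        using p by (auto simp: triangle_base_def)
      consider r q where "odd (r + q)" "L' = {(r, q), (r + 1, q)}" | r q where "L' = {(r, q), (r, q + 1)}"
        using L'(1) unfolding lozenge_def vertical_lozenge_def up_pointing_def by auto
      then show "L' = ?L p"
      proof cases
        case (1 r q)
        then show ?thesis using L'(3) p(3) by auto
      next
        case (2 r q)
        then have "r = j \<and> (q = p \<or> q = p - 1)" using L'(3) by auto
        then show ?thesis using 2 L'(2) no by auto
      qed
    qed simp
    \<comment> \<open>The position exceeds \<open>c + 1\<close>, so \<open>c >= - 1\<close> keeps
      the forced lozenges off the wall and none of them has weight \<open>1 / 2\<close>.\<close>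
    moreover have "p \<noteq> 0" using p Suc.prems(3) by auto
    then have "west_weight (?L p) = 1" by (auto simp: west_weight_def doubleton_eq_iff)
    moreover have "?R - ?L p = R - ?B - (\<Union>p\<in>insert p P. ?L p)" by auto
    moreover have "tiling_sum west_weight (R - ?B) = tiling_sum west_weight ?R"
      using insert.IH insert.prems by blast
    ultimately show ?case by (simp only: mult_1_left)
  qed simp
  let ?R = "R - {(r, p). r = j \<and> c < p \<and> p < c + 2 * int (Suc k)}"
  have eq1: "R - ?B - (\<Union>p\<in>?D. ?L p) = ?R - triangle_base (j - 1) (c + 1) k"
  proof (rule Set.set_eqI)
    fix t :: triangle
    obtain r p where t: "t = (r, p)" by (cases t)
    have U: "(r, p) \<in> (\<Union>p\<in>?D. ?L p) \<longleftrightarrow> (r = j - 1 \<or> r = j) \<and> c + 1 < p \<and> p < c + 1 + 2 * int k \<and> even (j + p)"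
      by auto
    have "(r, p) \<in> ?B \<or> (r, p) \<in> (\<Union>p\<in>?D. ?L p) \<longleftrightarrow>
      (r = j \<and> c < p \<and> p < c + 2 * int (Suc k)) \<or> (r, p) \<in> triangle_base (j - 1) (c + 1) k"
    proof -
      define b where "b = even (j + p)"
      have "p \<noteq> c + 1 \<and> p \<noteq> c + 1 + 2 * int k" if b using that Suc.prems(4) by (auto simp: b_def)
      moreover have b: "even (j + p) = b" "even (j - 1 + p) = (\<not> b)" by (auto simp: b_def)
      ultimately show ?thesis
        unfolding U triangle_base_def mem_Collect_eq prod.case b by (cases b) auto
    qed
    then show "t \<in> R - ?B - (\<Union>p\<in>?D. ?L p) \<longleftrightarrow> t \<in> ?R - triangle_base (j - 1) (c + 1) k"
      unfolding t by auto
  qed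
  have eq2: "?R - up_triangle (j - 1) (c + 1) k = R - up_triangle j c (Suc k)"
    by (auto simp: up_triangle_def)
  have "tiling_sum west_weight (?R - triangle_base (j - 1) (c + 1) k) =
      tiling_sum west_weight (?R - up_triangle (j - 1) (c + 1) k)"
  proof (rule Suc.IH)
    show "up_triangle (j - 1) (c + 1) k \<subseteq> ?R"
      using Suc.prems(2) by (auto simp: up_triangle_def)
  qed (use Suc.prems in auto)
  then show ?case
    using step[of ?D] by (simp only: eq1 eq2)
qed

lemma tiling_sum_up_triangles:
  assumes "finite I" "finite R"
    and "\<And>i. i \<in> I \<Longrightarrow> up_triangle j (c i) (k i) \<subseteq> R"
    and "\<And>i. i \<in> I \<Longrightarrow> c i \<ge> - 1" "\<And>i. i \<in> I \<Longrightarrow> even (j + c i)"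
    and "\<And>i i'. i \<in> I \<Longrightarrow> i' \<in> I \<Longrightarrow> i \<noteq> i' \<Longrightarrow> up_triangle j (c i) (k i) \<inter> up_triangle j (c i') (k i') = {}"
  shows "tiling_sum west_weight (R - (\<Union>i\<in>I. triangle_base j (c i) (k i))) =
    tiling_sum west_weight (R - (\<Union>i\<in>I. up_triangle j (c i) (k i)))"
  using assms
proof (induction I arbitrary: R rule: finite_induct)
  case (insert i I)
  let ?U = "\<lambda>i. up_triangle j (c i) (k i)" and ?B = "\<lambda>i. triangle_base j (c i) (k i)"
  let ?R = "R - (\<Union>i\<in>I. ?B i)"
  have d: "?U i \<inter> ?U i' = {}" if "i' \<in> I" for i'
    using insert.prems(5)[of i i'] insert.hyps(2) that by auto
  have "?U i \<inter> ?B i' = {}" if "i' \<in> I" for i'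
    using d[OF that] triangle_base_subset by blast
  then have sub: "?U i \<subseteq> ?R" using insert.prems(2)[of i] by auto
  have "tiling_sum west_weight (?R - ?B i) = tiling_sum west_weight (?R - ?U i)"
    by (rule tiling_sum_up_triangle) (use insert.prems sub in auto)
  moreover have "tiling_sum west_weight ((R - ?U i) - (\<Union>i\<in>I. ?B i)) =
      tiling_sum west_weight ((R - ?U i) - (\<Union>i\<in>I. ?U i))"
  proof (rule insert.IH)
    show "?U i' \<subseteq> R - ?U i" if "i' \<in> I" for i'
      using d[OF that] insert.prems(2)[of i'] that by auto
    show "?U i1 \<inter> ?U i2 = {}" if "i1 \<in> I" "i2 \<in> I" "i1 \<noteq> i2" for i1 i2
      using insert.prems(5)[of i1 i2] that by blast
  qed (use insert.prems in auto)
  moreover have "R - (\<Union>i\<in>insert i I. ?B i) = ?R - ?B i" "?R - ?U i = (R - ?U i) - (\<Union>i\<in>I. ?B i)"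
    "R - (\<Union>i\<in>insert i I. ?U i) = (R - ?U i) - (\<Union>i\<in>I. ?U i)" by auto
  ultimately show ?case by (simp only:)
qed simp

lemma triangle_base_cells:
  "triangle_base (int h) (2 * int l - int (h mod 2)) k = base_cells h {l..<l + k}"
proof (rule Set.set_eqI)
  fix t :: triangle
  obtain r p where t: "t = (r, p)" by (cases t)
  show "t \<in> triangle_base (int h) (2 * int l - int (h mod 2)) k \<longleftrightarrow> t \<in> base_cells h {l..<l + k}"
  proof
    assume "t \<in> triangle_base (int h) (2 * int l - int (h mod 2)) k"
    then have "r = int h" "2 * int l - int (h mod 2) < p" "p < 2 * int l - int (h mod 2) + 2 * int k" "odd (int h + p)"
      by (auto simp: triangle_base_def t)
    note rp = this
    obtain w where w: "p = 2 * w + (if even h then 1 else 0)"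
      using rp(4) by (cases "even h") (auto elim!: oddE evenE)
    then have lw: "int l \<le> w" "w < int l + int k"
      using rp(2,3) by (cases "even h"; simp add: odd_iff_mod_2_eq_one)+
    then have "nat w \<in> {l..<l + k}" by auto
    moreover have "p = base_pos h (nat w)" using w lw by (simp add: base_pos_def)
    moreover note \<open>r = int h\<close>
    ultimately show "t \<in> base_cells h {l..<l + k}" unfolding t base_cells_def by blast
  next
    assume "t \<in> base_cells h {l..<l + k}"
    then obtain q where "r = int h" "p = base_pos h q" "l \<le> q" "q < l + k"
      by (auto simp: base_cells_def t)
    then show "t \<in> triangle_base (int h) (2 * int l - int (h mod 2)) k"
      unfolding t by (cases "even h") (auto simp: triangle_base_def base_pos_def odd_iff_mod_2_eq_one)
  qed
qed

text \<open>A cell of the triangle projects straight down into its base; hence disjoint base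
  intervals carry disjoint triangles.\<close>

lemma up_triangle_interval:
  assumes "(r, p) \<in> up_triangle (int h) (2 * int l - int (h mod 2)) k"
  shows "nat ((p + int (h mod 2)) div 2) \<in> {l..<l + k}"
proof -
  have "2 * int l < p + int (h mod 2)" "p + int (h mod 2) < 2 * int l + 2 * int k"
    using assms by (auto simp: up_triangle_def)
  then show ?thesis by auto
qed

lemma trapezoid_sum_triangles:
  assumes "finite I"
    and fit: "\<And>i. i \<in> I \<Longrightarrow> l i + k i \<le> base_width N h" "\<And>i. i \<in> I \<Longrightarrow> k i \<le> h"
    and disj: "\<And>i i'. i \<in> I \<Longrightarrow> i' \<in> I \<Longrightarrow> i \<noteq> i' \<Longrightarrow> {l i..<l i + k i} \<inter> {l i'..<l i' + k i'} = {}"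
    and S: "\<And>i. i \<in> I \<Longrightarrow> S \<inter> {l i..<l i + k i} = {}"
  shows "tiling_sum west_weight (zigzag_region N h 0 - base_cells h S -
      (\<Union>i\<in>I. up_triangle (int h) (2 * int (l i) - int (h mod 2)) (k i))) =
    trapezoid_sum N h (S \<union> (\<Union>i\<in>I. {l i..<l i + k i}))"
proof -
  let ?c = "\<lambda>i. 2 * int (l i) - int (h mod 2)"
  let ?R = "zigzag_region N h 0 - base_cells h S"
  have "tiling_sum west_weight (?R - (\<Union>i\<in>I. triangle_base (int h) (?c i) (k i))) =
    tiling_sum west_weight (?R - (\<Union>i\<in>I. up_triangle (int h) (?c i) (k i)))"
  proof (rule tiling_sum_up_triangles)
    fix i assume i: "i \<in> I"
    show "up_triangle (int h) (?c i) (k i) \<subseteq> ?R"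
    proof
      fix t assume "t \<in> up_triangle (int h) (?c i) (k i)"
      moreover obtain r p where t: "t = (r, p)" by (cases t)
      ultimately have rp: "(r, p) \<in> up_triangle (int h) (?c i) (k i)" by simp
      then have *: "r \<le> int h" "?c i + (int h - r) < p" "p < ?c i + 2 * int (k i) - (int h - r)"
        by (auto simp: up_triangle_def)
      have w: "2 * int (base_width N h) = 2 * int N + int h + int (h mod 2)"
        by (cases "even h") (auto simp: base_width_def elim!: evenE oddE)
      have "int (h mod 2) \<le> 1" by auto
      then have "(r, p) \<in> zigzag_region N h 0"
        using * fit[OF i] w by (auto simp: zigzag_region_0)
      moreover have "(r, p) \<notin> base_cells h S"
      proof
        assume "(r, p) \<in> base_cells h S"
        then obtain q where "q \<in> S" "p = base_pos h q" by (auto simp: base_cells_def)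
        moreover from this have "nat ((p + int (h mod 2)) div 2) = q"
          by (cases "even h") (auto simp: base_pos_def odd_iff_mod_2_eq_one)
        ultimately show False using up_triangle_interval[OF rp] S[OF i] by auto
      qed
      ultimately show "t \<in> ?R" using t by simp
    qed
    show "- 1 \<le> ?c i" by (cases "even h") (auto simp: odd_iff_mod_2_eq_one)
    show "even (int h + ?c i)" by (cases "even h") (auto simp: odd_iff_mod_2_eq_one)
  next
    fix i i' assume i: "i \<in> I" "i' \<in> I" "i \<noteq> i'"
    show "up_triangle (int h) (?c i) (k i) \<inter> up_triangle (int h) (?c i') (k i') = {}"
      using up_triangle_interval[of _ _ h "l i" "k i"] up_triangle_interval[of _ _ h "l i'" "k i'"] disj[OF i]
      by fast
  qed (use assms in auto)
  moreover have "?R - (\<Union>i\<in>I. triangle_base (int h) (?c i) (k i)) =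
      zigzag_region N h 0 - base_cells h (S \<union> (\<Union>i\<in>I. {l i..<l i + k i}))"
    unfolding triangle_base_cells by (auto simp: base_cells_def)
  ultimately show ?thesis unfolding trapezoid_sum_def by simp
qed

section \<open>Sums and dent positions of a fern\<close>

lemma term_of_Cons: "term_of (z # a) (Suc i) = (if i = 0 then z else term_of a i)"
  by (cases i) (auto simp: term_of_def)

lemma s_sum_Suc: "s_sum (Suc k) b = s_sum k b + term_of b (Suc k)"
  by (simp add: s_sum_def)

lemma s_sum_0 [simp]: "s_sum 0 b = 0"
  by (simp add: s_sum_def)

lemma s_sum_Cons: "s_sum (Suc k) (z # a) = z + s_sum k a"
  by (induction k) (simp_all add: s_sum_Suc term_of_Cons)

lemma s_sum_mono: "i \<le> k \<Longrightarrow> s_sum i b \<le> s_sum k b"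
  by (auto simp: s_sum_def intro!: sum_mono2)

lemma E_sum_Cons: "E_sum (z # a) = O_sum a"
proof -
  let ?A = "{i. 1 \<le> i \<and> i \<le> length a \<and> odd i}"
  have "{i. 1 \<le> i \<and> i \<le> length (z # a) \<and> even i} = Suc ` ?A"
  proof (rule Set.set_eqI)
    fix i
    show "i \<in> {i. 1 \<le> i \<and> i \<le> length (z # a) \<and> even i} \<longleftrightarrow> i \<in> Suc ` ?A"
      by (cases i) (auto simp: Suc_le_eq odd_pos)
  qed
  then have "E_sum (z # a) = (\<Sum>i\<in>Suc ` ?A. term_of (z # a) i)"
    by (simp only: E_sum_def)
  also have "\<dots> = (\<Sum>i\<in>?A. term_of (z # a) (Suc i))"
    by (subst sum.reindex) auto
  also have "\<dots> = O_sum a"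
    unfolding O_sum_def by (rule sum.cong) (auto simp: term_of_Cons)
  finally show ?thesis .
qed

lemma O_sum_Cons: "O_sum (z # a) = z + E_sum a"
proof -
  let ?A = "{i. 1 \<le> i \<and> i \<le> length a \<and> even i}"
  have fin: "finite ?A" by (rule finite_subset[of _ "{..length a}"]) auto
  have "{i. 1 \<le> i \<and> i \<le> length (z # a) \<and> odd i} = insert 1 (Suc ` ?A)"
  proof (rule Set.set_eqI)
    fix i
    show "i \<in> {i. 1 \<le> i \<and> i \<le> length (z # a) \<and> odd i} \<longleftrightarrow> i \<in> insert 1 (Suc ` ?A)"
      by (cases i) auto
  qed
  then have "O_sum (z # a) = (\<Sum>i\<in>insert 1 (Suc ` ?A). term_of (z # a) i)"
    by (simp only: O_sum_def)
  also have "\<dots> = term_of (z # a) (Suc 0) + (\<Sum>i\<in>Suc ` ?A. term_of (z # a) i)"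
    using fin by (subst sum.insert) auto
  also have "(\<Sum>i\<in>Suc ` ?A. term_of (z # a) i) = (\<Sum>i\<in>?A. term_of (z # a) (Suc i))"
    by (subst sum.reindex) auto
  also have "\<dots> = E_sum a"
    unfolding E_sum_def by (rule sum.cong) (auto simp: term_of_Cons)
  finally show ?thesis by (simp add: term_of_Cons)
qed

lemma O_sum_plus_E_sum: "O_sum a + E_sum a = s_sum (length a) a"
proof (induction a)
  case Nil
  show ?case by (simp add: E_sum_def O_sum_def)
next
  case (Cons z a)
  then show ?case by (simp add: E_sum_Cons O_sum_Cons s_sum_Cons)
qed

text \<open>The fern is listed from its eastern end while positions count from the west, so triangle
  \<open>i\<close> is offset by the total length minus \<open>s_sum i b\<close>. The first
  \<open>m\<close> positions are the free ones, and \<open>P\<close> selects the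
  orientation.\<close>

definition fern_dents :: "(nat \<Rightarrow> bool) \<Rightarrow> nat \<Rightarrow> nat list \<Rightarrow> nat set" where
  "fern_dents P m b = (\<Union>i\<in>{i\<in>{1..length b}. P i}.
     {m + s_sum (length b) b - s_sum i b..<m + s_sum (length b) b - s_sum i b + term_of b i})"

lemma fern_dents_Nil [simp]: "fern_dents P m [] = {}"
  by (simp add: fern_dents_def)

text \<open>A prepended term extends the fern at its eastern end and shifts all other indices. So
  \<open>fern_dents odd m (z # a)\<close> is a block of length \<open>z\<close> together with the
  even-numbered triangles of \<open>a\<close>: the dents seen from below the line.\<close>

lemma fern_dents_Cons:
  "fern_dents P m (z # a) = (if P 1 then {m + s_sum (length a) a..<m + s_sum (length a) a + z} else {}) \<union>
    fern_dents (\<lambda>i. P (Suc i)) m a"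
proof -
  have "{i\<in>{1..length (z # a)}. P i} = (if P 1 then {1} else {}) \<union> Suc ` {i\<in>{1..length a}. P (Suc i)}"
  proof (rule Set.set_eqI)
    fix i
    show "i \<in> {i\<in>{1..length (z # a)}. P i} \<longleftrightarrow>
      i \<in> (if P 1 then {1} else {}) \<union> Suc ` {i\<in>{1..length a}. P (Suc i)}"
      by (cases i; cases "i - 1") auto
  qed
  moreover have "m + (z + s_sum (length a) a) - (z + s) = m + s_sum (length a) a - s" for s by simp
  ultimately show ?thesis
    using s_sum_Cons[of 0 z a] term_of_Cons[of z a 0]
    by (auto simp: fern_dents_def s_sum_Cons term_of_Cons split: if_splits)
qed

lemma fern_dents_Un: "fern_dents odd m a \<union> fern_dents even m a = {m..<m + s_sum (length a) a}"
proof (induction a)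
  case (Cons z a)
  have "fern_dents odd m (z # a) \<union> fern_dents even m (z # a) =
      {m + s_sum (length a) a..<m + s_sum (length a) a + z} \<union> (fern_dents odd m a \<union> fern_dents even m a)"
    by (auto simp: fern_dents_Cons)
  then show ?case using Cons by (auto simp: s_sum_Cons)
qed simp

lemma fern_dents_disjoint: "fern_dents odd m a \<inter> fern_dents even m a = {}"
proof (induction a)
  case (Cons z a)
  have "fern_dents odd m a \<union> fern_dents even m a \<subseteq> {..<m + s_sum (length a) a}"
    by (auto simp: fern_dents_Un)
  then show ?case using Cons by (auto simp: fern_dents_Cons)
qed simp

lemma card_fern_dents:
  "card (fern_dents odd m a) = O_sum a \<and> card (fern_dents even m a) = E_sum a"
proof (induction a)
  case Nil
  then show ?case by (simp add: O_sum_def E_sum_def)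
next
  case (Cons z a)
  let ?X = "{m + s_sum (length a) a..<m + s_sum (length a) a + z}"
  have sub: "fern_dents even m a \<subseteq> {m..<m + s_sum (length a) a}" using fern_dents_Un[of m a] by blast
  then have "?X \<inter> fern_dents even m a = {}" by fastforce
  moreover have "finite (fern_dents even m a)" using finite_subset[OF sub] by simp
  ultimately show ?case using Cons
    by (simp add: fern_dents_Cons card_Un_disjoint O_sum_Cons E_sum_Cons)
qed

text \<open>The weighted count of a trapezoid with dents \<open>D\<close>. Its height
  \<open>h\<close> is forced by \<open>h + 1 = 2 * card D + y mod 2\<close>, so only the parity has
  to be recorded.\<close>

definition dent_value :: "nat \<Rightarrow> nat set \<Rightarrow> real" where
  "dent_value y D = dent_product y D / H2 (2 * card D + y mod 2)"

lemma dent_product_cong: "even y = even y' \<Longrightarrow> dent_product y D = dent_product y' D"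
  by (simp add: dent_product_def)

lemma dent_value_cong: "even y = even y' \<Longrightarrow> dent_value y D = dent_value y' D"
  by (simp add: dent_value_def dent_product_def mod2_eq_if)

lemma trapezoid_sum_value:
  assumes "h \<ge> 1 \<or> D = {}" "D \<subseteq> {..<base_width N h}"
  shows "trapezoid_sum N h D = (if card D = (h + 1) div 2 then dent_value (h + 1) D else 0)"
proof (cases "h \<ge> 1")
  case True
  have "2 * ((h + 1) div 2) + (h + 1) mod 2 = h + 1" by simp
  then show ?thesis
    using trapezoid_sum_eq[OF True assms(2)] by (simp add: dent_value_def)
next
  case False
  then have "h = 0" "D = {}" using assms by auto
  moreover have "zigzag_region N 0 0 = {}" by (auto simp: zigzag_region_0)
  ultimately show ?thesis
    by (simp add: trapezoid_sum_def base_cells_def dent_value_def dent_product_def vandermonde_def H2_def)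
qed

text \<open>Of the fern, only the odd-numbered, up-pointing triangles reach above the line.\<close>

definition fern_trapezoid :: "nat \<Rightarrow> nat \<Rightarrow> nat \<Rightarrow> nat list \<Rightarrow> triangle set" where
  "fern_trapezoid N h m b = zigzag_region N h 0 -
    (\<Union>i\<in>{i\<in>{1..length b}. odd i}. up_triangle (int h)
       (2 * int (m + s_sum (length b) b - s_sum i b) - int (h mod 2)) (term_of b i))"

lemma fern_trapezoid_0 [simp]: "fern_trapezoid N 0 m b = {}"
  by (auto simp: fern_trapezoid_def zigzag_region_0)

lemma term_of_le_O_sum:
  assumes "odd i"
  shows "term_of b i \<le> O_sum b"
proof (cases "1 \<le> i \<and> i \<le> length b")
  case True
  have "finite {i. 1 \<le> i \<and> i \<le> length b \<and> odd i}"
    by (rule finite_subset[of _ "{..length b}"]) auto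
  then show ?thesis
    unfolding O_sum_def using True assms by (intro member_le_sum) auto
qed (auto simp: term_of_def)

lemma s_sum_diff: "i \<ge> 1 \<Longrightarrow> s_sum i b = s_sum (i - 1) b + term_of b i"
  using s_sum_Suc[of "i - 1" b] by simp

lemma fern_intervals_disjoint:
  fixes m :: nat
  assumes "i \<ge> 1" "i' \<ge> 1" "i \<le> length b" "i' \<le> length b" "i \<noteq> i'"
  defines "l \<equiv> \<lambda>i. m + s_sum (length b) b - s_sum i b"
  shows "{l i..<l i + term_of b i} \<inter> {l i'..<l i' + term_of b i'} = {}"
proof -
  have *: "{l i..<l i + term_of b i} \<inter> {l i'..<l i' + term_of b i'} = {}"
    if "i < i'" "i' \<le> length b" for i i'
  proof -
    have "s_sum i b \<le> s_sum (i' - 1) b" "s_sum i' b \<le> s_sum (length b) b"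
      using that by (auto intro: s_sum_mono)
    moreover have "s_sum i' b = s_sum (i' - 1) b + term_of b i'"
      using that by (intro s_sum_diff) simp
    ultimately have "l i' + term_of b i' \<le> l i" by (simp add: l_def)
    then show ?thesis by auto
  qed
  consider "i < i'" | "i' < i" using assms(5) by linarith
  then show ?thesis
  proof cases
    case 1
    then show ?thesis using * assms(4) by blast
  next
    case 2
    then have "{l i'..<l i' + term_of b i'} \<inter> {l i..<l i + term_of b i} = {}" using * assms(3) by blast
    then show ?thesis by (subst Int_commute)
  qed
qed

lemma tiling_sum_fern_trapezoid:
  assumes "O_sum b \<le> h" "m + s_sum (length b) b \<le> base_width N h" "S \<subseteq> {..<m}"
  shows "tiling_sum west_weight (fern_trapezoid N h m b - base_cells h S) =
    trapezoid_sum N h (S \<union> fern_dents odd m b)"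
proof -
  let ?I = "{i\<in>{1..length b}. odd i}" let ?l = "\<lambda>i. m + s_sum (length b) b - s_sum i b"
  have le: "s_sum i b \<le> s_sum (length b) b" if "i \<in> ?I" for i
    using that by (auto intro: s_sum_mono)
  have eq: "fern_trapezoid N h m b - base_cells h S = zigzag_region N h 0 - base_cells h S -
      (\<Union>i\<in>?I. up_triangle (int h) (2 * int (?l i) - int (h mod 2)) (term_of b i))"
    by (auto simp: fern_trapezoid_def)
  show ?thesis unfolding eq fern_dents_def
  proof (rule trapezoid_sum_triangles)
    fix i assume i: "i \<in> ?I"
    have "term_of b i \<le> s_sum i b" using s_sum_diff[of i b] i by simp
    then show "?l i + term_of b i \<le> base_width N h" using le[OF i] assms(2) by simp
    show "term_of b i \<le> h" using term_of_le_O_sum[of i b] i assms(1) by simp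
    show "S \<inter> {?l i..<?l i + term_of b i} = {}" using le[OF i] by (auto simp: disjoint_iff dest!: subsetD[OF assms(3)])
  next
    fix i i' assume "i \<in> ?I" "i' \<in> ?I" "i \<noteq> i'"
    then show "{?l i..<?l i + term_of b i} \<inter> {?l i'..<?l i' + term_of b i'} = {}"
      by (intro fern_intervals_disjoint) auto
  qed simp
qed

lemma fern_trapezoid_base:
  assumes "h \<ge> 1" "odd (int h + p)"
  shows "(int h, p) \<in> fern_trapezoid N h m b \<longleftrightarrow>
    p \<in> base_pos h ` ({..<base_width N h} - fern_dents odd m b)"
proof -
  let ?I = "{i\<in>{1..length b}. odd i}" let ?l = "\<lambda>i. m + s_sum (length b) b - s_sum i b"
  have "(int h, p) \<in> zigzag_region N h 0 \<longleftrightarrow> p \<in> base_pos h ` {..<base_width N h}"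
  proof
    assume "(int h, p) \<in> zigzag_region N h 0"
    then have "0 \<le> p" "p \<le> 2 * int N + int h - 1" by (auto simp: zigzag_region_0)
    then have "p = base_pos h (nat (p div 2))" "nat (p div 2) < base_width N h"
      using assms(2) by (auto simp: base_pos_def base_width_def)
    then show "p \<in> base_pos h ` {..<base_width N h}" by blast
  next
    assume "p \<in> base_pos h ` {..<base_width N h}"
    then obtain q where "p = base_pos h q" "q < base_width N h" by blast
    then have "0 \<le> p \<and> p \<le> 2 * int N + int h - 1"
      using assms by (auto simp: base_pos_def base_width_def split: if_splits) presburger+
    then show "(int h, p) \<in> zigzag_region N h 0" using assms by (simp add: zigzag_region_0)
  qed
  moreover have "(int h, p) \<in> up_triangle (int h) (2 * int l - int (h mod 2)) k \<longleftrightarrow> p \<in> base_pos h ` {l..<l + k}"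
    for l k
  proof -
    have "(int h, p) \<in> up_triangle (int h) (2 * int l - int (h mod 2)) k \<longleftrightarrow>
        (int h, p) \<in> triangle_base (int h) (2 * int l - int (h mod 2)) k"
      using assms(2) by (simp add: up_triangle_def triangle_base_def)
    then show ?thesis unfolding triangle_base_cells by (auto simp: base_cells_def)
  qed
  ultimately have "(int h, p) \<in> fern_trapezoid N h m b \<longleftrightarrow> p \<in> base_pos h ` {..<base_width N h} -
      (\<Union>i\<in>?I. base_pos h ` {?l i..<?l i + term_of b i})"
    unfolding fern_trapezoid_def by simp
  also have "base_pos h ` {..<base_width N h} - (\<Union>i\<in>?I. base_pos h ` {?l i..<?l i + term_of b i}) =
      base_pos h ` ({..<base_width N h} - fern_dents odd m b)"
    unfolding fern_dents_def
    by (simp only: image_UN[symmetric] image_set_diff[OF inj_base_pos, symmetric])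
  finally show ?thesis .
qed

section \<open>The regions of \<open>Q'\<close> and \<open>K'\<close> as trapezoids with a
  fern\<close>

lemma length_rev_prefix [simp]: "length (rev_prefix b k) = k"
  by (simp add: rev_prefix_def)

lemma nth_rev_prefix: "i < k \<Longrightarrow> rev_prefix b k ! i = term_of b (k - i)"
  unfolding rev_prefix_def by (subst nth_map) (simp_all add: rev_nth Suc_diff_Suc del: upt_Suc)

text \<open>Here \<open>t\<close> lists the segments of line \<open>h\<close> from left to right: first the \<open>m\<close> free positions, then
  the fern read backwards.\<close>

lemma dented_region_reversed:
  fixes b t :: "nat list" and m p :: nat
  assumes b: "b \<noteq> []" and p: "p = (length b + 1) div 2"
    and t: "t = (m + term_of b (2 * p)) # rev_prefix b (2 * p - 1)"
  shows "E_sum t = O_sum b" and "dented_region h t = fern_trapezoid (m + E_sum b) h m b"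
proof -
  have p_pos: "p \<ge> 1"
    using b p by (cases b) auto
  have length_reversed: "length t = 2 * p"
    using p_pos by (simp add: t)
  have term_of_reversed: "term_of t i = term_of b (2 * p + 1 - i)" if i: "2 \<le> i" "i \<le> 2 * p" for i
  proof -
    have "\<exists>k. i = Suc (Suc k)" using i by presburger
    then obtain k where k: "i = Suc (Suc k)" by blast
    have "term_of t i = t ! Suc k" using i k by (simp add: term_of_def length_reversed)
    also have "\<dots> = rev_prefix b (2 * p - 1) ! k" by (simp add: t)
    finally show ?thesis using i k by (simp add: nth_rev_prefix Suc_diff_Suc)
  qed
  \<comment> \<open>If \<open>length b\<close> is odd, \<open>2 * p\<close> is one past the end,
    where \<open>term_of\<close> gives \<open>0\<close>: the padding makes the number of segments
    even and changes no sum.\<close>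
  have s_sum_beyond: "s_sum (2 * p) b = s_sum (length b) b"
  proof (cases "even (length b)")
    case True
    then show ?thesis using p by simp
  next
    case False
    then have "2 * p = Suc (length b)" using p by simp
    then show ?thesis by (simp add: s_sum_Suc term_of_def)
  qed
  \<comment> \<open>The first \<open>i\<close> segments from the west and the first
    \<open>2 * p - i\<close> terms of the fern from the east together fill the whole line.\<close>
  have s_sum_reversed: "1 \<le> i \<Longrightarrow> i \<le> 2 * p \<Longrightarrow> s_sum i t + s_sum (2 * p - i) b = m + s_sum (length b) b" for i
  proof (induction i rule: nat_induct_at_least)
    case base
    have "s_sum 1 t = m + term_of b (2 * p)"
      using s_sum_Suc[of 0 t] by (simp add: t term_of_def[of "_ # _"])
    moreover have "s_sum (2 * p) b = s_sum (2 * p - 1) b + term_of b (2 * p)"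
      using p_pos by (intro s_sum_diff) simp
    ultimately show ?case using s_sum_beyond by simp
  next
    case (Suc i)
    have "s_sum (2 * p - i) b = s_sum (2 * p - Suc i) b + term_of b (2 * p - i)"
      using Suc.prems s_sum_diff[of "2 * p - i" b] by simp
    moreover have "term_of t (Suc i) = term_of b (2 * p - i)"
      using term_of_reversed[of "Suc i"] Suc by simp
    ultimately show ?case using Suc by (simp add: s_sum_Suc)
  qed
  show E_sum_reversed: "E_sum t = O_sum b"
    unfolding E_sum_def O_sum_def
  \<comment> \<open>The odd constant \<open>2 * p + 1\<close> exchanges the even indices of
    \<open>t\<close> with the odd indices of \<open>b\<close>.\<close>
  proof (rule sum.reindex_bij_witness[where i = "\<lambda>i. 2 * p + 1 - i" and j = "\<lambda>i. 2 * p + 1 - i"])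
    fix i assume i: "i \<in> {i. 1 \<le> i \<and> i \<le> length t \<and> even i}"
    then have i': "2 \<le> i" "i \<le> 2 * p" "even i" by (auto simp: length_reversed elim!: evenE)
    show "2 * p + 1 - (2 * p + 1 - i) = i" using i' by simp
    show "2 * p + 1 - i \<in> {i. 1 \<le> i \<and> i \<le> length b \<and> odd i}"
      using i' p by (auto elim!: evenE)
    show "term_of b (2 * p + 1 - i) = term_of t i" using i' by (simp add: term_of_reversed)
  next
    fix i assume i: "i \<in> {i. 1 \<le> i \<and> i \<le> length b \<and> odd i}"
    then have "i < 2 * p + 1" using p by auto
    then show "2 * p + 1 - (2 * p + 1 - i) = i" by simp
    show "2 * p + 1 - i \<in> {i. 1 \<le> i \<and> i \<le> length t \<and> even i}"
      using i p by (auto simp: length_reversed)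
  qed
  have O_sum_reversed: "O_sum t = m + E_sum b"
    using O_sum_plus_E_sum[of t] O_sum_plus_E_sum[of b] s_sum_reversed[of "2 * p"] p_pos
    by (simp add: E_sum_reversed length_reversed)
  show "dented_region h t = fern_trapezoid (m + E_sum b) h m b"
  proof -
    have "(\<Union>i\<in>{i. 1 \<le> i \<and> i \<le> length t \<and> even i}.
        up_triangle (int h) (- int (h mod 2) + 2 * int (s_sum (i - 1) t)) (term_of t i)) =
      (\<Union>i\<in>{i\<in>{1..length b}. odd i}. up_triangle (int h)
         (2 * int (m + s_sum (length b) b - s_sum i b) - int (h mod 2)) (term_of b i))"
      (is "(\<Union>i\<in>?I. ?f i) = (\<Union>i\<in>?J. ?g i)")
    proof -
      have "?I = (\<lambda>i. 2 * p + 1 - i) ` ?J"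
      proof (intro equalityI subsetI)
        fix i assume i: "i \<in> ?I"
        then have i': "2 \<le> i" "i \<le> 2 * p" "even i" by (auto simp: length_reversed elim!: evenE)
        then have "2 * p + 1 - i \<in> ?J" "i = 2 * p + 1 - (2 * p + 1 - i)"
          using p by (auto elim!: evenE)
        then show "i \<in> (\<lambda>i. 2 * p + 1 - i) ` ?J" by blast
      next
        fix i assume "i \<in> (\<lambda>i. 2 * p + 1 - i) ` ?J"
        then show "i \<in> ?I" using p by (auto simp: length_reversed)
      qed
      moreover have "?f (2 * p + 1 - i) = ?g i" if "i \<in> ?J" for i
      proof -
        have i': "1 \<le> i" "i \<le> length b" "odd i" using that by auto
        then have "i \<noteq> 2 * p" "length b \<le> 2 * p" using p by auto
        then have i: "1 \<le> i" "i \<le> 2 * p - 1" "odd i" using i' by simp_all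
        have "1 \<le> 2 * p - i" "2 * p - (2 * p - i) = i" using i by arith+
        then have "s_sum (2 * p - i) t = m + s_sum (length b) b - s_sum i b"
          using s_sum_reversed[of "2 * p - i"] by simp
        moreover have "2 * p + 1 - i - 1 = 2 * p - i" using i by simp
        moreover have "term_of t (2 * p + 1 - i) = term_of b i"
          using term_of_reversed[of "2 * p + 1 - i"] i by simp
        ultimately show ?thesis by (simp only: uminus_add_conv_diff)
      qed
      ultimately show ?thesis by (simp only: UN_simps(10)) simp
    qed
    then show ?thesis by (simp add: dented_region_def fern_trapezoid_def O_sum_reversed)
  qed
qed

text \<open>The condition on \<open>h\<close> holds for \<open>2 * O_sum b\<close> and for
  \<open>2 * O_sum b - 1\<close>, truncated or not, so \<open>Q_region\<close> and
  \<open>K_region\<close> are both covered.\<close>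

lemma tiling_sum_dented_region:
  assumes b: "b \<noteq> []" and p: "p = (length b + 1) div 2"
    and t: "t = (m + term_of b (2 * p)) # rev_prefix b (2 * p - 1)"
    and h: "(h + 1) div 2 = O_sum b"
  shows "tiling_sum west_weight (dented_region h t) = dent_value (h + 1) (fern_dents odd m b)"
proof -
  let ?D = "fern_dents odd m b"
  have w: "base_width (m + E_sum b) h = m + s_sum (length b) b"
    using h O_sum_plus_E_sum[of b] by (simp add: base_width_def)
  have "tiling_sum west_weight (dented_region h t) = trapezoid_sum (m + E_sum b) h ?D"
    using tiling_sum_fern_trapezoid[of b h m "m + E_sum b" "{}"] w h
    by (simp add: dented_region_reversed(2)[OF b p t] base_cells_def)
  also have "\<dots> = dent_value (h + 1) ?D"
  proof (subst trapezoid_sum_value)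
    have fin: "finite ?D" by (rule finite_subset[of _ "{m..<m + s_sum (length b) b}"]) (use fern_dents_Un[of m b] in auto)
    have card: "card ?D = O_sum b" using card_fern_dents by simp
    show "1 \<le> h \<or> ?D = {}"
      using h fin card by (cases "h = 0") auto
    show "?D \<subseteq> {..<base_width (m + E_sum b) h}" unfolding w using fern_dents_Un[of m b] by auto
    show "(if card ?D = (h + 1) div 2 then dent_value (h + 1) ?D else 0) = dent_value (h + 1) ?D"
      using card h by simp
  qed
  finally show ?thesis .
qed

lemma Q'_reversed:
  assumes b: "b \<noteq> []" and p: "p = (length b + 1) div 2"
    and t: "t = (m + term_of b (2 * p)) # rev_prefix b (2 * p - 1)"
  shows "Q' t = dent_value 1 (fern_dents odd m b)"
  unfolding Q'_def Q_region_def dented_region_reversed(1)[OF b p t]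
  by (subst tiling_sum_dented_region[OF b p t]) (auto intro: dent_value_cong)

lemma K'_reversed:
  assumes b: "b \<noteq> []" and p: "p = (length b + 1) div 2"
    and t: "t = (m + term_of b (2 * p)) # rev_prefix b (2 * p - 1)"
  shows "K' t = dent_value 0 (fern_dents odd m b)"
proof (cases "O_sum b = 0")
  \<comment> \<open>The truncated height \<open>0\<close> has the parity belonging to
    \<open>Q'\<close> instead of \<open>K'\<close>; without dents both values are
    \<open>1\<close>.\<close>
  case True
  have "K' t = dent_value 1 (fern_dents odd m b)"
    unfolding K'_def K_region_def dented_region_reversed(1)[OF b p t]
    by (subst tiling_sum_dented_region[OF b p t]) (use True in \<open>auto\<close>)
  moreover have "fern_dents odd m b = {}"
  proof -
    have "finite (fern_dents odd m b)"
      by (rule finite_subset[of _ "{m..<m + s_sum (length b) b}"]) (use fern_dents_Un[of m b] in auto)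
    then show ?thesis using True card_fern_dents[of m b] by simp
  qed
  ultimately show ?thesis by (simp add: dent_value_def dent_product_def vandermonde_def H2_def)
next
  case False
  then show ?thesis
    unfolding K'_def K_region_def dented_region_reversed(1)[OF b p t]
    by (subst tiling_sum_dented_region[OF b p t]) (auto intro!: dent_value_cong)
qed

section \<open>Cutting along the fern\<close>

definition flip :: "int \<Rightarrow> triangle \<Rightarrow> triangle" where
  "flip k = (\<lambda>(r, p). (k + 1 - r, p))"

lemma flip_flip [simp]: "flip k (flip k t) = t"
  by (auto simp: flip_def split: prod.splits)

lemma flip_image_iff: "t \<in> flip k ` X \<longleftrightarrow> flip k t \<in> X"
  by (metis flip_flip image_iff)

text \<open>Reflecting the rows \<open>1..k\<close> exchanges up- and down-pointing triangles
  exactly when \<open>k\<close> is even, as vertical lozenges require.\<close>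

lemma lozenge_flip:
  assumes "even k" "lozenge L"
  shows "lozenge (flip k ` L)"
proof -
  consider r p where "odd (r + p)" "L = {(r, p), (r + 1, p)}" | r p where "L = {(r, p), (r, p + 1)}"
    using assms(2) unfolding lozenge_def vertical_lozenge_def up_pointing_def by auto
  then show ?thesis
  proof cases
    case (1 r p)
    have "up_pointing (k - r, p)" using 1 assms(1) by (simp add: up_pointing_def)
    moreover have "flip k ` L = {(k - r, p), (k - r + 1, p)}" using 1 by (auto simp: flip_def)
    ultimately show ?thesis unfolding lozenge_def vertical_lozenge_def by blast
  next
    case (2 r p)
    have "flip k ` L = {(k + 1 - r, p), (k + 1 - r, p + 1)}" using 2 by (auto simp: flip_def)
    then show ?thesis unfolding lozenge_def by blast
  qed
qed

text \<open>For even \<open>k\<close> the row pairs \<open>2 * i - 1, 2 * i\<close> are permuted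
  among themselves; the bounds on \<open>r\<close> keep the reflected index at least
  \<open>1\<close>.\<close>

lemma west_weight_flip:
  assumes "even k" "\<And>r p. (r, p) \<in> L \<Longrightarrow> 1 \<le> r \<and> r \<le> k"
  shows "west_weight (flip k ` L) = west_weight L"
proof -
  let ?P = "\<lambda>L. \<exists>i\<ge>1. L = {(2 * i - 1, 0), (2 * i, 0)}"
  have imp: "?P (flip k ` L)" if L: "\<And>r p. (r, p) \<in> L \<Longrightarrow> 1 \<le> r \<and> r \<le> k" "?P L" for L
  proof -
    obtain i where i: "i \<ge> 1" "L = {(2 * i - 1, 0), (2 * i, 0)}" using L(2) by blast
    obtain l where l: "k = 2 * l" using assms(1) by blast
    have "2 * i \<le> k" using L(1)[of "2 * i" 0] i by simp
    then have "l + 1 - i \<ge> 1" using l by simp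
    moreover have "flip k ` L = {(2 * (l + 1 - i) - 1, 0), (2 * (l + 1 - i), 0)}"
      using i l by (auto simp: flip_def)
    ultimately show ?thesis by blast
  qed
  have "flip k ` flip k ` L = L" by (simp add: image_image)
  moreover have "1 \<le> r \<and> r \<le> k" if "(r, p) \<in> flip k ` L" for r p
    using that assms(2)[of "k + 1 - r" p] by (simp add: flip_image_iff) (simp add: flip_def)
  ultimately have "?P (flip k ` L) \<longleftrightarrow> ?P L"
    using imp[of L] imp[of "flip k ` L"] assms(2) by metis
  then show ?thesis by (simp add: west_weight_def)
qed

lemma base_width_lower: "base_width (x + u) (y + 2 * z + 2 * v - 1) = x + y div 2 + (z + (u + v))"
  by (cases "y + z + v = 0") (auto simp: base_width_def)

lemma fern_trapezoid_Cons:
  "fern_trapezoid N h m (z # a) = zigzag_region N h 0 -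
    up_triangle (int h) (2 * int (m + s_sum (length a) a) - int (h mod 2)) z -
    (\<Union>i\<in>{i\<in>{1..length a}. even i}. up_triangle (int h)
       (2 * int (m + s_sum (length a) a - s_sum i a) - int (h mod 2)) (term_of a i))"
proof -
  let ?f = "\<lambda>i. up_triangle (int h) (2 * int (m + s_sum (length (z # a)) (z # a) - s_sum i (z # a)) - int (h mod 2))
    (term_of (z # a) i)"
  have "{i\<in>{1..length (z # a)}. odd i} = insert 1 (Suc ` {i\<in>{1..length a}. even i})"
  proof (rule Set.set_eqI)
    fix i
    show "i \<in> {i\<in>{1..length (z # a)}. odd i} \<longleftrightarrow> i \<in> insert 1 (Suc ` {i\<in>{1..length a}. even i})"
      by (cases i) auto
  qed
  then have "(\<Union>i\<in>{i\<in>{1..length (z # a)}. odd i}. ?f i) = ?f 1 \<union> (\<Union>i\<in>{i\<in>{1..length a}. even i}. ?f (Suc i))"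
    by (simp only: UN_insert UN_simps(10))
  moreover have "?f 1 = up_triangle (int h) (2 * int (m + s_sum (length a) a) - int (h mod 2)) z"
    using s_sum_Cons[of 0 z a] term_of_Cons[of z a 0] by (simp add: s_sum_Cons)
  moreover have "?f (Suc i) = up_triangle (int h)
       (2 * int (m + s_sum (length a) a - s_sum i a) - int (h mod 2)) (term_of a i)"
    if "i \<in> {i\<in>{1..length a}. even i}" for i
  proof -
    have "m + s_sum (length (z # a)) (z # a) - s_sum (Suc i) (z # a) = m + s_sum (length a) a - s_sum i a"
      by (simp add: s_sum_Cons)
    moreover have "term_of (z # a) (Suc i) = term_of a i" using that by (simp add: term_of_Cons)
    ultimately show ?thesis by (simp only:)
  qed
  ultimately show ?thesis unfolding fern_trapezoid_def by auto
qed

text \<open>Upside down, the south-eastern side becomes the straight slanted side of a trapezoid,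
  and the \<open>z\<close> units of the north-eastern side below the fern cut a triangle of side
  \<open>z\<close> off its corner. That triangle is put in front of the fern as a further
  term.\<close>

lemma R_region_split:
  fixes x y z :: nat and a :: "nat list"
  assumes y: "y + 2 * O_sum a \<ge> 1"
  defines "m \<equiv> x + y div 2" and "j \<equiv> y + 2 * O_sum a - 1" and "h \<equiv> y + 2 * z + 2 * E_sum a - 1"
  shows "R_region x y z a = fern_trapezoid (x + E_sum a) j m a \<union>
    flip (int (j + h)) ` fern_trapezoid (x + O_sum a) h m (z # a)"
proof -
  let ?N = "x + E_sum a" and ?N' = "x + O_sum a"
  let ?ne = "y + z + 2 * O_sum a - 1" and ?se = "y + z + 2 * E_sum a - 1"
  let ?s = "s_sum (length a) a"
  let ?c = "\<lambda>i. 2 * int ?N + int j - 2 * int (s_sum i a)"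
  let ?U = "\<Union>i\<in>{i\<in>{1..length a}. odd i}. up_triangle (int j) (?c i) (term_of a i)"
  let ?D = "\<Union>i\<in>{i\<in>{1..length a}. even i}. down_triangle (int j) (?c i) (term_of a i)"
  have "(\<Union>i\<in>{1..length a}. (if odd i then up_triangle else down_triangle) (int j) (?c i) (term_of a i)) = ?U \<union> ?D"
    by (auto split: if_splits)
  then have R: "R_region x y z a = zigzag_region ?N ?ne ?se - (?U \<union> ?D)"
    by (simp add: R_region_def Let_def j_def)
  have s: "?s = O_sum a + E_sum a" by (simp add: O_sum_plus_E_sum)
  \<comment> \<open>The eastern end of the fern in both scales: \<open>m + ?s\<close> positions
    reach exactly to the north-eastern side.\<close>
  have w: "2 * int (m + ?s) - int (j mod 2) = 2 * int ?N + int j"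
  proof -
    have j1: "j + 1 = y + 2 * O_sum a" using y by (simp add: j_def)
    then have "j + 2 = y + 1 + 2 * O_sum a" by simp
    then have "j mod 2 = (y + 1) mod 2" by (metis mod_add_self2 mod_mult_self2)
    then have "2 * (y div 2) + 1 = y + j mod 2" by (cases "even y") (auto elim!: evenE oddE)
    moreover have "2 * int (x + u + (O_sum a + E_sum a)) - int v = 2 * int ?N + int j"
      if "2 * u + 1 = y + v" for u v
    proof -
      have "int (2 * u + 1) = int (y + v)" "int (j + 1) = int (y + 2 * O_sum a)"
        by (simp_all only: that j1)
      then show ?thesis by simp
    qed
    ultimately show ?thesis unfolding s m_def by blast
  qed
  have c: "2 * int (m + ?s - s_sum i a) - int (j mod 2) = ?c i" if "i \<in> {1..length a}" for i
  proof -
    have "s_sum i a \<le> ?s" using that by (intro s_sum_mono) simp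
    then have "int (m + ?s - s_sum i a) = int (m + ?s) - int (s_sum i a)" by simp
    moreover have "2 * (A - B) - J = C - 2 * B" if "2 * A - J = C" for A B C J :: int
      using that by simp
    ultimately show ?thesis using w by (simp only:)
  qed
  have A: "fern_trapezoid ?N j m a = zigzag_region ?N j 0 - ?U"
  proof -
    have "(\<Union>i\<in>{i\<in>{1..length a}. odd i}. up_triangle (int j) (2 * int (m + ?s - s_sum i a) - int (j mod 2)) (term_of a i)) = ?U"
      by (intro SUP_cong refl) (simp only: c mem_Collect_eq)
    then show ?thesis by (simp only: fern_trapezoid_def)
  qed
  have ne: "int ?ne = int j + int z" using y by (simp add: j_def)
  show ?thesis
  proof (rule Set.set_eqI)
    fix t :: triangle
    obtain r p where t: "t = (r, p)" by (cases t)
    have flip: "(r, p) \<in> flip (int (j + h)) ` X \<longleftrightarrow> (int (j + h) + 1 - r, p) \<in> X" for X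
      by (simp add: flip_image_iff) (simp add: flip_def)
    show "t \<in> R_region x y z a \<longleftrightarrow> t \<in> fern_trapezoid ?N j m a \<union>
        flip (int (j + h)) ` fern_trapezoid ?N' h m (z # a)"
    proof (cases "r \<le> int j")
      case True
      have "(r, p) \<notin> ?D" using True by (auto simp: down_triangle_def)
      moreover have "(r, p) \<in> zigzag_region ?N ?ne ?se \<longleftrightarrow> (r, p) \<in> zigzag_region ?N j 0"
        using True ne by (auto simp: zigzag_region_def)
      moreover have "(int (j + h) + 1 - r, p) \<notin> fern_trapezoid ?N' h m (z # a)"
        using True by (auto simp: fern_trapezoid_def zigzag_region_0)
      ultimately show ?thesis unfolding R A t Un_iff flip by blast
    next
      case False
      have U: "(r, p) \<notin> ?U" using False by (auto simp: up_triangle_def)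
      have Z: "(r, p) \<notin> zigzag_region ?N j 0" using False by (auto simp: zigzag_region_0)
      have "(r, p) \<in> zigzag_region ?N ?ne ?se - ?D \<longleftrightarrow>
          (int (j + h) + 1 - r, p) \<in> fern_trapezoid ?N' h m (z # a)"
      proof (cases "y + z + E_sum a = 0")
        \<comment> \<open>The lower half has no rows here; \<open>h\<close> and \<open>?se\<close>
          are truncated to \<open>0\<close>.\<close>
        case True
        then have "?se = 0" "h = 0" "z = 0" by (auto simp: h_def)
        then have "(r, p) \<notin> zigzag_region ?N ?ne ?se" using False ne by (auto simp: zigzag_region_def)
        moreover have "fern_trapezoid ?N' h m (z # a) = {}" by (simp add: \<open>h = 0\<close>)
        ultimately show ?thesis by blast
      next
        case nz: False
        have h: "int h = int y + 2 * int z + 2 * int (E_sum a) - 1" using nz by (auto simp: h_def)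
        have se: "int ?se = int y + int z + 2 * int (E_sum a) - 1" using nz by auto
        have j: "int j = int y + 2 * int (O_sum a) - 1" using y by (simp add: j_def)
        have "int (h + 2 * O_sum a) = int (j + 2 * (z + E_sum a))" using h j by simp
        then have "h + 2 * O_sum a = j + 2 * (z + E_sum a)" by (simp only: of_nat_eq_iff)
        then have "(h + 2 * O_sum a) mod 2 = (j + 2 * (z + E_sum a)) mod 2" by (rule arg_cong)
        then have par: "h mod 2 = j mod 2" by (simp only: mod_mult_self2)
        have D: "(r, p) \<in> down_triangle (int j) c k \<longleftrightarrow> (int (j + h) + 1 - r, p) \<in> up_triangle (int h) c k" for c k
          by (auto simp: down_triangle_def up_triangle_def)
        have B: "(\<Union>i\<in>{i\<in>{1..length a}. even i}. up_triangle (int h)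
            (2 * int (m + ?s - s_sum i a) - int (h mod 2)) (term_of a i)) =
          (\<Union>i\<in>{i\<in>{1..length a}. even i}. up_triangle (int h) (?c i) (term_of a i))"
          by (intro SUP_cong refl) (simp only: c par mem_Collect_eq)
        have DB: "(r, p) \<in> ?D \<longleftrightarrow> (int (j + h) + 1 - r, p) \<in>
          (\<Union>i\<in>{i\<in>{1..length a}. even i}. up_triangle (int h) (?c i) (term_of a i))"
          using D by simp
        have ZB: "(r, p) \<in> zigzag_region ?N ?ne ?se \<longleftrightarrow> (int (j + h) + 1 - r, p) \<in> zigzag_region ?N' h 0 -
          up_triangle (int h) (2 * int ?N + int j) z"
        proof -
          have "(r, p) \<in> zigzag_region ?N ?ne ?se \<longleftrightarrow> r \<le> int j + int h \<and> 0 \<le> p \<and>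
              p \<le> (if r \<le> int j + int z then 2 * int ?N + r - 1 else 2 * int ?N + 2 * (int j + int z) - r)"
            using False ne se h by (auto simp: zigzag_region_def)
          \<comment> \<open>The two branches form the minimum of two slanted bounds. After the
            reflection the first bound removes the corner triangle and the second is the straight
            side of the trapezoid.\<close>
          also have "\<dots> \<longleftrightarrow> r \<le> int j + int h \<and> 0 \<le> p \<and> p \<le> 2 * int ?N + r - 1 \<and>
              p \<le> 2 * int ?N + 2 * (int j + int z) - r"
            by auto
          also have "\<dots> \<longleftrightarrow> (int (j + h) + 1 - r, p) \<in> zigzag_region ?N' h 0 -
              up_triangle (int h) (2 * int ?N + int j) z"
            using False h j by (auto simp: zigzag_region_0 up_triangle_def)
          finally show ?thesis .
        qed
        have "fern_trapezoid ?N' h m (z # a) = zigzag_region ?N' h 0 -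
          up_triangle (int h) (2 * int ?N + int j) z -
          (\<Union>i\<in>{i\<in>{1..length a}. even i}. up_triangle (int h) (?c i) (term_of a i))"
          unfolding fern_trapezoid_Cons B by (simp only: par w)
        then show ?thesis by (simp only: Diff_iff[of "(r, p)"] DB ZB) (simp only: Diff_iff)
      qed
      then show ?thesis unfolding R A t Un_iff flip using U Z by blast
    qed
  qed
qed

text \<open>A vertical lozenge crosses the line only where neither half has a dent. If one half has
  no rows nothing crosses, which the conditional records.\<close>

lemma R'_crossing_sum:
  fixes x y z :: nat and a :: "nat list"
  assumes y: "y + 2 * O_sum a \<ge> 1"
  defines "m \<equiv> x + y div 2" and "j \<equiv> y + 2 * O_sum a - 1" and "h \<equiv> y + 2 * z + 2 * E_sum a - 1"
  shows "R' x y z a = (\<Sum>S\<in>Pow (if j \<ge> 1 \<and> h \<ge> 1 then {..<m} else {}).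
    (\<Prod>q\<in>S. if odd j then wall_weight q else 1) *
    trapezoid_sum (x + E_sum a) j (S \<union> fern_dents odd m a) *
    trapezoid_sum (x + O_sum a) h (S \<union> fern_dents odd m (z # a)))"
    (is "_ = (\<Sum>S\<in>Pow ?P'. ?g S)")
proof -
  let ?A = "fern_trapezoid (x + E_sum a) j m a" and ?B' = "fern_trapezoid (x + O_sum a) h m (z # a)"
  let ?B = "flip (int (j + h)) ` ?B'"
  let ?s = "s_sum (length a) a"
  have s: "?s = O_sum a + E_sum a" by (simp add: O_sum_plus_E_sum)
  have sz: "s_sum (length (z # a)) (z # a) = z + ?s" by (simp add: s_sum_Cons)
  have wA: "base_width (x + E_sum a) j = m + ?s"
    using y by (simp add: base_width_def s m_def j_def)
  have wB: "base_width (x + O_sum a) h = m + (z + ?s)"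
    unfolding s m_def h_def by (rule base_width_lower)
  have hO: "O_sum (z # a) \<le> h" "O_sum a \<le> j"
    using y unfolding O_sum_Cons h_def j_def by arith+
  \<comment> \<open>For \<open>h = 0\<close> the number \<open>j + h\<close> may be odd, but then
    the lower half is empty and needs no reflection.\<close>
  have even: "even (int (j + h))" if "h \<ge> 1"
  proof -
    have "h + 1 = y + 2 * z + 2 * E_sum a" using that unfolding h_def by simp
    moreover have "j + 1 = y + 2 * O_sum a" using y unfolding j_def by simp
    ultimately have "j + h + 2 = 2 * (y + O_sum a + z + E_sum a)" by simp
    then have "even (j + h + 2)" by (simp only: dvd_triv_left)
    then show ?thesis by simp
  qed
  have par: "base_pos h = base_pos j" if "h \<ge> 1"
    using even[OF that] by (auto simp: base_pos_def fun_eq_iff)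
  have finA: "finite ?A" and finB: "finite ?B"
    unfolding fern_trapezoid_def by (intro finite_imageI finite_Diff finite_zigzag_region)+
  have rowA: "r \<le> int j" if "(r, p) \<in> ?A" for r p
    using that by (auto simp: fern_trapezoid_def zigzag_region_0)
  have rowB: "r > int j" if "(r, p) \<in> ?B" for r p
  proof -
    have "flip (int (j + h)) (r, p) \<in> zigzag_region (x + O_sum a) h 0"
      using that unfolding flip_image_iff fern_trapezoid_def by blast
    then show ?thesis by (simp add: flip_def zigzag_region_0)
  qed
  have P: "{p. odd (int j + p) \<and> (int j, p) \<in> ?A \<and> (int j + 1, p) \<in> ?B} = base_pos j ` ?P'" (is "?P = _")
  proof (cases "j \<ge> 1 \<and> h \<ge> 1")
    case True
    have "p \<in> ?P \<longleftrightarrow> p \<in> base_pos j ` {..<m}" for p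
    proof (cases "odd (int j + p)")
      case odd: True
      have odd': "odd (int h + p)" using odd even True by auto
      have "(int j + 1, p) \<in> ?B \<longleftrightarrow> (int h, p) \<in> ?B'"
        by (simp add: flip_image_iff) (simp add: flip_def)
      then have "p \<in> ?P \<longleftrightarrow> p \<in> base_pos j ` ({..<m + ?s} - fern_dents odd m a) \<and>
          p \<in> base_pos j ` ({..<m + (z + ?s)} - fern_dents odd m (z # a))"
        using fern_trapezoid_base[of j p "x + E_sum a" m a] odd
          fern_trapezoid_base[of h p "x + O_sum a" m "z # a"] odd' True par
        by (simp add: wA wB)
      also have "\<dots> \<longleftrightarrow> p \<in> base_pos j ` (({..<m + ?s} - fern_dents odd m a) \<inter>
          ({..<m + (z + ?s)} - fern_dents odd m (z # a)))"
        by (subst inj_on_image_Int[OF inj_base_pos[of j UNIV]]) auto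
      \<comment> \<open>Each position of the fern belongs to an up- or a down-pointing triangle and
        so is missing from one half; the last \<open>z\<close> positions are missing from
        both.\<close>
      also have "({..<m + ?s} - fern_dents odd m a) \<inter> ({..<m + (z + ?s)} - fern_dents odd m (z # a)) = {..<m}"
      proof (rule Set.set_eqI)
        fix q
        have "q \<in> fern_dents odd m a \<or> q \<in> fern_dents even m a \<longleftrightarrow> m \<le> q \<and> q < m + ?s"
          using fern_dents_Un[of m a] by (metis Un_iff atLeastLessThan_iff)
        then show "q \<in> ({..<m + ?s} - fern_dents odd m a) \<inter> ({..<m + (z + ?s)} - fern_dents odd m (z # a)) \<longleftrightarrow>
            q \<in> {..<m}"
          by (simp add: fern_dents_Cons) linarith
      qed
      finally show ?thesis .
    next
      case False
      then show ?thesis by (auto simp: base_pos_def)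
    qed
    then have "?P = base_pos j ` {..<m}" by blast
    then show ?thesis using True by simp
  next
    case False
    then consider "j = 0" | "h = 0" by linarith
    then have "?P = {}"
      by cases simp_all
    then show ?thesis using False by (simp only: if_False) simp
  qed
  have "R' x y z a = tiling_sum west_weight (?A \<union> ?B)"
    using R_region_split[OF y] by (simp add: R'_def m_def j_def h_def)
  also have "\<dots> = (\<Sum>S\<in>Pow ?P. (\<Prod>p\<in>S. west_weight {(int j, p), (int j + 1, p)}) *
      tiling_sum west_weight (?A - Pair (int j) ` S) * tiling_sum west_weight (?B - Pair (int j + 1) ` S))"
    by (rule tiling_sum_line[OF finA rowA finB rowB])
  also have "\<dots> = (\<Sum>S\<in>Pow ?P'. (\<Prod>p\<in>base_pos j ` S. west_weight {(int j, p), (int j + 1, p)}) *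
      tiling_sum west_weight (?A - Pair (int j) ` base_pos j ` S) *
      tiling_sum west_weight (?B - Pair (int j + 1) ` base_pos j ` S))"
    unfolding P by (rule sum_Pow_image[OF inj_base_pos])
  also have "\<dots> = (\<Sum>S\<in>Pow ?P'. ?g S)"
  proof (rule sum.cong[OF refl])
    fix S assume S: "S \<in> Pow ?P'"
    then have Sm: "S \<subseteq> {..<m}" and jh: "S \<noteq> {} \<Longrightarrow> j \<ge> 1 \<and> h \<ge> 1" by (auto split: if_splits)
    have "west_weight {(int j, base_pos j q), (int j + 1, base_pos j q)} =
        (if odd j then wall_weight q else 1)" if "q \<in> S" for q
      using jh that by (intro west_weight_crossing) auto
    then have "(\<Prod>p\<in>base_pos j ` S. west_weight {(int j, p), (int j + 1, p)}) =
        (\<Prod>q\<in>S. if odd j then wall_weight q else 1)"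
      by (simp add: prod.reindex[OF inj_base_pos] cong: prod.cong)
    moreover have "tiling_sum west_weight (?A - Pair (int j) ` base_pos j ` S) =
        trapezoid_sum (x + E_sum a) j (S \<union> fern_dents odd m a)"
      using tiling_sum_fern_trapezoid[of a j m "x + E_sum a" S] hO wA Sm
      by (simp add: base_cells_def image_image)
    moreover have "tiling_sum west_weight (?B - Pair (int j + 1) ` base_pos j ` S) =
        trapezoid_sum (x + O_sum a) h (S \<union> fern_dents odd m (z # a))"
    proof -
      have "?B - Pair (int j + 1) ` base_pos j ` S = flip (int (j + h)) ` (?B' - base_cells h S)"
      proof -
        have "Pair (int j + 1) ` base_pos j ` S = flip (int (j + h)) ` base_cells h S"
        proof (cases "S = {}")
          case False
          then show ?thesis using par jh by (auto simp: base_cells_def flip_def image_image)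
        qed (simp add: base_cells_def)
        moreover have "inj (flip (int (j + h)))" by (metis flip_flip injI)
        ultimately show ?thesis by (simp add: image_set_diff)
      qed
      also have "tiling_sum west_weight \<dots> = tiling_sum west_weight (?B' - base_cells h S)"
      proof (cases "h \<ge> 1")
        case True
        show ?thesis
        proof (rule tiling_sum_involution)
          fix L assume L: "L \<subseteq> ?B' - base_cells h S"
          show "west_weight (flip (int (j + h)) ` L) = west_weight L"
          proof (rule west_weight_flip[OF even[OF True]])
            fix r p assume "(r, p) \<in> L"
            then have "(r, p) \<in> zigzag_region (x + O_sum a) h 0" using L by (auto simp: fern_trapezoid_def)
            then show "1 \<le> r \<and> r \<le> int (j + h)" by (auto simp: zigzag_region_0)
          qed
        qed (use lozenge_flip[OF even[OF True]] in auto)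
      next
        case False
        then have "h = 0" by simp
        then have "?B' = {}" by simp
        then show ?thesis by simp
      qed
      also have "\<dots> = trapezoid_sum (x + O_sum a) h (S \<union> fern_dents odd m (z # a))"
        by (rule tiling_sum_fern_trapezoid) (use hO wB sz Sm in auto)
      finally show ?thesis .
    qed
    ultimately show "(\<Prod>p\<in>base_pos j ` S. west_weight {(int j, p), (int j + 1, p)}) *
      tiling_sum west_weight (?A - Pair (int j) ` base_pos j ` S) *
      tiling_sum west_weight (?B - Pair (int j + 1) ` base_pos j ` S) = ?g S"
      by (simp only:)
  qed
  finally show ?thesis .
qed

lemma O_sum_Nil [simp]: "O_sum [] = 0" and E_sum_Nil [simp]: "E_sum [] = 0"
  by (simp_all add: O_sum_def E_sum_def)

lemma fern_dents_odd:
  "fern_dents odd m b \<subseteq> {m..<m + s_sum (length b) b}" "finite (fern_dents odd m b)"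
  "card (fern_dents odd m b) = O_sum b"
proof -
  show "fern_dents odd m b \<subseteq> {m..<m + s_sum (length b) b}" using fern_dents_Un[of m b] by blast
  then show "finite (fern_dents odd m b)" by (rule finite_subset) simp
  show "card (fern_dents odd m b) = O_sum b" using card_fern_dents by blast
qed

text \<open>Apart from truncation, a half with fern \<open>b\<close> has \<open>h'\<close> rows with
  \<open>h' + 1 = y + 2 * O_sum b\<close> and needs \<open>(h' + 1) div 2\<close> dents,
  \<open>O_sum b\<close> of them from the fern: both halves demand \<open>y div 2\<close>
  crossings.\<close>

lemma R'_value_sum:
  fixes x y z :: nat and a :: "nat list"
  assumes y: "y + 2 * O_sum a \<ge> 1"
  defines "m \<equiv> x + y div 2"
  shows "R' x y z a = (\<Sum>S\<in>{S. S \<subseteq> {..<m} \<and> card S = y div 2}.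
    (\<Prod>q\<in>S. if even y then wall_weight q else 1) *
    dent_value y (S \<union> fern_dents odd m a) * dent_value y (S \<union> fern_dents odd m (z # a)))"
proof -
  define j where "j = y + 2 * O_sum a - 1"
  define h where "h = y + 2 * z + 2 * E_sum a - 1"
  let ?P = "if j \<ge> 1 \<and> h \<ge> 1 then {..<m} else {}"
  let ?w = "\<lambda>S. \<Prod>q\<in>S. if even y then wall_weight q else 1"
  let ?v = "\<lambda>S. dent_value y (S \<union> fern_dents odd m a) * dent_value y (S \<union> fern_dents odd m (z # a))"
  let ?s = "s_sum (length a) a"
  have s: "?s = O_sum a + E_sum a" by (simp add: O_sum_plus_E_sum)
  have j1: "j + 1 = y + 2 * O_sum a" using y by (simp add: j_def)
  have par: "odd j \<longleftrightarrow> even y" using arg_cong[OF j1, of even] by simp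
  have val: "trapezoid_sum N h' (S \<union> fern_dents odd m b) =
      (if card S = y div 2 then dent_value y (S \<union> fern_dents odd m b) else 0)"
    if S: "S \<in> Pow ?P" and N: "base_width N h' = m + s_sum (length b) b"
      and h': "h' + 1 = y + 2 * O_sum b \<or> h' = 0 \<and> y = 0 \<and> O_sum b = 0"
      and h0: "h' = 0 \<Longrightarrow> j = 0 \<or> h = 0"
    for N h' b S
  proof -
    have Sm: "S \<subseteq> {..<m}" using S by (auto split: if_splits)
    have fin: "finite S" using Sm finite_subset by blast
    have disj: "S \<inter> fern_dents odd m b = {}" using Sm fern_dents_odd(1)[of m b] by fastforce
    have card: "card (S \<union> fern_dents odd m b) = card S + O_sum b"
      using card_Un_disjoint[OF fin fern_dents_odd(2) disj] fern_dents_odd(3) by simp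
    have "h' \<ge> 1 \<or> S \<union> fern_dents odd m b = {}"
    proof (cases "h' = 0")
      case True
      then have "S = {}" using S h0 by (auto split: if_splits)
      moreover have "O_sum b = 0" using h' True by arith
      then have "fern_dents odd m b = {}" using fern_dents_odd(2,3)[of m b] by simp
      ultimately show ?thesis by simp
    qed simp
    moreover have "S \<union> fern_dents odd m b \<subseteq> {..<base_width N h'}"
      using Sm fern_dents_odd(1)[of m b] unfolding N by fastforce
    ultimately have *: "trapezoid_sum N h' (S \<union> fern_dents odd m b) =
      (if card S + O_sum b = (h' + 1) div 2 then dent_value (h' + 1) (S \<union> fern_dents odd m b) else 0)"
      using trapezoid_sum_value[of h' "S \<union> fern_dents odd m b" N] card by simp
    show ?thesis
      using h'
    proof
      assume h'': "h' + 1 = y + 2 * O_sum b"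
      then have "card S + O_sum b = (h' + 1) div 2 \<longleftrightarrow> card S = y div 2" by simp
      moreover have "dent_value (h' + 1) D = dent_value y D" for D
        by (rule dent_value_cong) (use arg_cong[OF h'', of even] in simp)
      ultimately show ?thesis unfolding * by simp
    next
      \<comment> \<open>The truncated case: there are no rows and no dents, so the wrong parity of
        \<open>h' + 1\<close> does not change the value \<open>1\<close>.\<close>
      assume h'': "h' = 0 \<and> y = 0 \<and> O_sum b = 0"
      then have "S = {}" using S h0 by (auto split: if_splits)
      moreover have "fern_dents odd m b = {}" using h'' fern_dents_odd(2,3)[of m b] by simp
      ultimately show ?thesis unfolding *
        using h'' by (simp add: dent_value_def dent_product_def vandermonde_def H2_def)
    qed
  qed
  have "R' x y z a = (\<Sum>S\<in>Pow ?P. ?w S * trapezoid_sum (x + E_sum a) j (S \<union> fern_dents odd m a) *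
      trapezoid_sum (x + O_sum a) h (S \<union> fern_dents odd m (z # a)))"
    using R'_crossing_sum[OF y, of x z] par by (simp add: m_def j_def h_def)
  also have "\<dots> = (\<Sum>S\<in>Pow ?P. if card S = y div 2 then ?w S * ?v S else 0)"
  proof (rule sum.cong[OF refl])
    fix S assume S: "S \<in> Pow ?P"
    have "trapezoid_sum (x + E_sum a) j (S \<union> fern_dents odd m a) =
      (if card S = y div 2 then dent_value y (S \<union> fern_dents odd m a) else 0)"
    proof (rule val[OF S])
      show "base_width (x + E_sum a) j = m + s_sum (length a) a"
        using j1 by (simp add: base_width_def s m_def)
    qed (use j1 in auto)
    moreover have "trapezoid_sum (x + O_sum a) h (S \<union> fern_dents odd m (z # a)) =
      (if card S = y div 2 then dent_value y (S \<union> fern_dents odd m (z # a)) else 0)"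
    proof (rule val[OF S])
      show "base_width (x + O_sum a) h = m + s_sum (length (z # a)) (z # a)"
      proof -
        have "s_sum (length (z # a)) (z # a) = z + (O_sum a + E_sum a)" by (simp add: s_sum_Cons s)
        then show ?thesis unfolding m_def h_def by (simp only: base_width_lower)
      qed
      show "h + 1 = y + 2 * O_sum (z # a) \<or> h = 0 \<and> y = 0 \<and> O_sum (z # a) = 0"
        unfolding O_sum_Cons h_def by arith
    qed simp
    ultimately show "?w S * trapezoid_sum (x + E_sum a) j (S \<union> fern_dents odd m a) *
      trapezoid_sum (x + O_sum a) h (S \<union> fern_dents odd m (z # a)) =
      (if card S = y div 2 then ?w S * ?v S else 0)"
      by simp
  qed
  also have "\<dots> = (\<Sum>S\<in>{S\<in>Pow ?P. card S = y div 2}. ?w S * ?v S)"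
    by (rule sum.inter_filter[symmetric]) simp
  also have "{S\<in>Pow ?P. card S = y div 2} = {S. S \<subseteq> {..<m} \<and> card S = y div 2}"
  proof (cases "j \<ge> 1 \<and> h \<ge> 1")
    \<comment> \<open>If one half has no rows then \<open>y < 2\<close>, and the empty set is the
      only candidate on both sides.\<close>
    case False
    then have "y < 2" using j1 unfolding h_def by linarith
    then have "y div 2 = 0" by simp
    moreover have "S = {}" if "S \<subseteq> {..<m}" "card S = 0" for S
      using that finite_subset[of S "{..<m}"] by simp
    ultimately show ?thesis using False by auto
  qed auto
  finally show ?thesis by (simp add: mult.assoc)
qed

section \<open>Evaluation of the sum over crossing positions\<close>

definition dent_point :: "nat \<Rightarrow> nat \<Rightarrow> real" where
  "dent_point y q = (real q + real (y mod 2) / 2)\<^sup>2"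

lemma dent_product_alt:
  "dent_product y D = (if odd y then \<Prod>q\<in>D. real q + 1 / 2 else 1) * vandermonde (dent_point y) D"
  by (auto simp: dent_product_def dent_point_def[abs_def] odd_iff_mod_2_eq_one)

lemma vandermonde_Un:
  assumes "finite S" "finite D" "\<And>q q'. q \<in> D \<Longrightarrow> q' \<in> S \<Longrightarrow> q' < q"
  shows "vandermonde X (S \<union> D) = vandermonde X S * vandermonde X D * (\<Prod>q\<in>D. \<Prod>q'\<in>S. X q - X q')"
proof -
  have disj: "S \<inter> D = {}" using assms(3) by fastforce
  have 1: "{q' \<in> S \<union> D. q' < q} = {q' \<in> S. q' < q}" if "q \<in> S" for q
    using assms(3)[of _ q] that by fastforce
  have 2: "(\<Prod>q'\<in>{q' \<in> S \<union> D. q' < q}. X q - X q') =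
      (\<Prod>q'\<in>S. X q - X q') * (\<Prod>q'\<in>{q' \<in> D. q' < q}. X q - X q')" if "q \<in> D" for q
  proof -
    have "{q' \<in> S \<union> D. q' < q} = S \<union> {q' \<in> D. q' < q}" using assms(3)[of q] that by auto
    then show ?thesis
      by (simp only:) (rule prod.union_disjoint, use assms disj in auto)
  qed
  have "vandermonde X (S \<union> D) = (\<Prod>q\<in>S. \<Prod>q'\<in>{q' \<in> S \<union> D. q' < q}. X q - X q') *
      (\<Prod>q\<in>D. \<Prod>q'\<in>{q' \<in> S \<union> D. q' < q}. X q - X q')"
    unfolding vandermonde_def by (rule prod.union_disjoint) (use assms disj in auto)
  also have "\<dots> = vandermonde X S * (\<Prod>q\<in>D. (\<Prod>q'\<in>S. X q - X q') * (\<Prod>q'\<in>{q' \<in> D. q' < q}. X q - X q'))"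
    unfolding vandermonde_def using 1 2 by simp
  finally show ?thesis by (simp add: prod.distrib vandermonde_def mult_ac)
qed

text \<open>Here crossings and fern separate: only the last factor mixes the two, and it is
  multiplicative in \<open>D\<close>.\<close>

lemma dent_product_Un:
  assumes "finite S" "finite D" "\<And>q q'. q \<in> D \<Longrightarrow> q' \<in> S \<Longrightarrow> q' < q"
  shows "dent_product y (S \<union> D) = dent_product y S * dent_product y D *
    (\<Prod>q\<in>D. \<Prod>q'\<in>S. dent_point y q - dent_point y q')"
proof -
  have "S \<inter> D = {}" using assms(3) by fastforce
  then have "(\<Prod>q\<in>S \<union> D. real q + 1 / 2) = (\<Prod>q\<in>S. real q + 1 / 2) * (\<Prod>q\<in>D. real q + 1 / 2)"
    by (rule prod.union_disjoint[OF assms(1,2)])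
  then show ?thesis
    using vandermonde_Un[OF assms] by (simp add: dent_product_alt)
qed

lemma H_pos: "H n > 0"
  unfolding H_def by (intro prod_pos) simp

lemma H2_pos: "H2 n > 0"
  unfolding H2_def by (intro prod_pos) simp

lemma dent_products_reversed:
  fixes a :: "nat list" and m z :: nat
  assumes a: "a \<noteq> []"
  defines "t\<^sub>1 \<equiv> (m + term_of a (2 * ((length a + 1) div 2))) # rev_prefix a (2 * ((length a + 1) div 2) - 1)"
    and "t\<^sub>2 \<equiv> (m + term_of a (2 * (length a div 2) + 1)) # rev_prefix a (2 * (length a div 2)) @ [z]"
  shows "odd y \<Longrightarrow> dent_product y (fern_dents odd m a) = H2 (2 * O_sum a + 1) * Q' t\<^sub>1"
    and "odd y \<Longrightarrow> dent_product y (fern_dents odd m (z # a)) = H2 (2 * E_sum a + 2 * z + 1) * Q' t\<^sub>2"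
    and "even y \<Longrightarrow> dent_product y (fern_dents odd m a) = H2 (2 * O_sum a) * K' t\<^sub>1"
    and "even y \<Longrightarrow> dent_product y (fern_dents odd m (z # a)) = H2 (2 * E_sum a + 2 * z) * K' t\<^sub>2"
proof -
  have p: "2 * ((length (z # a) + 1) div 2) = Suc (2 * (length a div 2) + 1)" by simp
  have "rev_prefix (z # a) (Suc k) = rev_prefix a k @ [z]" for k
    by (induction k) (simp_all add: rev_prefix_def term_of_Cons)
  \<comment> \<open>\<open>t\<^sub>2\<close> is the reversed form of \<open>z # a\<close>, whose
    term \<open>k + 1\<close> is term \<open>k\<close> of \<open>a\<close>; hence the index
    \<open>2 * (length a div 2) + 1\<close>.\<close>
  then have t2: "t\<^sub>2 = (m + term_of (z # a) (2 * ((length (z # a) + 1) div 2))) #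
      rev_prefix (z # a) (2 * ((length (z # a) + 1) div 2) - 1)"
    unfolding p t\<^sub>2_def by (simp add: term_of_Cons)
  have Q: "Q' t\<^sub>1 = dent_value 1 (fern_dents odd m a)" "Q' t\<^sub>2 = dent_value 1 (fern_dents odd m (z # a))"
    using Q'_reversed[OF a refl t\<^sub>1_def[THEN meta_eq_to_obj_eq]] Q'_reversed[OF _ refl t2] by simp_all
  have K: "K' t\<^sub>1 = dent_value 0 (fern_dents odd m a)" "K' t\<^sub>2 = dent_value 0 (fern_dents odd m (z # a))"
    using K'_reversed[OF a refl t\<^sub>1_def[THEN meta_eq_to_obj_eq]] K'_reversed[OF _ refl t2] by simp_all
  have pos: "H2 n \<noteq> 0" for n using H2_pos[of n] by simp
  show "odd y \<Longrightarrow> dent_product y (fern_dents odd m a) = H2 (2 * O_sum a + 1) * Q' t\<^sub>1"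
    "odd y \<Longrightarrow> dent_product y (fern_dents odd m (z # a)) = H2 (2 * E_sum a + 2 * z + 1) * Q' t\<^sub>2"
    unfolding Q dent_value_def fern_dents_odd(3)
    using pos dent_product_cong[of y 1] by (simp_all add: O_sum_Cons add.commute)
  show "even y \<Longrightarrow> dent_product y (fern_dents odd m a) = H2 (2 * O_sum a) * K' t\<^sub>1"
    "even y \<Longrightarrow> dent_product y (fern_dents odd m (z # a)) = H2 (2 * E_sum a + 2 * z) * K' t\<^sub>2"
    unfolding K dent_value_def fern_dents_odd(3)
    using pos dent_product_cong[of y 0] by (simp_all add: O_sum_Cons add.commute)
qed

text \<open>A discrete Selberg-type sum: a squared Vandermonde product over the chosen points,
  weighted by their factors with a block of \<open>L\<close> further positions. The block stands for
  fern and corner together.\<close>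

definition selberg_sum :: "nat \<Rightarrow> nat \<Rightarrow> nat \<Rightarrow> real" where
  "selberg_sum y m L = (\<Sum>S\<in>{S. S \<subseteq> {..<m} \<and> card S = y div 2}.
    (\<Prod>q\<in>S. if even y then wall_weight q else 1) * (dent_product y S)\<^sup>2 *
    (\<Prod>q\<in>{m..<m + L}. \<Prod>q'\<in>S. dent_point y q - dent_point y q'))"

text \<open>The fern dents of the two halves partition the \<open>s_sum (length a) a + z\<close>
  positions from \<open>m\<close> on, so their factors with \<open>S\<close> multiply to the product
  over that block, whatever the fern is.\<close>

lemma R'_factorization:
  fixes x y z :: nat and a :: "nat list"
  assumes y: "y + 2 * O_sum a \<ge> 1"
  defines "m \<equiv> x + y div 2"
  shows "R' x y z a = selberg_sum y m (s_sum (length a) a + z) *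
    dent_product y (fern_dents odd m a) * dent_product y (fern_dents odd m (z # a)) /
    (H2 (2 * O_sum a + y) * H2 (2 * E_sum a + y + 2 * z))"
proof -
  let ?D1 = "fern_dents odd m a" and ?D2 = "fern_dents odd m (z # a)" and ?s = "s_sum (length a) a"
  let ?c = "\<lambda>D S. \<Prod>q\<in>D. \<Prod>q'\<in>S. dent_point y q - dent_point y q'"
  let ?w = "\<lambda>S. \<Prod>q\<in>S. if even y then wall_weight q else 1"
  let ?H = "H2 (2 * O_sum a + y) * H2 (2 * E_sum a + y + 2 * z)"
  have yy: "2 * (y div 2) + y mod 2 = y" by simp
  have sub: "?D1 \<subseteq> {m..<m + ?s}" "fern_dents even m a \<subseteq> {m..<m + ?s}"
    using fern_dents_Un[of m a] by auto
  have un: "?D1 \<union> ?D2 = {m..<m + (?s + z)}"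
  proof -
    have "?D1 \<union> ?D2 = {m + ?s..<m + ?s + z} \<union> (?D1 \<union> fern_dents even m a)"
      by (auto simp: fern_dents_Cons)
    moreover have "{A + B..<A + B + C} \<union> {A..<A + B} = {A..<A + (B + C)}" for A B C :: nat by auto
    ultimately show ?thesis by (simp only: fern_dents_Un)
  qed
  have disj: "?D1 \<inter> ?D2 = {}"
    using fern_dents_disjoint[of m a] sub by (fastforce simp: fern_dents_Cons)
  have "R' x y z a = (\<Sum>S\<in>{S. S \<subseteq> {..<m} \<and> card S = y div 2}.
      ?w S * dent_value y (S \<union> ?D1) * dent_value y (S \<union> ?D2))"
    unfolding m_def by (rule R'_value_sum[OF y])
  also have "\<dots> = (\<Sum>S\<in>{S. S \<subseteq> {..<m} \<and> card S = y div 2}.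
      ?w S * (dent_product y S)\<^sup>2 * ?c {m..<m + (?s + z)} S *
      (dent_product y ?D1 * dent_product y ?D2 / ?H))"
  proof (rule sum.cong[OF refl])
    fix S assume "S \<in> {S. S \<subseteq> {..<m} \<and> card S = y div 2}"
    then have S: "S \<subseteq> {..<m}" "card S = y div 2" by auto
    have fin: "finite S" using S(1) finite_subset by blast
    have val: "dent_value y (S \<union> fern_dents odd m b) =
        dent_product y S * dent_product y (fern_dents odd m b) * ?c (fern_dents odd m b) S /
        H2 (2 * O_sum b + y)" for b
    proof -
      have lt: "q' < q" if "q \<in> fern_dents odd m b" "q' \<in> S" for q q'
        using that S fern_dents_odd(1)[of m b] by fastforce
      have disj: "S \<inter> fern_dents odd m b = {}" using lt by fastforce
      have "2 * card (S \<union> fern_dents odd m b) + y mod 2 = 2 * O_sum b + y"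
        using card_Un_disjoint[OF fin fern_dents_odd(2) disj] S(2) yy by (simp add: fern_dents_odd(3))
      then show ?thesis
        unfolding dent_value_def by (simp add: dent_product_Un[OF fin fern_dents_odd(2) lt])
    qed
    have c: "?c {m..<m + (?s + z)} S = ?c ?D1 S * ?c ?D2 S"
      unfolding un[symmetric] by (rule prod.union_disjoint[OF fern_dents_odd(2) fern_dents_odd(2) disj])
    have O: "2 * O_sum (z # a) + y = 2 * E_sum a + y + 2 * z"
      by (simp add: O_sum_Cons)
    show "?w S * dent_value y (S \<union> ?D1) * dent_value y (S \<union> ?D2) =
        ?w S * (dent_product y S)\<^sup>2 * ?c {m..<m + (?s + z)} S *
        (dent_product y ?D1 * dent_product y ?D2 / ?H)"
      unfolding val c O by (simp add: power2_eq_square mult_ac)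
  qed
  also have "\<dots> = selberg_sum y m (?s + z) * (dent_product y ?D1 * dent_product y ?D2 / ?H)"
    unfolding selberg_sum_def sum_distrib_right ..
  finally show ?thesis by simp
qed

lemma R'_half_hexagon:
  fixes x y L :: nat
  assumes "y \<ge> 1"
  shows "R' x y L [] = dent_value 1 {x..<x + (y + L - 1)}"
proof -
  let ?n = "y + L - 1"
  have s: "s_sum (length [?n]) [?n] = ?n" by (simp add: s_sum_Suc term_of_def)
  have O: "O_sum [?n] = ?n" using O_sum_Cons[of ?n "[]"] by simp
  have D: "fern_dents odd x [?n] = {x..<x + ?n}" by (simp add: fern_dents_Cons)
  have w: "base_width x (2 * ?n) = x + ?n" by (simp add: base_width_def)
  have "R_region x y L [] = zigzag_region x ?n ?n"
    by (simp add: R_region_def)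
  also have "\<dots> = fern_trapezoid x (2 * ?n) x [?n]"
    unfolding fern_trapezoid_Cons by (auto simp: zigzag_region_def up_triangle_def split: if_splits)
  finally have "R' x y L [] = tiling_sum west_weight (fern_trapezoid x (2 * ?n) x [?n] - base_cells (2 * ?n) {})"
    by (simp add: R'_def base_cells_def)
  also have "\<dots> = trapezoid_sum x (2 * ?n) {x..<x + ?n}"
    by (subst tiling_sum_fern_trapezoid) (use s O D w in auto)
  also have "\<dots> = dent_value (2 * ?n + 1) {x..<x + ?n}"
    by (subst trapezoid_sum_value) (use w in auto)
  also have "\<dots> = dent_value 1 {x..<x + ?n}" by (rule dent_value_cong) simp
  finally show ?thesis .
qed

text \<open>Two evaluations of the empty fern with \<open>z = L\<close>: through the crossing sum,
  where only the lower half has dents besides the crossings, and as a half hexagon.\<close>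

lemma selberg_sum_block:
  fixes x y L :: nat
  assumes "y \<ge> 1"
  shows "selberg_sum y (x + y div 2) L * dent_product y {x + y div 2..<x + y div 2 + L} =
    H2 y * H2 (2 * L + y) * dent_value 1 {x..<x + (y + L - 1)}"
proof -
  have "dent_value 1 {x..<x + (y + L - 1)} = selberg_sum y (x + y div 2) L *
      dent_product y {x + y div 2..<x + y div 2 + L} / (H2 y * H2 (2 * L + y))"
    using R'_factorization[of y "[]" x L] R'_half_hexagon[OF assms, of x L] assms
    by (simp add: fern_dents_Cons dent_product_def vandermonde_def add.commute)
  then show ?thesis using H2_pos[of y] H2_pos[of "2 * L + y"] by (simp add: field_simps)
qed

section \<open>Closed products for blocks of consecutive positions\<close>

definition triangular_product :: "nat \<Rightarrow> nat \<Rightarrow> real" where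
  "triangular_product x n = (\<Prod>i<n. \<Prod>l\<le>i. real (2 * x + i + l + 1))"

lemma triangular_product_pos: "triangular_product x n > 0"
  unfolding triangular_product_def by (intro prod_pos) simp

lemma vandermonde_block:
  "vandermonde (dent_point y) {x..<x + n} =
    H n * (\<Prod>i<n. \<Prod>l<i. real (2 * x + i + l + y mod 2))"
proof -
  have "{x..<x + n} = (\<lambda>i. x + i) ` {..<n}"
    using image_add_atLeastLessThan[of x 0 n] by (simp add: atLeast0LessThan add.commute)
  then have "vandermonde (dent_point y) {x..<x + n} =
      (\<Prod>i<n. \<Prod>l<i. dent_point y (x + i) - dent_point y (x + l))"
    by (simp add: vandermonde_image)
  also have "\<dots> = (\<Prod>i<n. \<Prod>l<i. real (i - l) * real (2 * x + i + l + y mod 2))"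
  proof (intro prod.cong refl)
    fix i l assume "i \<in> {..<n}" "l \<in> {..<i}"
    then show "dent_point y (x + i) - dent_point y (x + l) = real (i - l) * real (2 * x + i + l + y mod 2)"
      by (simp add: dent_point_def power2_eq_square of_nat_diff field_simps)
  qed
  also have "\<dots> = (\<Prod>i<n. \<Prod>l<i. real (i - l)) * (\<Prod>i<n. \<Prod>l<i. real (2 * x + i + l + y mod 2))"
    by (simp only: prod.distrib)
  also have "(\<Prod>l<i. real (i - l)) = fact i" for i
  proof -
    have "(\<Prod>l<i. real (i - l)) = (\<Prod>l<i. real (Suc l))"
      by (rule prod.reindex_bij_witness[where i = "\<lambda>l. i - Suc l" and j = "\<lambda>l. i - Suc l"]) auto
    then show ?thesis by (simp add: fact_prod_Suc atLeast0LessThan)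
  qed
  then have "(\<Prod>i<n. \<Prod>l<i. real (i - l)) = H n" by (simp add: H_def)
  finally show ?thesis .
qed

text \<open>The factors \<open>q + 1 / 2\<close> are the halves of \<open>2 * x + i + i + 1\<close>:
  they supply the diagonal of the triangular product and the power of \<open>2\<close>.\<close>

lemma dent_product_block_odd:
  assumes "odd y"
  shows "dent_product y {x..<x + n} = H n / 2 ^ n * triangular_product x n"
proof -
  have "(\<Prod>q\<in>{x..<x + n}. real q + 1 / 2) = (\<Prod>i<n. real (x + i) + 1 / 2)"
    by (rule prod.reindex_bij_witness[where i = "\<lambda>i. x + i" and j = "\<lambda>q. q - x"]) auto
  also have "\<dots> = (\<Prod>i<n. real (2 * x + i + i + 1) / 2)"
    by (intro prod.cong) auto
  also have "\<dots> = (\<Prod>i<n. real (2 * x + i + i + 1)) / 2 ^ n"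
    by (simp only: prod_dividef prod_constant card_lessThan)
  finally have "dent_product y {x..<x + n} = (\<Prod>i<n. real (2 * x + i + i + 1)) / 2 ^ n *
      (H n * (\<Prod>i<n. \<Prod>l<i. real (2 * x + i + l + 1)))"
    using assms by (simp only: dent_product_alt vandermonde_block odd_iff_mod_2_eq_one simp_thms if_True)
  also have "\<dots> = H n / 2 ^ n * ((\<Prod>i<n. \<Prod>l<i. real (2 * x + i + l + 1)) * (\<Prod>i<n. real (2 * x + i + i + 1)))"
    by simp
  also have "(\<Prod>i<n. \<Prod>l<i. real (2 * x + i + l + 1)) * (\<Prod>i<n. real (2 * x + i + i + 1)) = triangular_product x n"
    unfolding triangular_product_def lessThan_Suc_atMost[symmetric] prod.lessThan_Suc prod.distrib ..
  finally show ?thesis .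
qed

text \<open>Integer points have the sums \<open>2 * m + i + l\<close> with \<open>l < i\<close> and
  no diagonal; lowering \<open>i\<close> by one makes this a triangular product with one row
  less.\<close>

lemma dent_product_block_even:
  assumes "even y"
  shows "dent_product y {m..<m + L} = H L * triangular_product m (L - 1)"
proof -
  have "dent_product y {m..<m + L} = H L * (\<Prod>i<L. \<Prod>l<i. real (2 * m + i + l))"
    using assms vandermonde_block[of y m L] by (simp add: dent_product_alt)
  also have "(\<Prod>i<L. \<Prod>l<i. real (2 * m + i + l)) = triangular_product m (L - 1)"
  proof (cases L)
    case (Suc n)
    have "(\<Prod>i<Suc n. \<Prod>l<i. real (2 * m + i + l)) = (\<Prod>i<n. \<Prod>l<Suc i. real (2 * m + Suc i + l))"
      by (subst prod.lessThan_Suc_shift) simp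
    also have "\<dots> = triangular_product m n"
      unfolding triangular_product_def lessThan_Suc_atMost by (intro prod.cong refl) simp
    finally show ?thesis by (simp add: Suc)
  qed (simp add: triangular_product_def)
  finally show ?thesis .
qed

lemma triangular_product_Suc:
  "triangular_product x (Suc n) = pochhammer (2 * real x + 1) (Suc n) * triangular_product (Suc x) n"
proof -
  have "triangular_product x (Suc n) = (\<Prod>i<Suc n. real (2 * x + i + 1) * (\<Prod>l<i. real (2 * x + i + Suc l + 1)))"
    unfolding triangular_product_def lessThan_Suc_atMost[symmetric]
    by (intro prod.cong refl) (subst prod.lessThan_Suc_shift, simp)
  also have "\<dots> = (\<Prod>i<Suc n. real (2 * x + i + 1)) * (\<Prod>i<Suc n. \<Prod>l<i. real (2 * x + i + Suc l + 1))"
    by (rule prod.distrib)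
  also have "(\<Prod>i<Suc n. real (2 * x + i + 1)) = pochhammer (2 * real x + 1) (Suc n)"
    unfolding pochhammer_prod atLeast0LessThan by (intro prod.cong refl) simp
  also have "(\<Prod>i<Suc n. \<Prod>l<i. real (2 * x + i + Suc l + 1)) =
      (\<Prod>i<n. \<Prod>l<Suc i. real (2 * x + Suc i + Suc l + 1))"
    by (subst prod.lessThan_Suc_shift) simp
  also have "\<dots> = triangular_product (Suc x) n"
    unfolding triangular_product_def lessThan_Suc_atMost by (intro prod.cong refl) simp
  finally show ?thesis .
qed

text \<open>The first column gives \<open>2 * x + 1\<close> up to \<open>2 * x + n + 2\<close>, and
  the last row of the rest continues up to \<open>2 * x + 2 * n + 3\<close>: one Pochhammer symbol.
  Iteration yields the product in the theorem.\<close>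

lemma triangular_product_Suc_Suc:
  "triangular_product x (n + 2) = pochhammer (2 * real x + 1) (2 * n + 3) * triangular_product (Suc x) n"
proof -
  have "triangular_product (Suc x) (Suc n) = triangular_product (Suc x) n * (\<Prod>l\<le>n. real (2 * Suc x + n + l + 1))"
    by (simp add: triangular_product_def)
  also have "(\<Prod>l\<le>n. real (2 * Suc x + n + l + 1)) =
      pochhammer (2 * real x + 1 + real (Suc (Suc n))) (Suc n)"
    unfolding pochhammer_prod atLeast0LessThan lessThan_Suc_atMost by (intro prod.cong refl) simp
  finally have "triangular_product x (Suc (Suc n)) =
      pochhammer (2 * real x + 1) (Suc (Suc n)) * pochhammer (2 * real x + 1 + real (Suc (Suc n))) (Suc n) *
      triangular_product (Suc x) n"
    unfolding triangular_product_Suc[of x "Suc n"] by simp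
  also have "pochhammer (2 * real x + 1) (Suc (Suc n)) * pochhammer (2 * real x + 1 + real (Suc (Suc n))) (Suc n) =
      pochhammer (2 * real x + 1) (Suc (Suc n) + Suc n)"
    by (rule pochhammer_product'[symmetric])
  finally show ?thesis by (simp add: numeral_eq_Suc)
qed

lemma triangular_product_shift:
  "triangular_product x (n + 2 * k) =
    (\<Prod>i=1..k. pochhammer (2 * real x + 2 * real i - 1) (2 * n + 4 * k + 3 - 4 * i)) *
    triangular_product (x + k) n"
proof (induction k arbitrary: x)
  case (Suc k)
  have "(\<Prod>i=1..Suc k. pochhammer (2 * real x + 2 * real i - 1) (2 * n + 4 * Suc k + 3 - 4 * i)) =
      (\<Prod>i<Suc k. pochhammer (2 * real x + 2 * real i + 1) (2 * n + 4 * Suc k - 1 - 4 * i))"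
    unfolding One_nat_def prod.atLeast1_atMost_eq by (intro prod.cong refl arg_cong2[where f = pochhammer]) auto
  also have "\<dots> = pochhammer (2 * real x + 1) (2 * n + 4 * k + 3) *
      (\<Prod>i<k. pochhammer (2 * real (Suc x) + 2 * real i + 1) (2 * n + 4 * k - 1 - 4 * i))"
    unfolding prod.lessThan_Suc_shift
    by (intro arg_cong2[where f = times] prod.cong refl arg_cong2[where f = pochhammer]) auto
  also have "(\<Prod>i<k. pochhammer (2 * real (Suc x) + 2 * real i + 1) (2 * n + 4 * k - 1 - 4 * i)) =
      (\<Prod>i=1..k. pochhammer (2 * real (Suc x) + 2 * real i - 1) (2 * n + 4 * k + 3 - 4 * i))"
    unfolding One_nat_def prod.atLeast1_atMost_eq by (intro prod.cong refl arg_cong2[where f = pochhammer]) auto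
  finally have prod: "(\<Prod>i=1..Suc k. pochhammer (2 * real x + 2 * real i - 1) (2 * n + 4 * Suc k + 3 - 4 * i)) =
      pochhammer (2 * real x + 1) (2 * n + 4 * k + 3) *
      (\<Prod>i=1..k. pochhammer (2 * real (Suc x) + 2 * real i - 1) (2 * n + 4 * k + 3 - 4 * i))" .
  have "triangular_product x (n + 2 * Suc k) = triangular_product x ((n + 2 * k) + 2)" by simp
  also have "\<dots> = pochhammer (2 * real x + 1) (2 * (n + 2 * k) + 3) * triangular_product (Suc x) (n + 2 * k)"
    by (rule triangular_product_Suc_Suc)
  also have "2 * (n + 2 * k) + 3 = 2 * n + 4 * k + 3" by simp
  finally show ?case unfolding prod Suc.IH by (simp only: mult.assoc add_Suc add_Suc_right)
qed simp

text \<open>The shift with \<open>L - 1\<close> in place of \<open>n\<close>. For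
  \<open>L = 0\<close> there is no such \<open>n\<close>; the last Pochhammer symbol then has length
  \<open>1\<close> and supplies the diagonal factor that is left.\<close>

lemma triangular_product_shift':
  assumes "k \<ge> 1"
  shows "triangular_product x (L + 2 * k - 1) =
    (\<Prod>i=1..k. pochhammer (2 * real x + 2 * real i - 1) (2 * L + 4 * k + 1 - 4 * i)) *
    triangular_product (x + k) (L - 1)"
proof (cases L)
  case (Suc n)
  have "L + 2 * k - 1 = n + 2 * k" "L - 1 = n" "2 * L + 4 * k + 1 - 4 * i = 2 * n + 4 * k + 3 - 4 * i" for i
    using Suc by auto
  then show ?thesis using triangular_product_shift[of x n k] by (simp only:)
next
  case 0
  obtain k' where k: "k = Suc k'" using assms by (cases k) auto
  have "triangular_product x (L + 2 * k - 1) = triangular_product x (1 + 2 * k')"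
    using 0 k by simp
  also have "\<dots> = (\<Prod>i=1..k'. pochhammer (2 * real x + 2 * real i - 1) (2 * L + 4 * k + 1 - 4 * i)) *
      (2 * real (x + k') + 1)"
    unfolding triangular_product_shift
    by (intro arg_cong2[where f = times] prod.cong refl arg_cong2[where f = pochhammer])
       (use 0 k in \<open>auto simp: triangular_product_def\<close>)
  also have "2 * real (x + k') + 1 = pochhammer (2 * real x + 2 * real (Suc k') - 1) (2 * L + 4 * k + 1 - 4 * Suc k')"
    using 0 k by simp
  finally show ?thesis using 0 k by (simp add: triangular_product_def)
qed

text \<open>Serves even \<open>y\<close>: it rewrites \<open>H n / (2 ^ n * H2 (2 * n + 1))\<close>
  as \<open>H (n + 1) / H2 (2 * n + 2)\<close> and so absorbs the power of \<open>2\<close>.\<close>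

lemma H2_double: "H2 (2 * n + 2) = H2 (2 * n + 1) * (2 ^ n * fact n)"
proof -
  have "H2 (2 * n + 2) = (\<Prod>j<Suc n. fact (2 * j))"
    using H2_even[of "Suc n"] by simp
  also have "\<dots> = (\<Prod>j<n. fact (2 * j + 1) * (2 * real (Suc j)))"
    unfolding prod.lessThan_Suc_shift by (simp add: algebra_simps)
  also have "\<dots> = H2 (2 * n + 1) * (2 ^ n * fact n)"
  proof -
    have "(\<Prod>j<n. real (Suc j)) = fact n" by (simp add: fact_prod_Suc atLeast0LessThan)
    then show ?thesis unfolding H2_odd prod.distrib by (simp only: prod_constant card_lessThan)
  qed
  finally show ?thesis .
qed

lemma selberg_sum_even:
  assumes "even y"
  shows "selberg_sum y (x + y div 2) L =
    (\<Prod>i=1..y div 2. pochhammer (2 * real x + 2 * real i - 1) (2 * L + 2 * y + 1 - 4 * i)) *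
    (H (L + y) * H2 y * H2 (2 * L + y) / (H L * H2 (2 * L + 2 * y)))"
proof (cases "y = 0")
  \<comment> \<open>The half hexagon requires \<open>y >= 1\<close>; for \<open>y = 0\<close> only
    \<open>S = {}\<close> contributes.\<close>
  case True
  have "{S :: nat set. S \<subseteq> {..<x} \<and> card S = 0} = {{}}"
    using finite_subset[of _ "{..<x}"] by auto
  then have "selberg_sum y (x + y div 2) L = 1"
    using True by (simp add: selberg_sum_def dent_product_def vandermonde_def)
  then show ?thesis
    using True H_pos[of L] H2_pos[of "2 * L"] by (simp add: H2_def[of 0])
next
  case False
  then obtain k where k: "y = 2 * k" "k \<ge> 1" using assms by (auto elim!: evenE)
  let ?n = "L + 2 * k - 1"
  let ?Q = "\<Prod>i=1..k. pochhammer (2 * real x + 2 * real i - 1) (2 * L + 4 * k + 1 - 4 * i)"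
  \<comment> \<open>The block of integer points from \<open>x + k\<close> is compared with the half
    hexagon's block of half-integer points from \<open>x\<close>; the common triangular product then
    cancels.\<close>
  have "selberg_sum y (x + k) L * (H L * triangular_product (x + k) (L - 1)) =
      H2 y * H2 (2 * L + y) * (H ?n / 2 ^ ?n * (?Q * triangular_product (x + k) (L - 1)) / H2 (2 * ?n + 1))"
    using selberg_sum_block[of y x L] dent_product_block_even[OF assms, of "x + k" L]
      dent_product_block_odd[of 1 x ?n] triangular_product_shift'[of k x L] k(2)
    by (simp add: k(1) dent_value_def add.commute)
  moreover have "H (Suc ?n) = H ?n * fact ?n" by (simp add: H_def)
  moreover have "H2 (2 * ?n + 2) = H2 (2 * ?n + 1) * (2 ^ ?n * fact ?n)" by (rule H2_double)
  ultimately have "selberg_sum y (x + k) L =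
      ?Q * (H (Suc ?n) * H2 y * H2 (2 * L + y) / (H L * H2 (2 * ?n + 2)))"
    using triangular_product_pos[of "x + k" "L - 1"] H_pos[of L] H2_pos[of "2 * ?n + 1"]
    by (simp add: field_simps)
  moreover have "y div 2 = k" "L + y = Suc ?n" "2 * L + 2 * y = 2 * ?n + 2"
    "2 * L + 2 * y + 1 - 4 * i = 2 * L + 4 * k + 1 - 4 * i" for i
    using k by auto
  ultimately show ?thesis by (simp only:)
qed

text \<open>Both blocks now consist of half-integer points, and \<open>1 / 2 ^ (y - 1)\<close> is
  the quotient of their powers \<open>2 ^ L\<close> and \<open>2 ^ (L + y - 1)\<close>.\<close>

lemma selberg_sum_odd:
  assumes "odd y"
  shows "selberg_sum y (x + (y - 1) div 2) L =
    (\<Prod>i=1..(y - 1) div 2. pochhammer (2 * real x + 2 * real i - 1) (2 * L + 2 * y + 1 - 4 * i)) *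
    (1 / 2 ^ (y - 1)) * (H (L + y - 1) * H2 y * H2 (2 * L + y) / (H L * H2 (2 * L + 2 * y - 1)))"
proof -
  obtain k where k: "y = 2 * k + 1" using assms by (rule oddE)
  let ?n = "L + 2 * k"
  let ?Q = "\<Prod>i=1..k. pochhammer (2 * real x + 2 * real i - 1) (2 * L + 4 * k + 3 - 4 * i)"
  have "selberg_sum y (x + k) L * (H L / 2 ^ L * triangular_product (x + k) L) =
      H2 y * H2 (2 * L + y) * (H ?n / 2 ^ ?n * (?Q * triangular_product (x + k) L) / H2 (2 * ?n + 1))"
    using selberg_sum_block[of y x L] dent_product_block_odd[OF assms, of "x + k" L]
      dent_product_block_odd[of 1 x ?n] triangular_product_shift[of x L k]
    by (simp add: k dent_value_def add.commute)
  then have "selberg_sum y (x + k) L =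
      ?Q * (1 / 2 ^ (2 * k)) * (H ?n * H2 y * H2 (2 * L + y) / (H L * H2 (2 * ?n + 1)))"
    using triangular_product_pos[of "x + k" L] H_pos[of L] H2_pos[of "2 * ?n + 1"]
    by (simp add: field_simps power_add)
  moreover have "(y - 1) div 2 = k" "y - 1 = 2 * k" "L + y - 1 = ?n" "2 * L + 2 * y - 1 = 2 * ?n + 1"
    "2 * L + 2 * y + 1 - 4 * i = 2 * L + 4 * k + 3 - 4 * i" for i
    using k by auto
  ultimately show ?thesis by (simp only:)
qed

theorem theorem1p6:
  fixes x y z n s E O' :: nat and a :: "nat list"
  assumes "a \<noteq> []"
    and "\<forall>k\<in>set a. k > 0"
    and "y + 2 * O_sum a \<ge> term_of a 1 + 1"
    and "n = length a" and "s = s_sum n a" and "E = E_sum a" and "O' = O_sum a"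
  shows "(odd y \<longrightarrow>
      R' x y z a =
        (\<Prod>i=1..(y - 1) div 2.
           pochhammer (2 * real x + 2 * real i - 1) (2 * s + 2 * y + 2 * z + 1 - 4 * i))
        * (1 / 2 ^ (y - 1))
        * ((H (s + y + z - 1) * H2 y * H2 (2 * E + 2 * z + 1) * H2 (2 * O' + 1)
              * H2 (2 * s + y + 2 * z))
           / (H (s + z) * H2 (2 * E + y + 2 * z) * H2 (2 * O' + y)
              * H2 (2 * s + 2 * y + 2 * z - 1)))
        * Q' ((x + (y - 1) div 2 + term_of a (2 * ((n + 1) div 2)))
              # rev_prefix a (2 * ((n + 1) div 2) - 1))
        * Q' ((x + (y - 1) div 2 + term_of a (2 * (n div 2) + 1))
              # rev_prefix a (2 * (n div 2)) @ [z]))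
    \<and> (even y \<longrightarrow>
      R' x y z a =
        (\<Prod>i=1..y div 2.
           pochhammer (2 * real x + 2 * real i - 1) (2 * s + 2 * y + 2 * z + 1 - 4 * i))
        * ((H (s + y + z) * H2 y * H2 (2 * E + 2 * z) * H2 (2 * O')
              * H2 (2 * s + y + 2 * z))
           / (H (s + z) * H2 (2 * E + y + 2 * z) * H2 (2 * O' + y)
              * H2 (2 * s + 2 * y + 2 * z)))
        * K' ((x + y div 2 + term_of a (2 * ((n + 1) div 2)))
              # rev_prefix a (2 * ((n + 1) div 2) - 1))
        * K' ((x + y div 2 + term_of a (2 * (n div 2) + 1))
              # rev_prefix a (2 * (n div 2)) @ [z]))"
proof -
  let ?m = "x + y div 2" and ?L = "s + z"
  have R: "R' x y z a = selberg_sum y ?m ?L * dent_product y (fern_dents odd ?m a) *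
      dent_product y (fern_dents odd ?m (z # a)) / (H2 (2 * O' + y) * H2 (2 * E + y + 2 * z))"
    using R'_factorization[of y a x z] assms(3-7) by simp
  have eqs: "s + y + z = ?L + y" "2 * s + y + 2 * z = 2 * ?L + y" "2 * s + 2 * y + 2 * z = 2 * ?L + 2 * y"
    by simp_all
  \<comment> \<open>Expressing the dent products by \<open>Q'\<close> or \<open>K'\<close> brings in
    the two \<open>H2\<close> factors of the numerator that contain only \<open>O'\<close>, or only
    \<open>E\<close> and \<open>z\<close>.\<close>
  note products = dent_products_reversed(1,3)[OF assms(1), where y = y and m = ?m, folded assms(4,7)]
    dent_products_reversed(2,4)[OF assms(1), where y = y and z = z and m = ?m, folded assms(4,6)]
  show ?thesis
  proof (intro conjI impI)
    assume y: "odd y"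
    then have m: "x + (y - 1) div 2 = ?m" by (auto elim!: oddE)
    show "R' x y z a =
        (\<Prod>i=1..(y - 1) div 2.
           pochhammer (2 * real x + 2 * real i - 1) (2 * s + 2 * y + 2 * z + 1 - 4 * i))
        * (1 / 2 ^ (y - 1))
        * ((H (s + y + z - 1) * H2 y * H2 (2 * E + 2 * z + 1) * H2 (2 * O' + 1)
              * H2 (2 * s + y + 2 * z))
           / (H (s + z) * H2 (2 * E + y + 2 * z) * H2 (2 * O' + y)
              * H2 (2 * s + 2 * y + 2 * z - 1)))
        * Q' ((x + (y - 1) div 2 + term_of a (2 * ((n + 1) div 2)))
              # rev_prefix a (2 * ((n + 1) div 2) - 1))
        * Q' ((x + (y - 1) div 2 + term_of a (2 * (n div 2) + 1))
              # rev_prefix a (2 * (n div 2)) @ [z])"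
      unfolding R m eqs products(1,3)[OF y] selberg_sum_odd[OF y, of x ?L, unfolded m]
      by (simp only: times_divide_eq_left times_divide_eq_right divide_divide_eq_left mult_ac)
  next
    assume y: "even y"
    show "R' x y z a =
        (\<Prod>i=1..y div 2.
           pochhammer (2 * real x + 2 * real i - 1) (2 * s + 2 * y + 2 * z + 1 - 4 * i))
        * ((H (s + y + z) * H2 y * H2 (2 * E + 2 * z) * H2 (2 * O')
              * H2 (2 * s + y + 2 * z))
           / (H (s + z) * H2 (2 * E + y + 2 * z) * H2 (2 * O' + y)
              * H2 (2 * s + 2 * y + 2 * z)))
        * K' ((x + y div 2 + term_of a (2 * ((n + 1) div 2)))
              # rev_prefix a (2 * ((n + 1) div 2) - 1))
        * K' ((x + y div 2 + term_of a (2 * (n div 2) + 1))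
              # rev_prefix a (2 * (n div 2)) @ [z])"
      unfolding R eqs products(2,4)[OF y] selberg_sum_even[OF y, of x ?L]
      by (simp only: times_divide_eq_left times_divide_eq_right divide_divide_eq_left mult_ac)
  qed
qed

end
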